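(* Let $n>m\ge1$ be integers, $k\ge1$, and $t=m(n-m)$. Let \[ \eta=\begin{cases}\frac{1}{t!}\prod_{i=1}^{m}\frac{(n-i)!}{(m-i)!} & \text{if } 1\le m\le \frac{n}{2},\\[2pt] \frac{1}{t!}\prod_{i=1}^{n-m}\frac{(n-i)!}{(n-m-i)!} & \text{if } \frac{n}{2}\le m\le n.\end{cases} \] Let $Q^{(k)}$ be uniformly distributed on the composite Grassmann manifold $\mathcal{G}^{(k)}_{n,m}(\mathbb{C})$, and for a positive integer $K$ define the distortion rate function \[ D^*(K)=\inf_{\mathcal{C}\subset\mathcal{G}^{(k)}_{n,m}(\mathbb{C}),\ |\mathcal{C}|=K}\ \mathrm{E}\left[\min_{P^{(k)}\in\mathcal{C}}d_c^2\left(P^{(k)},Q^{(k)}\right)\right]. \] Then, with $A=\left(\frac{\Gamma^{k}(t+1)}{\Gamma(kt+1)}\eta^{k}\right)^{-\frac{1}{kt}}$, \[ \frac{kt}{kt+1}\,A\,2^{-\frac{\log_2K}{kt}}\ \lesssim\ D^*(K)\ \lesssim\ \frac{\Gamma\left(\frac{1}{kt}\right)}{kt}\,A\,2^{-\frac{\log_2K}{kt}}, \] where $f(K)\lesssim g(K)$ means $\limsup_{K\to+\infty}\frac{f(K)}{g(K)}\le 1$.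
   Context: The Grassmann manifold $\mathcal{G}_{n,m}(\mathbb{C})$ is the set of $m$-dimensional subspaces of $\mathbb{C}^n$. A generator matrix $\mathbf{P}\in\mathbb{C}^{n\times m}$ of $P\in\mathcal{G}_{n,m}(\mathbb{C})$ has orthonormal columns spanning $P$. The chordal distance is $d_c(P_1,P_2)=\frac{1}{\sqrt2}\|\mathbf{P}_1\mathbf{P}_1^{\dagger}-\mathbf{P}_2\mathbf{P}_2^{\dagger}\|_F$. The $k$-composite Grassmann manifold $\mathcal{G}^{(k)}_{n,m}(\mathbb{C})$ is the Cartesian product of $k$ copies of $\mathcal{G}_{n,m}(\mathbb{C})$, with elements $P^{(k)}=(P_1,\dots,P_k)$, and chordal distance $d_c(P^{(k)}_1,P^{(k)}_2)=\sqrt{\sum_{i=1}^{k}d_c^2(P_{1,i},P_{2,i})}$. The uniform distribution on $\mathcal{G}^{(k)}_{n,m}(\mathbb{C})$ is the product of the (unitarily invariant) uniform distributions on each factor. *)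

theory Defs
  imports "HOL-Probability.Probability"
begin

text \<open>Complex n x n matrices are represented as complex^'n^'n, with n = CARD('n).
  A point of the Grassmannian G_{n,m}(C) is represented by the orthogonal projection
  P P^H onto it, where P is a generator matrix (n x m, orthonormal columns);
  the m columns of P are given as vectors v 0, ..., v (m-1).\<close>

definition cadj :: "complex^'n^'n \<Rightarrow> complex^'n^'n" where
  "cadj M = (\<chi> i j. cnj (M $ j $ i))"

definition unitary_mat :: "complex^'n^'n \<Rightarrow> bool" where
  "unitary_mat U \<longleftrightarrow> U ** cadj U = mat 1 \<and> cadj U ** U = mat 1"

definition orthonormal_cols :: "nat \<Rightarrow> (nat \<Rightarrow> complex^'n) \<Rightarrow> bool" where
  "orthonormal_cols m v \<longleftrightarrow>
     (\<forall>i<m. \<forall>j<m. (\<Sum>a\<in>UNIV. cnj (v i $ a) * v j $ a) = (if i = j then 1 else 0))"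

definition gen_proj :: "nat \<Rightarrow> (nat \<Rightarrow> complex^'n) \<Rightarrow> complex^'n^'n" where
  "gen_proj m v = (\<chi> a b. \<Sum>i<m. v i $ a * cnj (v i $ b))"

definition grassmann :: "nat \<Rightarrow> (complex^'n^'n) set" where
  "grassmann m = {gen_proj m v | v. orthonormal_cols m v}"

definition frob_norm :: "complex^'n^'n \<Rightarrow> real" where
  "frob_norm M = sqrt (\<Sum>i\<in>UNIV. \<Sum>j\<in>UNIV. (cmod (M $ i $ j))\<^sup>2)"

definition chordal_dist :: "complex^'n^'n \<Rightarrow> complex^'n^'n \<Rightarrow> real" where
  "chordal_dist P1 P2 = frob_norm (P1 - P2) / sqrt 2"

definition comp_grassmann :: "nat \<Rightarrow> nat \<Rightarrow> (nat \<Rightarrow> complex^'n^'n) set" where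
  "comp_grassmann k m = PiE {..<k} (\<lambda>_. grassmann m)"

definition comp_chordal_dist ::
  "nat \<Rightarrow> (nat \<Rightarrow> complex^'n^'n) \<Rightarrow> (nat \<Rightarrow> complex^'n^'n) \<Rightarrow> real" where
  "comp_chordal_dist k P Q = sqrt (\<Sum>i<k. (chordal_dist (P i) (Q i))\<^sup>2)"

definition uniform_grassmann :: "nat \<Rightarrow> (complex^'n^'n) measure \<Rightarrow> bool" where
  "uniform_grassmann m \<mu> \<longleftrightarrow>
     sets \<mu> = sets borel \<and> prob_space \<mu> \<and> emeasure \<mu> (grassmann m) = 1 \<and>
     (\<forall>U. unitary_mat U \<longrightarrow> distr \<mu> \<mu> (\<lambda>P. U ** P ** cadj U) = \<mu>)"

definition comp_uniform :: "nat \<Rightarrow> (complex^'n^'n) measure \<Rightarrow> (nat \<Rightarrow> complex^'n^'n) measure" where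
  "comp_uniform k \<mu> = PiM {..<k} (\<lambda>_. \<mu>)"

definition distortion_rate ::
  "nat \<Rightarrow> nat \<Rightarrow> (complex^'n^'n) measure \<Rightarrow> nat \<Rightarrow> real" where
  "distortion_rate k m \<mu> K =
     (INF C \<in> {C. C \<subseteq> comp_grassmann k m \<and> finite C \<and> card C = K}.
        integral\<^sup>L (comp_uniform k \<mu>)
          (\<lambda>Q. Min ((\<lambda>P. (comp_chordal_dist k P Q)\<^sup>2) ` C)))"

definition eta_const :: "nat \<Rightarrow> nat \<Rightarrow> real" where
  "eta_const n m =
     (let t = m * (n - m) in
      if 2 * m \<le> n
      then (1 / fact t) * (\<Prod>i=1..m. fact (n - i) / fact (m - i))
      else (1 / fact t) * (\<Prod>i=1..n-m. fact (n - i) / fact (n - m - i)))"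

end

(*
  Idea.  An invariant measure gives all chordal balls of radius sqrt x the same measure F(x), and
  by Fubini F(x) is also the probability that the span of m independent Gaussian vectors lies in a
  given ball.  Along the Gram-Schmidt process the squared chordal distance to a fixed subspace P is
  the sum over j of |(1 - P) u_j|^2; given u_1, ..., u_{j-1} close to P, the j-th summand is up to a
  factor 1 - O(x) a ratio X / (X + Y) of independent Gamma variables with parameters n - m and
  m - j + 1.  Convolving these power laws gives F(x) ~ eta x^t, and convolving once more over the
  k factors gives the volume c x^(kt) of balls in the composite manifold.  The upper bound is then
  a random coding argument, and the lower bound holds because a code of size K covers at most the
  proportion K c x^(kt) of the manifold within squared distance x.
*)

theory Submission
  imports Defs
begin

text \<open>Complex coordinates come in real pairs, so their sums of squares are Gamma variables
  with integer parameter. Small-ball probabilities are then monomials up to a factor between 1 - r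
  and 1, and every convolution is a Beta integral with integer exponents: the factorials in eta come
  from there. The obstacle is that the earlier vectors are only close to P, so the next residual
  does not split exactly along P and its complement; an adapted frame, correct up to a factor
  between 1 - x and 1, replaces the exact splitting. Errors pass through further integrals and must
  be uniform in centre and radius, hence explicit two-sided bounds on a range x <= x0, with x0
  chosen small only at the end. The constants, with p = kt: integrating the covering estimate bounds
  the distortion below by x - K c x^(p+1) / (p+1); this is maximal at K c x^p = 1, which gives the
  factor p / (p+1). A random code exceeds distortion y with probability about exp (- K c y^p), whose
  integral over y >= 0 is Gamma (1/p) / p times (K c)^(-1/p).\<close>

section \<open>Gaussian vectors\<close>

text \<open>Both sides are translation invariant and agree on a ball, so integrating
  \<open>indicator A (T x + y) * indicator B y\<close> in either order (the uniqueness proof for Haar measure) shows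
  that they agree everywhere.\<close>

lemma lborel_distr_orthogonal_transformation:
  fixes T :: "'a::euclidean_space \<Rightarrow> 'a"
  assumes T: "orthogonal_transformation T"
  shows "distr lborel borel T = lborel"
proof (rule measure_eqI)
  have lin: "linear T" using T by (rule orthogonal_transformation_linear)
  have [measurable]: "T \<in> borel_measurable borel"
    using lin by (intro borel_measurable_continuous_onI linear_continuous_on linear_conv_bounded_linear[THEN iffD1])
  have translate: "(\<integral>\<^sup>+x. h (c + x) \<partial>lborel) = (\<integral>\<^sup>+x. h x \<partial>lborel)"
    if [measurable]: "h \<in> borel_measurable borel" for h and c :: 'a
    by (subst (2) lborel_distr_plus[of c, symmetric], subst nn_integral_distr) auto
  define B where "B = cball (0::'a) 1"
  have [measurable]: "B \<in> sets borel" by (simp add: B_def)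
  fix A assume "A \<in> sets (distr lborel borel T)"
  then have [measurable]: "A \<in> sets borel" by simp
  let ?N = "distr lborel borel T" and ?I = "\<lambda>x y. indicator A (T x + y) * indicator B y :: ennreal"
  define J where "J = (\<integral>\<^sup>+y. \<integral>\<^sup>+x. ?I x y \<partial>lborel \<partial>(lborel::'a measure))"
  have "J = (\<integral>\<^sup>+y. emeasure ?N A * indicator B y \<partial>lborel)"
    unfolding J_def
  proof (rule nn_integral_cong)
    fix y :: 'a
    \<comment> \<open>Pulling y back to z turns the shift by y inside \<open>T x + y\<close> into a
      shift of x by z, under which \<open>lborel\<close> is invariant.\<close>
    obtain z where z: "y = T z" using orthogonal_transformation_surj[OF T] by (metis surjD)
    have "(\<integral>\<^sup>+x. ?I x y \<partial>lborel) = (\<integral>\<^sup>+x. indicator A (T x + y) \<partial>lborel) * indicator B y"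
      by (rule nn_integral_multc) simp
    also have "(\<integral>\<^sup>+x. indicator A (T x + y) \<partial>lborel) = (\<integral>\<^sup>+x. indicator A (T (z + x)) \<partial>lborel)"
      by (simp add: z linear_add[OF lin] add.commute)
    also have "\<dots> = (\<integral>\<^sup>+x. indicator A (T x) \<partial>lborel)"
      by (rule translate[of "\<lambda>x. indicator A (T x)"]) measurable
    also have "\<dots> = (\<integral>\<^sup>+x. indicator A x \<partial>distr lborel borel T)"
      by (subst nn_integral_distr) auto
    also have "\<dots> = emeasure ?N A" by simp
    finally show "(\<integral>\<^sup>+x. ?I x y \<partial>lborel)
       = emeasure ?N A * indicator B y" .
  qed
  also have "\<dots> = emeasure ?N A * emeasure lborel B"
    by (subst nn_integral_cmult) auto
  finally have J1: "J = emeasure ?N A * emeasure lborel B" .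
  have "J = (\<integral>\<^sup>+x. \<integral>\<^sup>+y. ?I x y \<partial>lborel \<partial>(lborel::'a measure))"
    unfolding J_def by (rule lborel_pair.Fubini') measurable
  also have "\<dots> = (\<integral>\<^sup>+x. \<integral>\<^sup>+y. indicator A y * indicator B (y - T x) \<partial>lborel \<partial>(lborel::'a measure))"
  proof (rule nn_integral_cong)
    fix x :: 'a
    have "(\<integral>\<^sup>+y. ?I x y \<partial>lborel)
        = (\<integral>\<^sup>+y. indicator A (T x + y) * indicator B ((T x + y) - T x) \<partial>lborel)" by simp
    also have "\<dots> = (\<integral>\<^sup>+y. indicator A y * indicator B (y - T x) \<partial>lborel)"
      by (rule translate[of "\<lambda>y. indicator A y * indicator B (y - T x)"]) measurable
    finally show "(\<integral>\<^sup>+y. ?I x y \<partial>lborel)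
      = (\<integral>\<^sup>+y. indicator A y * indicator B (y - T x) \<partial>lborel)" .
  qed
  also have "\<dots> = (\<integral>\<^sup>+y. \<integral>\<^sup>+x. indicator A y * indicator B (y - T x) \<partial>lborel \<partial>(lborel::'a measure))"
    by (rule lborel_pair.Fubini') measurable
  also have "\<dots> = (\<integral>\<^sup>+y. indicator A y * emeasure lborel B \<partial>lborel)"
  proof (rule nn_integral_cong)
    fix y :: 'a
    obtain z where z: "y = T z" using orthogonal_transformation_surj[OF T] by (metis surjD)
    \<comment> \<open>T preserves norms and \<open>B\<close> is centred at 0, so in the variable x
      the constraint is the unit ball around z, whose volume does not depend on y.\<close>
    have "indicator B (y - T x) = (indicator B (- z + x) :: ennreal)" for x
    proof -
      have "norm (y - T x) = norm (T (z - x))" by (simp add: z linear_diff[OF lin])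
      also have "\<dots> = norm (- z + x)"
        using orthogonal_transformation_norm[OF T] by (metis add.commute norm_minus_commute uminus_add_conv_diff)
      finally show ?thesis by (simp add: B_def indicator_def)
    qed
    then have "(\<integral>\<^sup>+x. indicator A y * indicator B (y - T x) \<partial>lborel) = indicator A y * (\<integral>\<^sup>+x. indicator B (- z + x) \<partial>lborel)"
      by (simp add: nn_integral_cmult)
    also have "(\<integral>\<^sup>+x. indicator B (- z + x) \<partial>lborel) = (\<integral>\<^sup>+x. indicator B x \<partial>lborel)"
      by (rule translate) measurable
    finally show "(\<integral>\<^sup>+x. indicator A y * indicator B (y - T x) \<partial>lborel) = indicator A y * emeasure lborel B"
      by simp
  qed
  also have "\<dots> = emeasure lborel A * emeasure lborel B"
    by (subst nn_integral_multc) auto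
  finally have J2: "J = emeasure lborel A * emeasure lborel B" .
  have "emeasure lborel B \<noteq> 0" "emeasure lborel B \<noteq> \<top>"
    using emeasure_lborel_cball_finite[of "0::'a" 1] emeasure_lborel_cbox_finite
    by (auto simp: B_def emeasure_cball unit_ball_vol_pos less_imp_neq[symmetric] ennreal_eq_0_iff not_le)
  then show "emeasure ?N A = emeasure lborel A"
    using J1 J2 by (auto simp: mult.commute[of _ "emeasure lborel B"] ennreal_mult_cancel_left)
qed simp

text \<open>The variance 1/2 is chosen so that sums of squares of an even number of coordinates are
  Gamma variables of rate 1, without a scale parameter.\<close>

lemma nn_integral_exp_square: "(\<integral>\<^sup>+x. ennreal (exp (- x\<^sup>2) / sqrt pi) \<partial>lborel) = 1"
proof -
  interpret prob_space "density lborel (normal_density 0 (1 / sqrt 2))"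
    by (rule prob_space_normal_density) simp
  have "emeasure (density lborel (normal_density 0 (1 / sqrt 2))) UNIV = 1"
    using emeasure_space_1 by simp
  moreover have "normal_density 0 (1 / sqrt 2) x = exp (- x\<^sup>2) / sqrt pi" for x
    by (simp add: normal_density_def power_divide)
  ultimately show ?thesis by (simp add: emeasure_density)
qed

section \<open>Gaussian density in coordinates and the Gamma law of sums of squares\<close>

abbreviation lborel_PiM :: "'b set \<Rightarrow> ('b \<Rightarrow> real) measure" where
  "lborel_PiM A \<equiv> PiM A (\<lambda>_. lborel)"

text \<open>The Gaussian density relative to a Lebesgue product over any index set. Written as a
  product it factors along disjoint unions, so coordinates outside the sets of interest can be
  integrated out with mass 1.\<close>

definition gauss_weight :: "'b set \<Rightarrow> ('b \<Rightarrow> real) \<Rightarrow> ennreal" where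
  "gauss_weight A f = (\<Prod>b\<in>A. ennreal (exp (- (f b)\<^sup>2) / sqrt pi))"

lemma gauss_weight_measurable [measurable]:
  "A \<subseteq> C \<Longrightarrow> gauss_weight A \<in> borel_measurable (lborel_PiM C)"
  unfolding gauss_weight_def[abs_def]
  by (rule borel_measurable_prod_ennreal) (auto intro!: measurable_compose[OF measurable_component_singleton])

lemma gauss_weight_eq:
  "finite A \<Longrightarrow> gauss_weight A f = ennreal (exp (- (\<Sum>b\<in>A. (f b)\<^sup>2)) / sqrt pi ^ card A)"
  by (simp add: gauss_weight_def prod_ennreal prod_dividef sum_negf[symmetric] exp_sum)

lemma gauss_weight_merge:
  assumes "I \<inter> J = {}" "finite I" "finite J"
  shows "gauss_weight (I \<union> J) (merge I J (x, y)) = gauss_weight I x * gauss_weight J y"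
proof -
  have "gauss_weight (I \<union> J) (merge I J (x, y)) = gauss_weight I (merge I J (x, y)) * gauss_weight J (merge I J (x, y))"
    unfolding gauss_weight_def using assms by (intro prod.union_disjoint) auto
  moreover have "gauss_weight I (merge I J (x, y)) = gauss_weight I x"
    unfolding gauss_weight_def by (intro prod.cong refl) (auto simp: merge_def)
  moreover have "gauss_weight J (merge I J (x, y)) = gauss_weight J y"
    unfolding gauss_weight_def using assms by (intro prod.cong refl) (auto simp: merge_def)
  ultimately show ?thesis by simp
qed

lemma nn_integral_gauss_weight:
  "finite A \<Longrightarrow> (\<integral>\<^sup>+f. gauss_weight A f \<partial>lborel_PiM A) = 1"
proof -
  assume A: "finite A"
  interpret product_sigma_finite "\<lambda>_::'a. lborel :: real measure" by standard
  show ?thesis unfolding gauss_weight_def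
    by (subst product_nn_integral_prod[OF A]) (auto simp: nn_integral_exp_square)
qed

lemma DERIV_power_fact:
  "((\<lambda>x. c * x ^ Suc k / fact (Suc k)) has_real_derivative c * (x ^ k / fact k)) (at x)"
proof -
  have "((\<lambda>x. (c / fact (Suc k)) * x ^ Suc k) has_real_derivative (c / fact (Suc k)) * (real (Suc k) * x ^ (Suc k - Suc 0))) (at x)"
    by (rule DERIV_cmult) (rule DERIV_pow)
  moreover have "(c / fact (Suc k)) * (real (Suc k) * x ^ (Suc k - Suc 0)) = c * (x ^ k / fact k)"
    by (simp del: of_nat_Suc)
  ultimately show ?thesis by (simp del: power_Suc fact_Suc)
qed

lemma nn_integral_power_Icc:
  assumes r: "0 \<le> r" and c: "0 \<le> c"
  shows "(\<integral>\<^sup>+x. ennreal (c * (x ^ k / fact k)) * indicator {0..r} x \<partial>lborel) = ennreal (c * r ^ Suc k / fact (Suc k))"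
proof -
  have "(\<lambda>x. c * (x ^ k / fact k)) \<in> borel_measurable borel" by measurable
  then have "(\<integral>\<^sup>+x. ennreal (c * (x ^ k / fact k)) * indicator {0..r} x \<partial>lborel)
    = ennreal (c * r ^ Suc k / fact (Suc k) - c * 0 ^ Suc k / fact (Suc k))"
    by (rule nn_integral_FTC_Icc[OF _ DERIV_power_fact _ r]) (use c in simp)
  also have "c * r ^ Suc k / fact (Suc k) - c * 0 ^ Suc k / fact (Suc k) = c * r ^ Suc k / fact (Suc k)"
    by (simp only: power_0_Suc mult_zero_right div_0 diff_zero)
  finally show ?thesis .
qed

lemma borel_measurable_sum_squares:
  "A \<subseteq> C \<Longrightarrow> (\<lambda>f. \<Sum>b\<in>A. (f b)\<^sup>2) \<in> borel_measurable (lborel_PiM C)"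
  by (intro borel_measurable_sum borel_measurable_power measurable_compose[OF measurable_component_singleton]) auto

text \<open>The ball of radius sqrt r in dimension 2 (k + 1) has volume pi^(k+1) r^(k+1) / (k+1)!,
  and the density is its derivative in r. In even dimension this involves no half-integer Gamma
  values.\<close>

lemma distr_sum_squares_lborel:
  fixes A :: "'b set"
  assumes A: "finite A" "card A = 2 * Suc k"
  shows "distr (lborel_PiM A) borel (\<lambda>f. \<Sum>b\<in>A. (f b)\<^sup>2)
       = density lborel (\<lambda>r. ennreal (pi ^ Suc k * r ^ k / fact k) * indicator {0..} r)" (is "?L = ?R")
proof -
  note [measurable] = borel_measurable_sum_squares[of A A]
  have L: "emeasure ?L {..r} = ennreal (pi ^ Suc k * r ^ Suc k / fact (Suc k))" if r: "r > 0" for r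
  proof -
    have "emeasure ?L {..r} = emeasure (lborel_PiM A) ({f. sqrt (\<Sum>i\<in>A. (f i)\<^sup>2) \<le> sqrt r} \<inter> space (lborel_PiM A))"
      by (subst emeasure_distr) (auto intro!: arg_cong2[where f=emeasure])
    also have "\<dots> = ennreal (unit_ball_vol (real (card A)) * (sqrt r) ^ card A)"
      using r A by (intro emeasure_cball_aux) auto
    also have "unit_ball_vol (real (card A)) = pi ^ Suc k / fact (Suc k)"
      using unit_ball_vol_even[of "Suc k"] A by simp
    also have "(sqrt r) ^ card A = r ^ Suc k" using r unfolding A power_mult by simp
    finally show ?thesis by simp
  qed
  have R: "emeasure ?R {..r} = ennreal (pi ^ Suc k * r ^ Suc k / fact (Suc k))" if r: "r > 0" for r
  proof -
    have "emeasure ?R {..r} = (\<integral>\<^sup>+x. ennreal (pi ^ Suc k * x ^ k / fact k) * indicator {0..r} x \<partial>lborel)"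
      by (subst emeasure_density) (auto intro!: nn_integral_cong simp: indicator_def)
    also have "\<dots> = ennreal (pi ^ Suc k * r ^ Suc k / fact (Suc k))"
      using nn_integral_power_Icc[of r "pi ^ Suc k" k] r by (simp del: power_Suc fact_Suc)
    finally show ?thesis .
  qed
  show ?thesis
  \<comment> \<open>The exhausting sequence starts at 1 because the volume formula \<open>L\<close>
    is available for positive r only.\<close>
  proof (rule measure_eqI_generator_eq[where E="range atMost" and \<Omega>=UNIV and A="\<lambda>i. {..real (Suc i)}"])
    show "Int_stable (range (atMost :: real \<Rightarrow> _))"
      by (auto simp: Int_stable_def)
    show "range (atMost :: real \<Rightarrow> _) \<subseteq> Pow UNIV" by simp
    show "range (\<lambda>i. {..real (Suc i)}) \<subseteq> range atMost" by blast
    show "sets ?L = sigma_sets UNIV (range atMost)" "sets ?R = sigma_sets UNIV (range atMost)"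
      by (simp_all add: borel_eq_atMost)
    show "(\<Union>i. {..real (Suc i)}) = UNIV"
    proof (intro set_eqI iffI UNIV_I)
      fix x :: real
      obtain n where "x \<le> real n" using real_arch_simple by blast
      then show "x \<in> (\<Union>i. {..real (Suc i)})" by (intro UN_I[of n]) auto
    qed
    show "emeasure ?L {..real (Suc i)} \<noteq> \<infinity>" for i
      unfolding L[of "real (Suc i)", OF of_nat_0_less_iff[THEN iffD2, OF zero_less_Suc]] by simp
    fix X assume "X \<in> range (atMost :: real \<Rightarrow> _)"
    then obtain r where X: "X = {..r}" by auto
    show "emeasure ?L X = emeasure ?R X"
    proof (cases "r > 0")
      case True then show ?thesis by (simp only: X L R)
    next
      case False
      have "emeasure ?L {..r} \<le> ennreal e" if e: "e > 0" for e
      proof -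
        define c where "c = pi ^ Suc k / fact (Suc k)"
        have c: "c > 0" by (simp add: c_def)
        \<comment> \<open>With x <= 1, c x^(k+1) <= c x <= e; so half-lines ending at a nonpositive
          r have arbitrarily small measure.\<close>
        define x where "x = min 1 (e / c)"
        have x: "x > 0" using e c by (simp add: x_def)
        have "emeasure ?L {..r} \<le> emeasure ?L {..x}" using False x by (intro emeasure_mono) auto
        also have "\<dots> = ennreal (c * (x * x ^ k))" by (subst L[OF x]) (simp add: c_def)
        also have "\<dots> \<le> ennreal e"
        proof (rule ennreal_leI)
          have "x * x ^ k \<le> x * 1" using x by (intro mult_left_mono power_le_one) (auto simp: x_def)
          also have "\<dots> \<le> e / c" by (simp add: x_def)
          finally show "c * (x * x ^ k) \<le> e" using c by (simp add: field_simps)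
        qed
        finally show ?thesis .
      qed
      note small = this
      have "emeasure ?L {..r} \<le> 0"
      proof (rule ennreal_le_epsilon)
        fix e :: real assume "0 < e"
        from small[OF this] show "emeasure ?L {..r} \<le> 0 + ennreal e" by (simp only: add_0)
      qed
      then have l0: "emeasure ?L {..r} = 0" by (simp only: le_zero_eq)
      have "emeasure ?R {..r} \<le> emeasure ?R {..0}" using False by (intro emeasure_mono) auto
      also have "emeasure ?R {..0} = 0"
      proof -
        have "emeasure ?R {..0} = (\<integral>\<^sup>+x. ennreal (pi ^ Suc k * x ^ k / fact k) * indicator {0..} x * indicator {..0} x \<partial>lborel)"
          by (rule emeasure_density) measurable
        also have "\<dots> = (\<integral>\<^sup>+x. 0 \<partial>(lborel :: real measure))"
          by (rule nn_integral_cong_AE)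
            (use AE_lborel_singleton[of "0::real"] in eventually_elim, auto simp: indicator_def)
        finally show ?thesis by simp
      qed
      finally have r0: "emeasure ?R {..r} = 0" by (simp only: le_zero_eq)
      show ?thesis by (simp only: X l0 r0)
    qed
  qed
qed

text \<open>The weight is exp (- r) / pi^(k+1) in terms of the sum of squares r, and pi^(k+1)
  cancels against the density of the pushforward. Note that \<open>erlang_density k\<close> has
  shape parameter k + 1.\<close>

lemma nn_integral_sum_squares_gauss_weight:
  fixes A :: "'b set"
  assumes A: "finite A" "card A = 2 * Suc k" and [measurable]: "\<phi> \<in> borel_measurable borel"
  shows "(\<integral>\<^sup>+f. \<phi> (\<Sum>b\<in>A. (f b)\<^sup>2) * gauss_weight A f \<partial>lborel_PiM A)
       = (\<integral>\<^sup>+r. \<phi> r * ennreal (erlang_density k 1 r) \<partial>lborel)"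
proof -
  note [measurable] = borel_measurable_sum_squares[of A A]
  have pow: "sqrt pi ^ card A = pi ^ Suc k" unfolding A power_mult by simp
  have "(\<integral>\<^sup>+f. \<phi> (\<Sum>b\<in>A. (f b)\<^sup>2) * gauss_weight A f \<partial>lborel_PiM A)
     = (\<integral>\<^sup>+r. \<phi> r * ennreal (exp (- r) / pi ^ Suc k) \<partial>distr (lborel_PiM A) borel (\<lambda>f. \<Sum>b\<in>A. (f b)\<^sup>2))"
    by (subst nn_integral_distr) (auto simp: gauss_weight_eq A(1) pow simp del: power_Suc)
  also have "\<dots> = (\<integral>\<^sup>+r. \<phi> r * ennreal (erlang_density k 1 r) \<partial>lborel)"
    unfolding distr_sum_squares_lborel[OF A]
    by (subst nn_integral_density)
      (auto intro!: nn_integral_cong simp: erlang_density_def indicator_def ennreal_mult'[symmetric] ac_simps)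
  finally show ?thesis .
qed

text \<open>On \<open>complex^'n\<close>, where \<open>DIM\<close> is 2n, this is the law of n
  independent complex Gaussians with density exp (- |z|^2) / pi.\<close>

definition gauss :: "'a::euclidean_space measure" where
  "gauss = density lborel (\<lambda>x. ennreal (exp (- (norm x)\<^sup>2) / sqrt pi ^ DIM('a)))"

lemma sets_gauss [simp, measurable_cong]: "sets gauss = sets borel"
  and space_gauss [simp]: "space gauss = UNIV"
  by (simp_all add: gauss_def)

lemma nn_integral_gauss_PiM:
  fixes h :: "'a::euclidean_space \<Rightarrow> ennreal"
  assumes [measurable]: "h \<in> borel_measurable borel"
  shows "(\<integral>\<^sup>+x. h x \<partial>gauss)
    = (\<integral>\<^sup>+f. h (\<Sum>b\<in>Basis. f b *\<^sub>R b) * gauss_weight Basis f \<partial>PiM (Basis::'a set) (\<lambda>_. lborel))"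
proof -
  have "(\<integral>\<^sup>+x. h x \<partial>gauss) = (\<integral>\<^sup>+x. h x * ennreal (exp (- (norm x)\<^sup>2) / sqrt pi ^ DIM('a)) \<partial>lborel)"
    unfolding gauss_def by (subst nn_integral_density) (auto simp: ac_simps)
  also have "\<dots> = (\<integral>\<^sup>+f. h (\<Sum>b\<in>Basis. f b *\<^sub>R b) *
      ennreal (exp (- (norm (\<Sum>b\<in>Basis. f b *\<^sub>R b))\<^sup>2) / sqrt pi ^ DIM('a)) \<partial>PiM (Basis::'a set) (\<lambda>_. lborel))"
    by (subst lborel_eq, subst nn_integral_distr) auto
  also have "\<dots> = (\<integral>\<^sup>+f. h (\<Sum>b\<in>Basis. f b *\<^sub>R b) * gauss_weight Basis f \<partial>PiM (Basis::'a set) (\<lambda>_. lborel))"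
  proof (intro nn_integral_cong arg_cong2[where f="(*)"] refl)
    fix f :: "'a \<Rightarrow> real"
    have "(norm (\<Sum>b\<in>Basis. f b *\<^sub>R b))\<^sup>2 = (\<Sum>b\<in>Basis. (f b)\<^sup>2)"
      unfolding power2_norm_eq_inner by (subst euclidean_inner) (simp add: power2_eq_square)
    then show "ennreal (exp (- (norm (\<Sum>b\<in>Basis. f b *\<^sub>R b))\<^sup>2) / sqrt pi ^ DIM('a)) = gauss_weight Basis f"
      by (simp add: gauss_weight_eq)
  qed
  finally show ?thesis .
qed

lemma prob_space_gauss: "prob_space (gauss :: 'a::euclidean_space measure)"
proof
  show "emeasure (gauss :: 'a measure) (space gauss) = 1"
    using nn_integral_gauss_PiM[of "\<lambda>_::'a. 1"] nn_integral_gauss_weight[of "Basis::'a set"] by simp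
qed

lemma nn_integral_gauss_orthogonal_transformation:
  fixes T :: "'a::euclidean_space \<Rightarrow> 'a"
  assumes T: "orthogonal_transformation T" and [measurable]: "h \<in> borel_measurable borel"
  shows "(\<integral>\<^sup>+x. h (T x) \<partial>gauss) = (\<integral>\<^sup>+x. h x \<partial>gauss)"
proof -
  have lin: "linear T" using T by (rule orthogonal_transformation_linear)
  have [measurable]: "T \<in> borel_measurable borel"
    using lin by (intro borel_measurable_continuous_onI linear_continuous_on linear_conv_bounded_linear[THEN iffD1])
  show ?thesis unfolding gauss_def
    apply (subst nn_integral_density, measurable)
    apply (subst nn_integral_density, measurable)
    apply (subst (2) lborel_distr_orthogonal_transformation[OF T, symmetric])
    apply (subst nn_integral_distr)
      apply (auto simp: orthogonal_transformation_norm[OF T])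
    done
qed

abbreviation sq_sum :: "'a::real_inner set \<Rightarrow> 'a \<Rightarrow> real" where
  "sq_sum B x \<equiv> (\<Sum>b\<in>B. (x \<bullet> b)\<^sup>2)"

text \<open>Independence of the two Gamma variables, by Fubini: the coordinates in \<open>B\<close>
  are split off first, then those in \<open>A\<close>, and the remaining ones contribute the factor
  1.\<close>

lemma nn_integral_gauss_sums_of_squares:
  fixes A B :: "'a::euclidean_space set"
  assumes AB: "A \<subseteq> Basis" "B \<subseteq> Basis" "A \<inter> B = {}" "card A = 2 * Suc k" "card B = 2 * Suc l"
    and [measurable]: "case_prod \<phi> \<in> borel_measurable (borel \<Otimes>\<^sub>M borel)"
  shows "(\<integral>\<^sup>+x. \<phi> (sq_sum A x) (sq_sum B x) \<partial>gauss)
    = (\<integral>\<^sup>+s. (\<integral>\<^sup>+r. \<phi> r s * ennreal (erlang_density k 1 r) \<partial>lborel) * ennreal (erlang_density l 1 s) \<partial>lborel)"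
proof -
  let ?J = "\<lambda>s. \<integral>\<^sup>+r. \<phi> r s * ennreal (erlang_density k 1 r) \<partial>lborel"
  interpret product_sigma_finite "\<lambda>_::'a. lborel :: real measure" by standard
  define C where "C = Basis - A - B"
  have fin: "finite A" "finite B" "finite C"
    using AB finite_Basis finite_subset by (auto simp: C_def)
  have Bas: "Basis = B \<union> (A \<union> C)" "B \<inter> (A \<union> C) = {}" "A \<inter> C = {}" using AB by (auto simp: C_def)
  define SA SB where "SA f = (\<Sum>b\<in>A. (f b)\<^sup>2)" and "SB f = (\<Sum>b\<in>B. (f b)\<^sup>2)" for f :: "'a \<Rightarrow> real"
  have [measurable]: "SA \<in> borel_measurable (PiM Basis (\<lambda>_. lborel))" "SB \<in> borel_measurable (PiM Basis (\<lambda>_. lborel))"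
    "SA \<in> borel_measurable (lborel_PiM (A \<union> C))" "SA \<in> borel_measurable (lborel_PiM A)"
    "SB \<in> borel_measurable (lborel_PiM B)"
    unfolding SA_def[abs_def] SB_def[abs_def] using AB by (auto intro!: borel_measurable_sum_squares)
  note [measurable] = gauss_weight_measurable
  have "(\<integral>\<^sup>+x. \<phi> (sq_sum A x) (sq_sum B x) \<partial>gauss)
    = (\<integral>\<^sup>+f. \<phi> (\<Sum>b\<in>A. ((\<Sum>b\<in>Basis. f b *\<^sub>R b) \<bullet> b)\<^sup>2) (\<Sum>b\<in>B. ((\<Sum>b\<in>Basis. f b *\<^sub>R b) \<bullet> b)\<^sup>2) * gauss_weight Basis f \<partial>PiM (Basis::'a set) (\<lambda>_. lborel))"
    by (rule nn_integral_gauss_PiM) measurable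
  also have "\<dots> = (\<integral>\<^sup>+f. \<phi> (SA f) (SB f) * gauss_weight Basis f \<partial>PiM (Basis::'a set) (\<lambda>_. lborel))"
    unfolding SA_def SB_def using AB
    by (intro nn_integral_cong arg_cong2[where f="(*)"] arg_cong2[where f=\<phi>] sum.cong refl) auto
  also have "\<dots> = (\<integral>\<^sup>+f. \<phi> (SA f) (SB f) * gauss_weight Basis f \<partial>PiM (B \<union> (A \<union> C)) (\<lambda>_. lborel))"
    by (simp only: Bas(1)[symmetric])
  also have "\<dots> = (\<integral>\<^sup>+x. (\<integral>\<^sup>+y. \<phi> (SA (merge B (A \<union> C) (x, y))) (SB (merge B (A \<union> C) (x, y)))
      * gauss_weight Basis (merge B (A \<union> C) (x, y)) \<partial>lborel_PiM (A \<union> C)) \<partial>lborel_PiM B)"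
    using fin Bas by (intro product_nn_integral_fold) (auto simp: Bas(1)[symmetric])
  also have "\<dots> = (\<integral>\<^sup>+x. (\<integral>\<^sup>+y. \<phi> (SA y) (SB x) * gauss_weight (A \<union> C) y \<partial>lborel_PiM (A \<union> C))
        * gauss_weight B x \<partial>lborel_PiM B)"
  proof (rule nn_integral_cong)
    fix x :: "'a \<Rightarrow> real"
    have 1: "SA (merge B (A \<union> C) (x, y)) = SA y" for y
      unfolding SA_def using Bas AB by (intro sum.cong refl) (auto simp: merge_def)
    have 2: "SB (merge B (A \<union> C) (x, y)) = SB x" for y
      unfolding SB_def by (intro sum.cong refl) (auto simp: merge_def)
    have 3: "gauss_weight Basis (merge B (A \<union> C) (x, y)) = gauss_weight (A \<union> C) y * gauss_weight B x" for y
      using gauss_weight_merge[of B "A \<union> C" x y] fin Bas by (simp add: mult.commute)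
    show "(\<integral>\<^sup>+y. \<phi> (SA (merge B (A \<union> C) (x, y))) (SB (merge B (A \<union> C) (x, y)))
      * gauss_weight Basis (merge B (A \<union> C) (x, y)) \<partial>lborel_PiM (A \<union> C))
      = (\<integral>\<^sup>+y. \<phi> (SA y) (SB x) * gauss_weight (A \<union> C) y \<partial>lborel_PiM (A \<union> C)) * gauss_weight B x"
      unfolding 1 2 3 by (subst nn_integral_multc[symmetric]) (auto simp: ac_simps)
  qed
  also have "\<dots> = (\<integral>\<^sup>+x. ?J (SB x) * gauss_weight B x \<partial>lborel_PiM B)"
  proof (intro nn_integral_cong arg_cong2[where f="(*)"] refl)
    fix x :: "'a \<Rightarrow> real"
    have "(\<integral>\<^sup>+y. \<phi> (SA y) (SB x) * gauss_weight (A \<union> C) y \<partial>lborel_PiM (A \<union> C))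
      = (\<integral>\<^sup>+u. (\<integral>\<^sup>+v. \<phi> (SA (merge A C (u, v))) (SB x) * gauss_weight (A \<union> C) (merge A C (u, v)) \<partial>lborel_PiM C) \<partial>lborel_PiM A)"
      using fin Bas by (intro product_nn_integral_fold) auto
    also have "\<dots> = (\<integral>\<^sup>+u. \<phi> (SA u) (SB x) * gauss_weight A u \<partial>lborel_PiM A)"
    proof (rule nn_integral_cong)
      fix u :: "'a \<Rightarrow> real"
      have 1: "SA (merge A C (u, v)) = SA u" for v
        unfolding SA_def by (intro sum.cong refl) (auto simp: merge_def)
      have 3: "gauss_weight (A \<union> C) (merge A C (u, v)) = gauss_weight A u * gauss_weight C v" for v
        using fin Bas by (intro gauss_weight_merge) auto
      show "(\<integral>\<^sup>+v. \<phi> (SA (merge A C (u, v))) (SB x) * gauss_weight (A \<union> C) (merge A C (u, v)) \<partial>lborel_PiM C)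
        = \<phi> (SA u) (SB x) * gauss_weight A u"
        unfolding 1 3 mult.assoc[symmetric]
        by (subst nn_integral_cmult) (auto simp: nn_integral_gauss_weight[OF fin(3)])
    qed
    also have "\<dots> = ?J (SB x)"
      unfolding SA_def using AB fin by (intro nn_integral_sum_squares_gauss_weight) auto
    finally show "(\<integral>\<^sup>+y. \<phi> (SA y) (SB x) * gauss_weight (A \<union> C) y \<partial>lborel_PiM (A \<union> C))
      = ?J (SB x)" .
  qed
  also have "\<dots> = (\<integral>\<^sup>+s. ?J s * ennreal (erlang_density l 1 s) \<partial>lborel)"
    unfolding SB_def using AB fin
    by (intro nn_integral_sum_squares_gauss_weight[of B l "\<lambda>s. \<integral>\<^sup>+r. \<phi> r s * ennreal (erlang_density k 1 r) \<partial>lborel"]) auto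
  finally show ?thesis .
qed

section \<open>Ratios of independent Gamma variables near zero\<close>

lemma ennreal_add_le: "0 \<le> b \<Longrightarrow> ennreal (a + b) \<le> ennreal a + ennreal b"
  by (cases "0 \<le> a") (auto simp: ennreal_neg intro: ennreal_leI)

abbreviation erlang_mass :: "nat \<Rightarrow> real \<Rightarrow> ennreal" where
  "erlang_mass k r \<equiv> (\<integral>\<^sup>+x. indicator {..r} x * ennreal (erlang_density k 1 x) \<partial>lborel)"

text \<open>On [0, r] the exponential in the density lies between 1 - r and 1. For r > 1 the lower
  bound is negative and becomes 0 in \<open>ennreal\<close>, so no upper restriction on r has to be
  carried along.\<close>

lemma erlang_small_ball:
  assumes r: "0 \<le> r"
  shows "erlang_mass k r \<le> ennreal (r ^ Suc k / fact (Suc k))"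
    and "ennreal ((1 - r) * r ^ Suc k / fact (Suc k)) \<le> erlang_mass k r"
proof -
  note int = nn_integral_power_Icc[OF r]
  have "erlang_mass k r
     \<le> (\<integral>\<^sup>+x. ennreal (1 * (x ^ k / fact k)) * indicator {0..r} x \<partial>lborel)"
    by (intro nn_integral_mono)
      (auto simp: erlang_density_def indicator_def divide_simps intro!: ennreal_leI mult_right_le_one_le)
  then show "erlang_mass k r \<le> ennreal (r ^ Suc k / fact (Suc k))"
    by (subst (asm) int) auto
  show "ennreal ((1 - r) * r ^ Suc k / fact (Suc k)) \<le> erlang_mass k r"
  proof (cases "r \<le> 1")
    case True
    have "(\<integral>\<^sup>+x. ennreal ((1 - r) * (x ^ k / fact k)) * indicator {0..r} x \<partial>lborel)
       \<le> erlang_mass k r"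
    proof (intro nn_integral_mono)
      fix x :: real
      have "(1 - r) * (x ^ k / fact k) \<le> exp (- x) * (x ^ k / fact k)" if "0 \<le> x" "x \<le> r"
        using that exp_ge_add_one_self[of "- x"] by (intro mult_right_mono) auto
      then show "ennreal ((1 - r) * (x ^ k / fact k)) * indicator {0..r} x \<le> indicator {..r} x * ennreal (erlang_density k 1 x)"
        by (auto simp: erlang_density_def indicator_def ac_simps intro!: ennreal_leI)
    qed
    then show ?thesis by (subst (asm) int) (use True in auto)
  next
    case False
    then have "(1 - r) * r ^ Suc k / fact (Suc k) \<le> 0"
      by (intro divide_nonpos_pos mult_nonpos_nonneg) auto
    then show ?thesis by (simp add: ennreal_neg)
  qed
qed

text \<open>\<open>I\<close> is the probability that X <= s Y for independent Gamma variables of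
  shapes k + 1 and l + 1. Given Y = y, X lies below s y with probability close to (s y)^(k+1) /
  (k+1)!, so \<open>M\<close> comes from the moment of order k + 1 of Y, which is (k+l+1)! / l!. The
  error is the next moment, larger by the factor k + l + 2.\<close>

lemma erlang_ratio_small_ball:
  fixes k l :: nat
  assumes s: "0 \<le> s"
  defines "M \<equiv> fact (k + l + 1) / (fact (Suc k) * fact l)"
  defines "I \<equiv> (\<integral>\<^sup>+y. erlang_mass k (s * y) * ennreal (erlang_density l 1 y) \<partial>lborel)"
  shows "I \<le> ennreal (M * s ^ Suc k)"
    and "ennreal (M * s ^ Suc k * (1 - s * real (k + l + 2))) \<le> I"
proof -
  have "(\<lambda>(y, x). indicator {..s * y} x * ennreal (erlang_density k 1 x))
    = (\<lambda>z. indicator {z. snd z \<le> s * fst z} z * ennreal (erlang_density k 1 (snd z)))"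
    by (auto simp: indicator_def fun_eq_iff)
  also have "\<dots> \<in> borel_measurable (borel \<Otimes>\<^sub>M lborel)" by measurable
  finally have [measurable]: "(\<lambda>y. \<integral>\<^sup>+x. indicator {..s * y} x * ennreal (erlang_density k 1 x) \<partial>lborel) \<in> borel_measurable borel"
    by (rule lborel.borel_measurable_nn_integral)
  have mom: "(\<integral>\<^sup>+y. ennreal (c * (erlang_density l 1 y * y ^ i)) \<partial>lborel) = ennreal (c * fact (l + i) / fact l)"
    if "c \<ge> 0" for c i
    using that nn_integral_erlang_ith_moment[of 1 l i]
    by (subst ennreal_mult', simp, subst nn_integral_cmult) (auto simp: ennreal_mult'[symmetric])
  have "I \<le> (\<integral>\<^sup>+y. ennreal (s ^ Suc k / fact (Suc k) * (erlang_density l 1 y * y ^ Suc k)) \<partial>lborel)"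
    unfolding I_def
  proof (intro nn_integral_mono)
    fix y :: real
    show "erlang_mass k (s * y) * ennreal (erlang_density l 1 y)
      \<le> ennreal (s ^ Suc k / fact (Suc k) * (erlang_density l 1 y * y ^ Suc k))"
    proof (cases "y \<ge> 0")
      case True
      have "erlang_mass k (s * y) * ennreal (erlang_density l 1 y)
        \<le> ennreal ((s * y) ^ Suc k / fact (Suc k)) * ennreal (erlang_density l 1 y)"
        using True s by (intro mult_right_mono erlang_small_ball(1)) auto
      also have "\<dots> = ennreal (s ^ Suc k / fact (Suc k) * (erlang_density l 1 y * y ^ Suc k))"
        using True s by (subst ennreal_mult'[symmetric]) (auto simp: power_mult_distrib ac_simps)
      finally show ?thesis .
    qed (auto simp: erlang_density_def)
  qed
  also have "\<dots> = ennreal (M * s ^ Suc k)"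
    using s by (subst mom) (auto simp: M_def ac_simps)
  finally show "I \<le> ennreal (M * s ^ Suc k)" .
  show "ennreal (M * s ^ Suc k * (1 - s * real (k + l + 2))) \<le> I"
  proof -
    define a where "a = s ^ Suc k / fact (Suc k)"
    have a: "a \<ge> 0" using s by (simp add: a_def)
    \<comment> \<open>Truncated subtraction is avoided under the integral: the main moment is
      bounded by \<open>I\<close> plus the error moment, and the difference is taken only between
      finite numbers at the end.\<close>
    have "ennreal (a * fact (l + Suc k) / fact l)
       = (\<integral>\<^sup>+y. ennreal (a * (erlang_density l 1 y * y ^ Suc k)) \<partial>lborel)"
      by (rule mom[symmetric, OF a])
    also have "\<dots> \<le> (\<integral>\<^sup>+y. erlang_mass k (s * y) * ennreal (erlang_density l 1 y)
        + ennreal ((s * a) * (erlang_density l 1 y * y ^ Suc (Suc k))) \<partial>lborel)"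
    proof (intro nn_integral_mono)
      fix y :: real
      show "ennreal (a * (erlang_density l 1 y * y ^ Suc k)) \<le>
         erlang_mass k (s * y) * ennreal (erlang_density l 1 y)
        + ennreal ((s * a) * (erlang_density l 1 y * y ^ Suc (Suc k)))"
      proof (cases "y \<ge> 0")
        case True
        have "ennreal ((1 - s * y) * (s * y) ^ Suc k / fact (Suc k)) * ennreal (erlang_density l 1 y)
          \<le> erlang_mass k (s * y) * ennreal (erlang_density l 1 y)"
          using True s by (intro mult_right_mono erlang_small_ball(2)) auto
        moreover have "ennreal (a * (erlang_density l 1 y * y ^ Suc k))
          \<le> ennreal ((1 - s * y) * (s * y) ^ Suc k / fact (Suc k)) * ennreal (erlang_density l 1 y) + ennreal ((s * a) * (erlang_density l 1 y * y ^ Suc (Suc k)))"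
        proof -
          have "a * (erlang_density l 1 y * y ^ Suc k) = ((1 - s * y) * (s * y) ^ Suc k / fact (Suc k)) * erlang_density l 1 y
               + (s * a) * (erlang_density l 1 y * y ^ Suc (Suc k))"
            unfolding a_def by (simp add: power_mult_distrib algebra_simps add_divide_distrib diff_divide_distrib del: fact_Suc)
          \<comment> \<open>The first summand is negative when s * y > 1 and is then truncated to 0,
            so that in general only an inequality holds here.\<close>
          also have "ennreal \<dots> \<le> ennreal (((1 - s * y) * (s * y) ^ Suc k / fact (Suc k)) * erlang_density l 1 y)
               + ennreal ((s * a) * (erlang_density l 1 y * y ^ Suc (Suc k)))"
            by (rule ennreal_add_le) (use s a True in simp)
          also have "ennreal (((1 - s * y) * (s * y) ^ Suc k / fact (Suc k)) * erlang_density l 1 y)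
             = ennreal ((1 - s * y) * (s * y) ^ Suc k / fact (Suc k)) * ennreal (erlang_density l 1 y)"
            by (rule ennreal_mult'') auto
          finally show ?thesis .
        qed
        ultimately show ?thesis by (meson add_right_mono order_trans)
      qed (auto simp: erlang_density_def)
    qed
    also have "\<dots> = I + (\<integral>\<^sup>+y. ennreal ((s * a) * (erlang_density l 1 y * y ^ Suc (Suc k))) \<partial>lborel)"
      unfolding I_def by (subst nn_integral_add) auto
    also have "(\<integral>\<^sup>+y. ennreal ((s * a) * (erlang_density l 1 y * y ^ Suc (Suc k))) \<partial>lborel)
       = ennreal (s * a * fact (l + Suc (Suc k)) / fact l)"
      using a s by (intro mom) auto
    finally have *: "ennreal (a * fact (l + Suc k) / fact l) \<le> I + ennreal (s * a * fact (l + Suc (Suc k)) / fact l)" .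
    have "M * s ^ Suc k * (1 - s * real (k + l + 2)) = a * fact (l + Suc k) / fact l - s * a * fact (l + Suc (Suc k)) / fact l"
    proof -
      have e1: "fact (l + Suc k) = (fact (k + l + 1) :: real)"
        by (rule arg_cong[where f=fact]) simp
      have "l + Suc (Suc k) = Suc (k + l + 1)" by simp
      then have e2: "fact (l + Suc (Suc k)) = real (k + l + 2) * fact (k + l + 1)"
        by (simp only: fact_Suc) simp
      have "F / (G * H) * S * (1 - s * N) = S / G * F / H - s * (S / G) * (N * F) / H" for F G H S N :: real
        by (simp add: algebra_simps diff_divide_distrib)
      then show ?thesis unfolding M_def a_def e1 e2 .
    qed
    moreover have "ennreal \<dots> \<le> I"
      using * a s by (subst ennreal_minus[symmetric]) (auto simp: ennreal_minus_le_iff add.commute)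
    ultimately show ?thesis by simp
  qed
qed

section \<open>Adapted orthonormal frames\<close>

text \<open>Complete \<open>F\<close> and \<open>G\<close> by an orthonormal basis of their
  orthogonal complement and rotate the standard basis onto the result; rotation invariance of the
  Gaussian reduces the claim to coordinate sets.\<close>

lemma nn_integral_gauss_orthonormal:
  fixes F G :: "'a::euclidean_space set"
  assumes fin: "finite F" "finite G" and disj: "F \<inter> G = {}"
    and orth: "pairwise orthogonal (F \<union> G)" and unit: "\<And>f. f \<in> F \<union> G \<Longrightarrow> norm f = 1"
    and card: "card F = 2 * Suc k" "card G = 2 * Suc l"
    and [measurable]: "case_prod \<phi> \<in> borel_measurable (borel \<Otimes>\<^sub>M borel)"
  shows "(\<integral>\<^sup>+x. \<phi> (sq_sum F x) (sq_sum G x) \<partial>gauss)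
    = (\<integral>\<^sup>+s. (\<integral>\<^sup>+r. \<phi> r s * ennreal (erlang_density k 1 r) \<partial>lborel) * ennreal (erlang_density l 1 s) \<partial>lborel)"
proof -
  define S where "S = {y::'a. \<forall>x\<in>span (F \<union> G). orthogonal x y}"
  have "subspace S" unfolding S_def by (rule subspace_orthogonal_to_vectors)
  then obtain B where B: "B \<subseteq> S" "pairwise orthogonal B" "\<And>x. x \<in> B \<Longrightarrow> norm x = 1" "independent B"
    "card B = dim S" "span B = S"
    using orthonormal_basis_subspace by blast
  have finB: "finite B" using B(4) by (rule independent_imp_finite)
  have ind: "independent (F \<union> G)"
    by (rule pairwise_orthogonal_independent[OF orth]) (use unit in force)
  have perp: "orthogonal x y" if "x \<in> F \<union> G" "y \<in> B" for x y
    using that B(1) by (auto simp: S_def span_base)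
  have BFG: "B \<inter> (F \<union> G) = {}"
    using perp unit by (force simp: orthogonal_def)
  define H where "H = B \<union> (F \<union> G)"
  have finH: "finite H" using fin finB by (simp add: H_def)
  have "dim S + dim (span (F \<union> G)) = dim (UNIV :: 'a set)"
    using dim_subspace_orthogonal_to_vectors[of "span (F \<union> G)" UNIV] by (simp add: S_def)
  moreover have "dim (span (F \<union> G)) = card (F \<union> G)" using ind by (simp add: dim_eq_card_independent)
  ultimately have cardH: "card H = DIM('a)"
    unfolding H_def using BFG fin finB B(5) by (subst card_Un_disjoint) auto
  have H: "pairwise orthogonal H" "\<And>h. h \<in> H \<Longrightarrow> norm h = 1"
  proof -
    show "pairwise orthogonal H"
      unfolding H_def pairwise_def
      by (metis UnE UnI1 UnI2 B(2) orth pairwiseD perp orthogonal_commute)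
    show "norm h = 1" if "h \<in> H" for h using that B(3) unit by (auto simp: H_def)
  qed
  obtain h where h: "bij_betw h (Basis::'a set) H"
    using finite_same_card_bij[OF finite_Basis finH] cardH by auto
  have inner_h: "h b \<bullet> h b' = (if b = b' then 1 else 0)" if "b \<in> Basis" "b' \<in> Basis" for b b'
  proof (cases "b = b'")
    case True
    then have "norm (h b') = 1" using H(2) bij_betwE[OF h] that by auto
    then show ?thesis using True by (simp add: norm_eq_1)
  next
    case False
    then have "h b \<noteq> h b'" using h that by (auto simp: bij_betw_def inj_on_def)
    then show ?thesis using H(1) bij_betwE[OF h] that False by (auto simp: pairwise_def orthogonal_def)
  qed
  \<comment> \<open>The isometry with b mapped to h b; the h-coordinates of T x are the standard
    coordinates of x.\<close>
  define T where "T x = (\<Sum>b\<in>Basis. (x \<bullet> b) *\<^sub>R h b)" for x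
  have T_h: "T x \<bullet> h b = x \<bullet> b" if b: "b \<in> Basis" for x b
  proof -
    have "T x \<bullet> h b = (\<Sum>b'\<in>Basis. (x \<bullet> b') * (h b' \<bullet> h b))" by (simp add: T_def inner_sum_left)
    also have "\<dots> = (\<Sum>b'\<in>Basis. if b' = b then x \<bullet> b' else 0)" using b by (intro sum.cong) (auto simp: inner_h)
    finally show ?thesis using b by simp
  qed
  have T: "orthogonal_transformation T"
    unfolding orthogonal_transformation_def
  proof (intro conjI allI)
    show "linear T" unfolding T_def
      by (intro linear_compose_sum ballI) (auto intro!: linearI simp: inner_add_left scaleR_add_left)
    fix v w
    have "T v \<bullet> T w = (\<Sum>b\<in>Basis. (w \<bullet> b) * (T v \<bullet> h b))" by (subst (2) T_def) (simp add: inner_sum_right)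
    also have "\<dots> = v \<bullet> w" by (subst euclidean_inner) (simp add: T_h mult.commute)
    finally show "T v \<bullet> T w = v \<bullet> w" .
  qed
  define A1 A2 where "A1 = {b\<in>Basis. h b \<in> F}" and "A2 = {b\<in>Basis. h b \<in> G}"
  have "h ` A1 = F \<inter> h ` Basis" "h ` A2 = G \<inter> h ` Basis" by (auto simp: A1_def A2_def)
  then have "h ` A1 = F" "h ` A2 = G" unfolding bij_betw_imp_surj_on[OF h] by (auto simp: H_def)
  then have b1: "bij_betw h A1 F" and b2: "bij_betw h A2 G"
    by (auto intro!: bij_betw_subset[OF h] simp: A1_def A2_def)
  have s1: "(\<Sum>f\<in>F. (T x \<bullet> f)\<^sup>2) = (sq_sum A1 x)" for x
    unfolding sum.reindex_bij_betw[OF b1, symmetric] by (rule sum.cong) (auto simp: A1_def T_h)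
  have s2: "(\<Sum>f\<in>G. (T x \<bullet> f)\<^sup>2) = (sq_sum A2 x)" for x
    unfolding sum.reindex_bij_betw[OF b2, symmetric] by (rule sum.cong) (auto simp: A2_def T_h)
  have "(\<integral>\<^sup>+x. \<phi> (sq_sum F x) (sq_sum G x) \<partial>gauss)
    = (\<integral>\<^sup>+x. \<phi> (\<Sum>f\<in>F. (T x \<bullet> f)\<^sup>2) (\<Sum>f\<in>G. (T x \<bullet> f)\<^sup>2) \<partial>gauss)"
    by (rule nn_integral_gauss_orthogonal_transformation[OF T, symmetric]) measurable
  also have "\<dots> = (\<integral>\<^sup>+s. (\<integral>\<^sup>+r. \<phi> r s * ennreal (erlang_density k 1 r) \<partial>lborel) * ennreal (erlang_density l 1 s) \<partial>lborel)"
    unfolding s1 s2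
  proof (rule nn_integral_gauss_sums_of_squares)
    show "card A1 = 2 * Suc k" "card A2 = 2 * Suc l"
      using bij_betw_same_card[OF b1] bij_betw_same_card[OF b2] card by simp_all
    show "A1 \<inter> A2 = {}" using disj by (auto simp: A1_def A2_def)
  qed (auto simp: A1_def A2_def)
  finally show ?thesis .
qed

lemma gauss_ratio_small_ball:
  fixes F G :: "'a::euclidean_space set"
  assumes F: "finite F" "finite G" "F \<inter> G = {}" "pairwise orthogonal (F \<union> G)" "\<And>f. f \<in> F \<union> G \<Longrightarrow> norm f = 1"
    "card F = 2 * Suc k" "card G = 2 * Suc l" and s: "0 \<le> s"
  defines "M \<equiv> fact (k + l + 1) / (fact (Suc k) * fact l)"
  shows "emeasure gauss {x. (sq_sum F x) \<le> s * (sq_sum G x)} \<le> ennreal (M * s ^ Suc k)"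
    and "ennreal (M * s ^ Suc k * (1 - s * real (k + l + 2)))
      \<le> emeasure gauss {x. (sq_sum F x) \<le> s * (sq_sum G x)}"
proof -
  define X where "X = {x. (sq_sum F x) \<le> s * (sq_sum G x)}"
  have "X \<in> sets borel" unfolding X_def by measurable
  then have "emeasure gauss X = (\<integral>\<^sup>+x. indicator X x \<partial>gauss)" by simp
  also have "\<dots> = (\<integral>\<^sup>+x. indicator {..s * (sq_sum G x)} (sq_sum F x) \<partial>gauss)"
    by (intro nn_integral_cong) (auto simp: X_def indicator_def)
  also have "\<dots> = (\<integral>\<^sup>+y. erlang_mass k (s * y) * ennreal (erlang_density l 1 y) \<partial>lborel)"
  proof (rule nn_integral_gauss_orthonormal[OF F, of "\<lambda>r y. indicator {..s * y} r"])
    have "(\<lambda>(r, y). indicator {..s * y} r :: ennreal) = indicator {z :: real \<times> real. fst z \<le> s * snd z}"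
      by (auto simp: indicator_def fun_eq_iff)
    also have "\<dots> \<in> borel_measurable (borel \<Otimes>\<^sub>M borel)"
    proof (rule borel_measurable_indicator)
      have "{z \<in> space (borel \<Otimes>\<^sub>M borel). fst z \<le> s * snd z} \<in> sets (borel \<Otimes>\<^sub>M borel :: (real \<times> real) measure)"
        by measurable
      then show "{z :: real \<times> real. fst z \<le> s * snd z} \<in> sets (borel \<Otimes>\<^sub>M borel)"
        by (simp add: space_pair_measure)
    qed
    finally show "(\<lambda>(r, y). indicator {..s * y} r :: ennreal) \<in> borel_measurable (borel \<Otimes>\<^sub>M borel)" .
  qed auto
  finally have X: "emeasure gauss X = \<dots>" .
  show "emeasure gauss {x. (sq_sum F x) \<le> s * (sq_sum G x)} \<le> ennreal (M * s ^ Suc k)"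
    unfolding X_def[symmetric] X M_def by (rule erlang_ratio_small_ball(1)[OF s])
  show "ennreal (M * s ^ Suc k * (1 - s * real (k + l + 2)))
      \<le> emeasure gauss {x. (sq_sum F x) \<le> s * (sq_sum G x)}"
    unfolding X_def[symmetric] X M_def by (rule erlang_ratio_small_ball(2)[OF s])
qed

text \<open>Projections are treated over the reals, because the Gaussian estimates count real
  coordinates; a complex subspace of dimension m appears with real dimension 2m.\<close>

definition orth_proj :: "('a::real_inner \<Rightarrow> 'a) \<Rightarrow> bool" where
  "orth_proj p \<longleftrightarrow> linear p \<and> (\<forall>x y. p x \<bullet> y = x \<bullet> p y) \<and> (\<forall>x. p (p x) = p x)"

lemma orth_projD:
  assumes "orth_proj p"
  shows "linear p" "p x \<bullet> y = x \<bullet> p y" "p (p x) = p x"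
  using assms by (auto simp: orth_proj_def)

lemma orth_proj_norm:
  assumes "orth_proj p"
  shows "(norm x)\<^sup>2 = (norm (p x))\<^sup>2 + (norm (x - p x))\<^sup>2"
  using orth_projD[OF assms]
  by (simp add: power2_norm_eq_inner inner_diff_left inner_diff_right)

text \<open>\<open>G\<close> is an orthonormal basis of the part of \<open>range p\<close> orthogonal to \<open>range u\<close>, and
  \<open>F\<close> spans the rest of the orthogonal complement of \<open>range u\<close>.  On \<open>F\<close> the projection \<open>p\<close> is
  small, because it takes values in the image under \<open>p\<close> of \<open>range u\<close>, which is nearly
  orthogonal to \<open>F\<close>.\<close>

lemma orth_proj_adapted_frame:
  fixes p u :: "'a::euclidean_space \<Rightarrow> 'a"
  assumes p: "orth_proj p" and u: "orth_proj u" and x: "0 \<le> x" "x < 1"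
    and close: "\<And>z. (norm (u z - p (u z)))\<^sup>2 \<le> x * (norm (u z))\<^sup>2"
  obtains F G where "finite F" "finite G" "F \<inter> G = {}" "pairwise orthogonal (F \<union> G)"
    "\<And>f. f \<in> F \<union> G \<Longrightarrow> norm f = 1"
    "card F + dim (range p) = DIM('a)" "card G + dim (range u) = dim (range p)"
    "\<And>y. (norm (y - u y))\<^sup>2 = (sq_sum F y) + (sq_sum G y)"
    "\<And>y. (norm ((y - u y) - p (y - u y)))\<^sup>2 \<le> (sq_sum F y)"
    "\<And>y. (1 - x) * (sq_sum F y) \<le> (norm ((y - u y) - p (y - u y)))\<^sup>2"
proof -
  note pD = orth_projD[OF p] and uD = orth_projD[OF u]
  define V where "V = range p"
  define U where "U = range u"
  define A where "A = p ` U"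
  define K where "K = {y \<in> V. \<forall>a\<in>A. orthogonal a y}"
  define W where "W = {y. \<forall>z\<in>U. orthogonal z y}"
  define R where "R = {y \<in> W. \<forall>k\<in>K. orthogonal k y}"
  have sV: "subspace V" and sU: "subspace U"
    unfolding V_def U_def using linear_subspace_image[OF pD(1) subspace_UNIV] linear_subspace_image[OF uD(1) subspace_UNIV]
    by simp_all
  have sA: "subspace A" unfolding A_def using pD(1) sU by (rule linear_subspace_image)
  have sW: "subspace W" unfolding W_def by (rule subspace_orthogonal_to_vectors)
  have sK: "subspace K"
    using subspace_inter[OF sV subspace_orthogonal_to_vectors[of A]] by (simp add: K_def Int_def)
  have sR: "subspace R"
    using subspace_inter[OF sW subspace_orthogonal_to_vectors[of K]] by (simp add: R_def Int_def)
  have AV: "A \<subseteq> V" unfolding A_def V_def by auto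
  have pV: "p y = y" if "y \<in> V" for y using that pD(3) by (auto simp: V_def)
  have uU: "u z = z" if "z \<in> U" for z using that uD(3) by (auto simp: U_def)
  have closeU: "(norm (z - p z))\<^sup>2 \<le> x * (norm z)\<^sup>2" if "z \<in> U" for z
    using close[of z] uU[OF that] by simp
  \<comment> \<open>A vector of \<open>U\<close> killed by p would be at distance its full norm from
    its projection, contradicting closeness since x < 1. Hence \<open>A\<close> and \<open>U\<close>
    have equal dimension, which fixes the cardinalities of \<open>F\<close> and
    \<open>G\<close>.\<close>
  have inj: "inj_on p U"
  proof (rule inj_onI)
    fix y z assume "y \<in> U" "z \<in> U" "p y = p z"
    then have d: "y - z \<in> U" "p (y - z) = 0" using sU pD(1) by (auto simp: subspace_diff linear_diff)
    then have "(1 - x) * (norm (y - z))\<^sup>2 \<le> 0" using closeU[OF d(1)] by (simp add: algebra_simps)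
    then have "(norm (y - z))\<^sup>2 \<le> 0" using x by (simp add: mult_le_0_iff)
    then show "y = z" by simp
  qed
  have dimA: "dim A = dim U" unfolding A_def
    using inj sU by (intro dim_image_eq pD(1)) (simp add: span_eq_iff[THEN iffD2])
  have dimK: "dim K + dim U = dim V"
    using dim_subspace_orthogonal_to_vectors[OF sA sV AV] by (simp add: K_def dimA)
  have uW: "y \<in> W \<longleftrightarrow> u y = 0" for y
  proof
    assume "y \<in> W"
    then have "u (u y) \<bullet> y = 0" by (auto simp: W_def U_def orthogonal_def)
    then have "u y \<bullet> u y = 0" by (metis uD(2))
    then show "u y = 0" by simp
  next
    assume "u y = 0" then show "y \<in> W"
      by (auto simp: W_def U_def orthogonal_def uD(2))
  qed
  \<comment> \<open>For y in the range of p, z and p z have the same inner product with y, so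
    orthogonality to p(U) gives orthogonality to U.\<close>
  have KW: "K \<subseteq> W"
  proof
    fix y assume y: "y \<in> K"
    then have "p y = y" by (simp add: K_def pV)
    then have "z \<bullet> y = p z \<bullet> y" for z using pD(2)[of z y] by simp
    then show "y \<in> W" using y by (auto simp: K_def W_def A_def orthogonal_def)
  qed
  have dimW: "dim W + dim U = DIM('a)"
    using dim_subspace_orthogonal_to_vectors[OF sU subspace_UNIV] by (simp add: W_def)
  have dimR: "dim R + dim K = dim W"
    using dim_subspace_orthogonal_to_vectors[OF sK sW KW] by (simp add: R_def)
  obtain F where F: "F \<subseteq> R" "pairwise orthogonal F" "\<And>f. f \<in> F \<Longrightarrow> norm f = 1" "independent F" "card F = dim R" "span F = R"
    using orthonormal_basis_subspace[OF sR] by blast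
  obtain G where G: "G \<subseteq> K" "pairwise orthogonal G" "\<And>f. f \<in> G \<Longrightarrow> norm f = 1" "independent G" "card G = dim K" "span G = K"
    using orthonormal_basis_subspace[OF sK] by blast
  have fin: "finite F" "finite G" using F(4) G(4) by (auto intro: independent_imp_finite)
  have perp: "k \<bullet> r = 0" if "k \<in> K" "r \<in> R" for k r using that by (auto simp: R_def orthogonal_def)
  have parseval: "(norm y)\<^sup>2 = (sq_sum B y)"
    if B: "pairwise orthogonal B" "\<And>f. f \<in> B \<Longrightarrow> norm f = 1" "y \<in> span B" "finite B" for y and B :: "'a set"
  proof -
    have "(\<Sum>f\<in>B. (y \<bullet> f) *\<^sub>R f) = y" by (rule orthonormal_basis_expand[OF B])
    then have "(norm y)\<^sup>2 = y \<bullet> (\<Sum>f\<in>B. (y \<bullet> f) *\<^sub>R f)"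
      by (simp only: power2_norm_eq_inner)
    then show ?thesis by (simp add: inner_sum_right power2_eq_square)
  qed
  have main: "(norm (y - u y))\<^sup>2 = (sq_sum F y) + (sq_sum G y) \<and>
      (norm ((y - u y) - p (y - u y)))\<^sup>2 \<le> (sq_sum F y) \<and>
      (1 - x) * (sq_sum F y) \<le> (norm ((y - u y) - p (y - u y)))\<^sup>2" for y
  proof -
    define w where "w = y - u y"
    have wW: "w \<in> W" by (simp add: uW w_def linear_diff[OF uD(1)] uD(3))
    have wy: "w \<bullet> f = y \<bullet> f" if "f \<in> W" for f
      using that uD(2)[of y f] by (simp add: w_def inner_diff_left uW)
    define k where "k = (\<Sum>f\<in>G. (w \<bullet> f) *\<^sub>R f)"
    define r where "r = w - k"
    have kK: "k \<in> K" unfolding k_def G(6)[symmetric] by (intro span_sum span_scale span_base)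
    have kf: "k \<bullet> f = w \<bullet> f" if f: "f \<in> G" for f
    proof -
      have "k \<bullet> f = (\<Sum>g\<in>G. (w \<bullet> g) * (g \<bullet> f))" by (simp add: k_def inner_sum_left)
      also have "\<dots> = (\<Sum>g\<in>G. if g = f then w \<bullet> g else 0)"
        using f G(2,3) by (intro sum.cong) (auto simp: pairwise_def orthogonal_def norm_eq_1)
      finally show ?thesis using f fin by simp
    qed
    have rW: "r \<in> W" using wW kK KW sW by (auto simp: r_def subspace_diff)
    have "orthogonal r k'" if "k' \<in> K" for k'
      using that unfolding G(6)[symmetric]
      by (rule orthogonal_to_span) (auto simp: orthogonal_def r_def inner_diff_left kf)
    then have rR: "r \<in> R" using rW by (auto simp: R_def orthogonal_commute)
    have rf: "r \<bullet> f = y \<bullet> f" if "f \<in> F" for f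
      using that F(1) perp[OF kK] wy[of f] by (auto simp: r_def inner_diff_left R_def)
    have nr: "(norm r)\<^sup>2 = (sq_sum F y)"
      using parseval[OF F(2,3) _ fin(1), of r] rR F(6) rf by simp
    have nk: "(norm k)\<^sup>2 = (sq_sum G y)"
      using parseval[OF G(2,3) _ fin(2), of k] kK G(1,6) KW kf wy by (simp add: subset_eq)
    have w: "w = r + k" by (simp add: r_def)
    have "(norm w)\<^sup>2 = (norm r)\<^sup>2 + (norm k)\<^sup>2"
      unfolding w using perp[OF kK rR]
      by (intro norm_add_Pythagorean) (simp add: orthogonal_def inner_commute)
    then have c1: "(norm w)\<^sup>2 = (sq_sum F y) + (sq_sum G y)" by (simp only: nr nk)
    have pk: "p k = k" using kK by (simp add: K_def pV)
    \<comment> \<open>The component along \<open>K\<close> is fixed by p and disappears from the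
      defect; only the component r along \<open>F\<close> matters.\<close>
    have wp: "w - p w = r - p r" unfolding w using pk by (simp add: linear_add[OF pD(1)])
    have split: "(norm r)\<^sup>2 = (norm (p r))\<^sup>2 + (norm (r - p r))\<^sup>2" by (rule orth_proj_norm[OF p])
    have c2: "(norm (w - p w))\<^sup>2 \<le> (norm r)\<^sup>2" unfolding wp split by simp
    \<comment> \<open>The part b of p r orthogonal to \<open>A\<close> lies in \<open>K\<close>,
      hence is orthogonal to r; moving p across the inner product gives b . p r = b . r = 0, so b
      vanishes.\<close>
    have "p r \<in> A"
    proof -
      obtain a b where ab: "p r = a + b" "a \<in> span A" "\<And>v. v \<in> span A \<Longrightarrow> orthogonal b v"
        using orthogonal_subspace_decomp_exists[of A "p r"] by metis
      have aA: "a \<in> A" using ab(2) sA by (simp add: span_eq_iff[THEN iffD2])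
      have "b = p r - a" using ab(1) by simp
      then have "b \<in> V" using aA AV sV by (auto simp: V_def intro: subspace_diff)
      then have bK: "b \<in> K" using ab(3) by (auto simp: K_def orthogonal_commute span_base)
      have "b \<bullet> p r = p b \<bullet> r" by (simp add: pD(2))
      also have "\<dots> = 0" using bK perp rR by (simp add: K_def pV)
      finally have "b \<bullet> b = 0"
        using ab(3)[OF span_base[OF aA]] by (simp add: ab(1) inner_add_right orthogonal_def)
      then show ?thesis using ab(1) aA by simp
    qed
    then obtain z where z: "z \<in> U" "p r = p z" by (auto simp: A_def)
    have ur: "u r = 0" using rW by (simp add: uW)
    have rz: "r \<bullet> z = 0" using uD(2)[of r z] uU[OF z(1)] ur by simp
    \<comment> \<open>With p r = p z for some z in \<open>U\<close> orthogonal to r, a equals - (r -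
      p r) . (z - p z), so a^2 <= b e by Cauchy-Schwarz. Closeness of z gives (1 - x) e <= x a.
      Eliminating e yields (1 - x) a <= x b, that is (1 - x) |r|^2 <= |r - p r|^2.\<close>
    define a b e where "a = (norm (p r))\<^sup>2" and "b = (norm (r - p r))\<^sup>2" and "e = (norm (z - p z))\<^sup>2"
    have nn: "0 \<le> a" "0 \<le> b" "0 \<le> e" by (simp_all add: a_def b_def e_def)
    have "a = r \<bullet> p z" unfolding a_def power2_norm_eq_inner using pD(2)[of r "p r"] pD(3)[of r] z(2) by simp
    also have "\<dots> = - ((r - p r) \<bullet> (z - p z))"
      using rz pD(2)[of r z] pD(2)[of r "p z"] pD(3)[of z] by (simp add: inner_diff_left inner_diff_right)
    also have "\<dots> \<le> norm (r - p r) * norm (z - p z)"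
      using norm_cauchy_schwarz[of "- (r - p r)" "z - p z"] by (simp only: inner_minus_left norm_minus_cancel)
    finally have "a\<^sup>2 \<le> (norm (r - p r) * norm (z - p z))\<^sup>2" using nn(1) by (rule power_mono)
    then have a2: "a * a \<le> b * e" by (simp add: b_def e_def power2_eq_square ac_simps)
    have "e \<le> x * (norm z)\<^sup>2" unfolding e_def by (rule closeU[OF z(1)])
    also have "(norm z)\<^sup>2 = a + e" unfolding a_def e_def z(2) by (rule orth_proj_norm[OF p])
    finally have ea: "(1 - x) * e \<le> x * a" by (simp add: algebra_simps)
    have "(1 - x) * a \<le> x * b"
    proof (cases "a = 0")
      case True
      have "0 \<le> x * b" using x nn by simp
      then show ?thesis using True by simp
    next
      case False
      have "(1 - x) * (a * a) \<le> (1 - x) * (b * e)" using a2 x by (intro mult_left_mono) auto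
      also have "\<dots> = b * ((1 - x) * e)" by simp
      also have "\<dots> \<le> b * (x * a)" using ea nn by (intro mult_left_mono) auto
      finally have "((1 - x) * a) * a \<le> (x * b) * a" by (simp add: ac_simps)
      then show ?thesis using False nn by (simp add: mult_le_cancel_right)
    qed
    then have "(1 - x) * (a + b) \<le> b" by (simp add: algebra_simps)
    then have c3: "(1 - x) * (norm r)\<^sup>2 \<le> (norm (w - p w))\<^sup>2" unfolding wp split a_def b_def .
    show ?thesis using c1 c2 c3 unfolding nr w_def by simp
  qed
  show thesis
  proof
    show "F \<inter> G = {}"
    proof (rule ccontr)
      assume "F \<inter> G \<noteq> {}"
      then obtain f where "f \<in> F" "f \<in> G" by auto
      then have "f \<bullet> f = 0" by (intro perp subsetD[OF G(1)] subsetD[OF F(1)])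
      then show False using F(3)[OF \<open>f \<in> F\<close>] by simp
    qed
    show "pairwise orthogonal (F \<union> G)"
    proof -
      have "f \<bullet> g = 0 \<and> g \<bullet> f = 0" if "f \<in> F" "g \<in> G" for f g
        using perp[of g f] that F(1) G(1) by (auto simp: inner_commute)
      then show ?thesis
        using F(2) G(2) unfolding pairwise_def by (auto simp: orthogonal_def)
    qed
    show "norm f = 1" if "f \<in> F \<union> G" for f using that F(3) G(3) by auto
    show "card F + dim (range p) = DIM('a)" "card G + dim (range u) = dim (range p)"
      using dimR dimK dimW F(5) G(5) by (auto simp: V_def U_def)
  qed (use fin main in auto)
qed

section \<open>Convolution of power laws\<close>

text \<open>The Beta integral at integer arguments. Each induction step integrates by parts: the
  boundary terms of (x - y)^(r+1) y^(p+1) / (p+1) vanish, and one power moves from x - y to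
  y.\<close>

lemma has_integral_beta_nat:
  fixes x :: real
  assumes x: "0 \<le> x"
  shows "((\<lambda>y. (x - y) ^ r * y ^ p) has_integral fact r * fact p / fact (p + r + 1) * x ^ (p + r + 1)) {0..x}"
proof (induction r arbitrary: p)
  case 0
  have "((\<lambda>y. y ^ p) has_integral x ^ Suc p / real (Suc p) - 0 ^ Suc p / real (Suc p)) {0..x}"
  proof (rule fundamental_theorem_of_calculus[OF x])
    fix y
    have "((\<lambda>y. y ^ Suc p / real (Suc p)) has_real_derivative (real (Suc p) * y ^ (Suc p - Suc 0)) / real (Suc p)) (at y within {0..x})"
      by (rule DERIV_cdivide) (rule DERIV_subset[OF DERIV_pow subset_UNIV])
    then show "((\<lambda>y. y ^ Suc p / real (Suc p)) has_vector_derivative y ^ p) (at y within {0..x})"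
      by (simp add: has_real_derivative_iff_has_vector_derivative del: of_nat_Suc)
  qed
  moreover have "x ^ Suc p / real (Suc p) - 0 ^ Suc p / real (Suc p) = fact 0 * fact p / fact (p + 0 + 1) * x ^ (p + 0 + 1)"
    by (simp del: of_nat_Suc power_Suc)
  ultimately show ?case by simp
next
  case (Suc r)
  have "((\<lambda>y. (x - y) ^ Suc r * y ^ p - real (Suc r) / real (Suc p) * ((x - y) ^ r * y ^ Suc p))
     has_integral (x - x) ^ Suc r * x ^ Suc p / real (Suc p) - (x - 0) ^ Suc r * 0 ^ Suc p / real (Suc p)) {0..x}"
  proof (rule fundamental_theorem_of_calculus[OF x])
    fix y
    have "((\<lambda>y. (x - y) ^ Suc r * y ^ Suc p / real (Suc p)) has_real_derivative
       (real (Suc r) * ((x - y) ^ r * (- 1)) * y ^ Suc p + (x - y) ^ Suc r * (real (Suc p) * y ^ p)) / real (Suc p)) (at y within {0..x})"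
      by (auto intro!: derivative_eq_intros simp del: power_Suc of_nat_Suc)
    moreover have "(real (Suc r) * ((x - y) ^ r * (- 1)) * y ^ Suc p + (x - y) ^ Suc r * (real (Suc p) * y ^ p)) / real (Suc p)
       = (x - y) ^ Suc r * y ^ p - real (Suc r) / real (Suc p) * ((x - y) ^ r * y ^ Suc p)"
      by (simp add: add_divide_distrib diff_divide_distrib del: power_Suc of_nat_Suc)
    ultimately show "((\<lambda>y. (x - y) ^ Suc r * y ^ Suc p / real (Suc p)) has_vector_derivative
       (x - y) ^ Suc r * y ^ p - real (Suc r) / real (Suc p) * ((x - y) ^ r * y ^ Suc p)) (at y within {0..x})"
      by (simp only: has_real_derivative_iff_has_vector_derivative)
  qed
  then have "((\<lambda>y. (x - y) ^ Suc r * y ^ p - real (Suc r) / real (Suc p) * ((x - y) ^ r * y ^ Suc p)) has_integral 0) {0..x}"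
    by simp
  from has_integral_add[OF this has_integral_mult_right[OF Suc.IH[of "Suc p"], of "real (Suc r) / real (Suc p)"]]
  have "((\<lambda>y. (x - y) ^ Suc r * y ^ p) has_integral
     real (Suc r) / real (Suc p) * (fact r * fact (Suc p) / fact (Suc p + r + 1) * x ^ (Suc p + r + 1))) {0..x}"
    by simp
  moreover have "real (Suc r) / real (Suc p) * (fact r * fact (Suc p) / fact (Suc p + r + 1) * x ^ (Suc p + r + 1))
    = fact (Suc r) * fact p / fact (p + Suc r + 1) * x ^ (p + Suc r + 1)"
  proof -
    have "Suc p + r + 1 = p + Suc r + 1" by simp
    moreover have "fact (Suc r) = real (Suc r) * fact r" "fact (Suc p) = real (Suc p) * fact p" by simp_all
    ultimately show ?thesis by (simp del: fact_Suc of_nat_Suc power_Suc)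
  qed
  ultimately show ?case by (simp only:)
qed

text \<open>Minus the derivative of (x - y)^(r+1) in y, cut off to [0, x]: its integral from X to x
  is (x - X)^(r+1).\<close>

abbreviation beta_kernel :: "nat \<Rightarrow> real \<Rightarrow> real \<Rightarrow> ennreal" where
  "beta_kernel r x y \<equiv> ennreal (real (Suc r) * (x - y) ^ r) * indicator {0..x} y"

lemma nn_integral_beta_nat:
  assumes x: "0 \<le> x" and a: "0 \<le> a"
  shows "(\<integral>\<^sup>+y. beta_kernel r x y * ennreal (a * y ^ p) \<partial>lborel)
    = ennreal (a * (fact (Suc r) * fact p / fact (p + Suc r)) * x ^ (p + Suc r))"
proof -
  have "((\<lambda>y. (a * real (Suc r)) * ((x - y) ^ r * y ^ p)) has_integral
     (a * real (Suc r)) * (fact r * fact p / fact (p + r + 1) * x ^ (p + r + 1))) {0..x}"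
    by (rule has_integral_mult_right[OF has_integral_beta_nat[OF x]])
  then have "(\<integral>\<^sup>+y. ennreal (indicator {0..x} y * ((a * real (Suc r)) * ((x - y) ^ r * y ^ p))) \<partial>lborel)
     = ennreal ((a * real (Suc r)) * (fact r * fact p / fact (p + r + 1) * x ^ (p + r + 1)))"
    using a by (intro nn_integral_has_integral_lebesgue) auto
  moreover have "(a * real (Suc r)) * (fact r * fact p / fact (p + r + 1) * x ^ (p + r + 1))
     = a * (fact (Suc r) * fact p / fact (p + Suc r)) * x ^ (p + Suc r)"
    by simp
  moreover have "beta_kernel r x y * ennreal (a * y ^ p)
    = ennreal (indicator {0..x} y * ((a * real (Suc r)) * ((x - y) ^ r * y ^ p)))" for y
    using a by (auto simp: indicator_def ennreal_mult'[symmetric] ac_simps simp del: of_nat_Suc)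
  ultimately show ?thesis by (simp only:)
qed

abbreviation sublevel :: "'b measure \<Rightarrow> ('b \<Rightarrow> real) \<Rightarrow> real \<Rightarrow> 'b set" where
  "sublevel M X y \<equiv> {\<xi>\<in>space M. X \<xi> \<le> y}"

text \<open>Layer cake formula. It expresses the expectation of the truncated power through the
  distribution function of \<open>X\<close> alone, so that power bounds on that function can be
  inserted.\<close>

lemma nn_integral_truncated_power:
  assumes "sigma_finite_measure M" and X[measurable]: "X \<in> borel_measurable M" and pos: "\<And>\<omega>. \<omega> \<in> space M \<Longrightarrow> 0 \<le> X \<omega>"
    and x: "0 \<le> x"
  shows "(\<integral>\<^sup>+\<omega>. ennreal ((x - X \<omega>) ^ Suc r) * indicator {..x} (X \<omega>) \<partial>M)
    = (\<integral>\<^sup>+y. beta_kernel r x y * emeasure M {\<omega>\<in>space M. X \<omega> \<le> y} \<partial>lborel)"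
proof -
  interpret M: sigma_finite_measure M by fact
  interpret pair_sigma_finite lborel M by standard
  have "(\<integral>\<^sup>+y. beta_kernel r x y * emeasure M {\<omega>\<in>space M. X \<omega> \<le> y} \<partial>lborel)
    = (\<integral>\<^sup>+y. (\<integral>\<^sup>+\<omega>. beta_kernel r x y * indicator {X \<omega>..} y \<partial>M) \<partial>lborel)"
  proof (rule nn_integral_cong)
    fix y
    have "{\<omega>\<in>space M. X \<omega> \<le> y} \<in> sets M" by measurable
    then have "emeasure M {\<omega>\<in>space M. X \<omega> \<le> y} = (\<integral>\<^sup>+\<omega>. indicator {\<omega>\<in>space M. X \<omega> \<le> y} \<omega> \<partial>M)" by simp
    also have "\<dots> = (\<integral>\<^sup>+\<omega>. indicator {X \<omega>..} y \<partial>M)" by (intro nn_integral_cong) (auto simp: indicator_def)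
    finally show "beta_kernel r x y * emeasure M {\<omega>\<in>space M. X \<omega> \<le> y}
      = (\<integral>\<^sup>+\<omega>. beta_kernel r x y * indicator {X \<omega>..} y \<partial>M)"
      by (subst nn_integral_cmult) (auto simp: indicator_def)
  qed
  also have "\<dots> = (\<integral>\<^sup>+\<omega>. (\<integral>\<^sup>+y. beta_kernel r x y * indicator {X \<omega>..} y \<partial>lborel) \<partial>M)"
  proof (rule Fubini'[symmetric])
    have "(\<lambda>(y, \<omega>). beta_kernel r x y * indicator {X \<omega>..} y)
       = (\<lambda>z. ennreal (real (Suc r) * (x - fst z) ^ r) * indicator {0..x} (fst z) * (if X (snd z) \<le> fst z then 1 else 0))"
      by (auto simp: indicator_def fun_eq_iff)
    also have "\<dots> \<in> borel_measurable (lborel \<Otimes>\<^sub>M M)" by measurable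
    finally show "(\<lambda>(y, \<omega>). beta_kernel r x y * indicator {X \<omega>..} y)
      \<in> borel_measurable (lborel \<Otimes>\<^sub>M M)" .
  qed
  also have "\<dots> = (\<integral>\<^sup>+\<omega>. ennreal ((x - X \<omega>) ^ Suc r) * indicator {..x} (X \<omega>) \<partial>M)"
  proof (rule nn_integral_cong)
    fix \<omega> assume \<omega>: "\<omega> \<in> space M"
    show "(\<integral>\<^sup>+y. beta_kernel r x y * indicator {X \<omega>..} y \<partial>lborel)
       = ennreal ((x - X \<omega>) ^ Suc r) * indicator {..x} (X \<omega>)"
    proof (cases "X \<omega> \<le> x")
      case True
      have "(\<integral>\<^sup>+y. beta_kernel r x y * indicator {X \<omega>..} y \<partial>lborel)
        = (\<integral>\<^sup>+y. ennreal (real (Suc r) * (x - y) ^ r) * indicator {X \<omega>..x} y \<partial>lborel)"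
        using pos[OF \<omega>] by (intro nn_integral_cong) (auto simp: indicator_def)
      also have "\<dots> = ennreal (- ((x - x) ^ Suc r) - (- ((x - X \<omega>) ^ Suc r)))"
      proof (rule nn_integral_FTC_Icc[where F="\<lambda>y. - ((x - y) ^ Suc r)"])
        show "((\<lambda>y. - ((x - y) ^ Suc r)) has_real_derivative real (Suc r) * (x - y) ^ r) (at y)" for y
          by (auto intro!: derivative_eq_intros simp del: power_Suc of_nat_Suc)
        show "0 \<le> real (Suc r) * (x - y) ^ r" if "y \<in> {X \<omega>..x}" for y using that by simp
        show "(\<lambda>y. real (Suc r) * (x - y) ^ r) \<in> borel_measurable borel" by measurable
      qed (rule True)
      finally show ?thesis using True by simp
    next
      case False
      then have "(\<integral>\<^sup>+y. beta_kernel r x y * indicator {X \<omega>..} y \<partial>lborel) = (\<integral>\<^sup>+y. 0 \<partial>(lborel :: real measure))"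
        by (intro nn_integral_cong) (auto simp: indicator_def)
      then show ?thesis using False by simp
    qed
  qed
  finally show ?thesis by (rule sym)
qed

text \<open>In the inductions \<open>X\<close> is the sum of the terms so far and \<open>h\<close>
  the conditional probability that one more term fits into the remaining x - X. The exponents p and
  r + 1 add up, and the coefficients are multiplied by the Beta factor p! (r+1)! / (p+r+1)!.\<close>

lemma small_ball_convolution_upper:
  assumes M: "sigma_finite_measure M" and X: "X \<in> borel_measurable M" and pos: "\<And>\<omega>. \<omega> \<in> space M \<Longrightarrow> 0 \<le> X \<omega>"
    and x: "0 \<le> x" and a: "0 \<le> a" and b: "0 \<le> b"
    and F: "\<And>y. 0 \<le> y \<Longrightarrow> y \<le> x \<Longrightarrow> emeasure M {\<omega>\<in>space M. X \<omega> \<le> y} \<le> ennreal (a * y ^ p)"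
    and h: "AE \<omega> in M. h \<omega> \<le> ennreal (b * (x - X \<omega>) ^ Suc r) * indicator {..x} (X \<omega>)"
  shows "(\<integral>\<^sup>+\<omega>. h \<omega> \<partial>M) \<le> ennreal (a * b * (fact (Suc r) * fact p / fact (p + Suc r)) * x ^ (p + Suc r))"
proof -
  note [measurable] = X
  have trunc: "(\<integral>\<^sup>+\<omega>. ennreal ((x - X \<omega>) ^ Suc r) * indicator {..x} (X \<omega>) \<partial>M)
    = (\<integral>\<^sup>+y. beta_kernel r x y * emeasure M {\<omega>\<in>space M. X \<omega> \<le> y} \<partial>lborel)"
    using M X pos x by (rule nn_integral_truncated_power)
  have "(\<integral>\<^sup>+\<omega>. h \<omega> \<partial>M) \<le> (\<integral>\<^sup>+\<omega>. ennreal b * (ennreal ((x - X \<omega>) ^ Suc r) * indicator {..x} (X \<omega>)) \<partial>M)"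
    using h b by (intro nn_integral_mono_AE) (auto simp: ennreal_mult' mult.assoc simp del: power_Suc)
  also have "\<dots> = ennreal b * (\<integral>\<^sup>+\<omega>. ennreal ((x - X \<omega>) ^ Suc r) * indicator {..x} (X \<omega>) \<partial>M)"
    by (rule nn_integral_cmult) measurable
  also have "\<dots> \<le> ennreal b * (\<integral>\<^sup>+y. beta_kernel r x y * ennreal (a * y ^ p) \<partial>lborel)"
    unfolding trunc
  proof (rule mult_left_mono[OF nn_integral_mono])
    fix y
    show "beta_kernel r x y * emeasure M {\<omega>\<in>space M. X \<omega> \<le> y}
      \<le> beta_kernel r x y * ennreal (a * y ^ p)"
      using F[of y] by (cases "y \<in> {0..x}") (auto intro: mult_left_mono simp del: of_nat_Suc)
  qed simp
  also have "\<dots> = ennreal (b * (a * (fact (Suc r) * fact p / fact (p + Suc r)) * x ^ (p + Suc r)))"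
    unfolding nn_integral_beta_nat[OF x a] using b by (simp only: ennreal_mult')
  finally show ?thesis by (simp only: ac_simps)
qed

lemma small_ball_convolution_lower:
  assumes M: "sigma_finite_measure M" and X: "X \<in> borel_measurable M" and pos: "\<And>\<omega>. \<omega> \<in> space M \<Longrightarrow> 0 \<le> X \<omega>"
    and x: "0 \<le> x" and a: "0 \<le> a" and b: "0 \<le> b"
    and F: "\<And>y. 0 \<le> y \<Longrightarrow> y \<le> x \<Longrightarrow> ennreal (a * y ^ p) \<le> emeasure M {\<omega>\<in>space M. X \<omega> \<le> y}"
    and h: "AE \<omega> in M. ennreal (b * (x - X \<omega>) ^ Suc r) * indicator {..x} (X \<omega>) \<le> h \<omega>"
  shows "ennreal (a * b * (fact (Suc r) * fact p / fact (p + Suc r)) * x ^ (p + Suc r)) \<le> (\<integral>\<^sup>+\<omega>. h \<omega> \<partial>M)"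
proof -
  note [measurable] = X
  have trunc: "(\<integral>\<^sup>+\<omega>. ennreal ((x - X \<omega>) ^ Suc r) * indicator {..x} (X \<omega>) \<partial>M)
    = (\<integral>\<^sup>+y. beta_kernel r x y * emeasure M {\<omega>\<in>space M. X \<omega> \<le> y} \<partial>lborel)"
    using M X pos x by (rule nn_integral_truncated_power)
  have "ennreal (a * b * (fact (Suc r) * fact p / fact (p + Suc r)) * x ^ (p + Suc r))
     = ennreal (b * (a * (fact (Suc r) * fact p / fact (p + Suc r)) * x ^ (p + Suc r)))" by (simp only: ac_simps)
  also have "\<dots> = ennreal b * (\<integral>\<^sup>+y. beta_kernel r x y * ennreal (a * y ^ p) \<partial>lborel)"
    unfolding nn_integral_beta_nat[OF x a] using b by (simp only: ennreal_mult')
  also have "\<dots> \<le> ennreal b * (\<integral>\<^sup>+\<omega>. ennreal ((x - X \<omega>) ^ Suc r) * indicator {..x} (X \<omega>) \<partial>M)"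
    unfolding trunc
  proof (rule mult_left_mono[OF nn_integral_mono])
    fix y
    show "beta_kernel r x y * ennreal (a * y ^ p)
      \<le> beta_kernel r x y * emeasure M {\<omega>\<in>space M. X \<omega> \<le> y}"
      using F[of y] by (cases "y \<in> {0..x}") (auto intro: mult_left_mono simp del: of_nat_Suc)
  qed simp
  also have "\<dots> = (\<integral>\<^sup>+\<omega>. ennreal b * (ennreal ((x - X \<omega>) ^ Suc r) * indicator {..x} (X \<omega>)) \<partial>M)"
    by (rule nn_integral_cmult[symmetric]) measurable
  also have "\<dots> \<le> (\<integral>\<^sup>+\<omega>. h \<omega> \<partial>M)"
    using h b by (intro nn_integral_mono_AE) (auto simp: ennreal_mult' mult.assoc simp del: power_Suc)
  finally show ?thesis .
qed

section \<open>Projections in complex coordinate space\<close>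

text \<open>The Hermitian product, conjugate linear in the first argument. Its real part is the real
  inner product in which projections and Gaussian measures are handled.\<close>

definition cinner :: "complex^'n \<Rightarrow> complex^'n \<Rightarrow> complex" where
  "cinner x y = (\<Sum>a\<in>UNIV. cnj (x $ a) * y $ a)"

lemma Re_cinner: "Re (cinner x y) = x \<bullet> y"
  by (simp add: cinner_def inner_vec_def inner_complex_def)

lemma cinner_commute: "cinner y x = cnj (cinner x y)"
  by (simp add: cinner_def mult.commute)

lemma cinner_linear_right:
  "cinner x (y + z) = cinner x y + cinner x z" "cinner x (y - z) = cinner x y - cinner x z"
  "cinner x (c *s y) = c * cinner x y" "cinner x (r *\<^sub>R y) = of_real r * cinner x y"
  "cinner x (\<Sum>i\<in>I. f i) = (\<Sum>i\<in>I. cinner x (f i))"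
  by (simp_all add: cinner_def algebra_simps sum.distrib sum_subtractf sum_distrib_left sum_component
      scaleR_conv_of_real[where 'a=complex] sum.swap[of _ UNIV I])

lemma cinner_linear_left:
  "cinner (y + z) x = cinner y x + cinner z x" "cinner (y - z) x = cinner y x - cinner z x"
  "cinner (c *s y) x = cnj c * cinner y x" "cinner (r *\<^sub>R y) x = of_real r * cinner y x"
  "cinner (\<Sum>i\<in>I. f i) x = (\<Sum>i\<in>I. cinner (f i) x)"
  by (simp_all add: cinner_commute[of _ x] cinner_linear_right)

lemma cinner_self: "cinner x x = of_real ((norm x)\<^sup>2)"
proof (rule complex_eqI)
  have "Im (cinner x x) = - Im (cinner x x)" by (subst cinner_commute) simp
  then show "Im (cinner x x) = Im (of_real ((norm x)\<^sup>2))" by simp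
qed (simp add: Re_cinner power2_norm_eq_inner)

lemma norm_vector_scalar_mult: "norm (c *s x) = cmod c * norm (x :: complex^'n)"
  by (simp add: norm_vec_def norm_mult L2_set_right_distrib)

lemma orthonormal_cols_cinner:
  "orthonormal_cols m v \<longleftrightarrow> (\<forall>i<m. \<forall>j<m. cinner (v i) (v j) = (if i = j then 1 else 0))"
  by (simp add: orthonormal_cols_def cinner_def)

lemma gen_proj_apply: "gen_proj m v *v y = (\<Sum>i<m. cinner (v i) y *s v i)"
  by (simp add: vec_eq_iff gen_proj_def matrix_vector_mult_def cinner_def sum_distrib_left sum_distrib_right
      sum.swap[of _ UNIV] ac_simps)

lemma cinner_gen_proj:
  "cinner (gen_proj m v *v x) y = (\<Sum>i<m. cnj (cinner (v i) x) * cinner (v i) y)"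
  by (simp add: gen_proj_apply cinner_linear_left)

lemma gen_proj_self:
  assumes "orthonormal_cols m v" "i < m"
  shows "gen_proj m v *v v i = v i"
proof -
  have "gen_proj m v *v v i = (\<Sum>j<m. if j = i then v i else 0)"
    unfolding gen_proj_apply using assms by (intro sum.cong) (auto simp: orthonormal_cols_cinner)
  then show ?thesis using assms by simp
qed

lemma matrix_vector_mult_scaleR: "(M :: complex^'n^'m) *v (r *\<^sub>R y) = r *\<^sub>R (M *v y)"
  by (simp add: vec_eq_iff matrix_vector_mult_def scaleR_sum_right)

lemma orth_proj_gen_proj:
  assumes v: "orthonormal_cols m v"
  shows "orth_proj (\<lambda>y. gen_proj m v *v y)"
  unfolding orth_proj_def
proof (intro conjI allI)
  show lin: "linear (\<lambda>y. gen_proj m v *v y)"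
    by (intro linearI matrix_vector_right_distrib matrix_vector_mult_scaleR)
  fix x y
  have "cinner (gen_proj m v *v x) y = cinner x (gen_proj m v *v y)"
    unfolding cinner_gen_proj by (subst gen_proj_apply)
      (simp add: cinner_linear_right cinner_commute[of x] mult.commute)
  then show "(gen_proj m v *v x) \<bullet> y = x \<bullet> (gen_proj m v *v y)"
    by (metis Re_cinner)
  have "gen_proj m v *v (gen_proj m v *v x) = (\<Sum>i<m. cinner (v i) x *s (gen_proj m v *v v i))"
    by (subst (2) gen_proj_apply) (simp add: linear_sum[OF lin] vector_scalar_commute)
  also have "\<dots> = (\<Sum>i<m. cinner (v i) x *s v i)"
    using v by (intro sum.cong refl) (simp add: gen_proj_self)
  finally show "gen_proj m v *v (gen_proj m v *v x) = gen_proj m v *v x" by (simp add: gen_proj_apply)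
qed

text \<open>The vectors v_i together with their multiples by the imaginary unit form a real
  orthonormal basis of the range.\<close>

lemma dim_range_gen_proj:
  fixes v :: "nat \<Rightarrow> complex^'n"
  assumes v: "orthonormal_cols m v"
  shows "dim (range (\<lambda>y. gen_proj m v *v y)) = 2 * m"
proof -
  define e where "e z = (if snd z then \<i> *s v (fst z) else v (fst z))" for z :: "nat \<times> bool"
  define I where "I = {..<m} \<times> (UNIV :: bool set)"
  have inner_e: "e z \<bullet> e z' = (if z = z' then 1 else 0)" if "z \<in> I" "z' \<in> I" for z z'
  proof -
    have "cinner (v (fst z)) (v (fst z')) = (if fst z = fst z' then 1 else 0)"
      using v that by (auto simp: I_def orthonormal_cols_cinner)
    then show ?thesis unfolding Re_cinner[symmetric] e_def
      by (auto simp: cinner_linear_left cinner_linear_right prod_eq_iff)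
  qed
  have inj: "inj_on e I"
  proof (rule inj_onI)
    fix z z' assume "z \<in> I" "z' \<in> I" "e z = e z'"
    then show "z = z'" using inner_e[of z z'] inner_e[of z z] by (auto split: if_splits)
  qed
  have "pairwise orthogonal (e ` I)"
    unfolding pairwise_def
  proof (intro ballI impI)
    fix a b assume "a \<in> e ` I" "b \<in> e ` I" "a \<noteq> b"
    then obtain z z' where "a = e z" "b = e z'" "z \<in> I" "z' \<in> I" "z \<noteq> z'" by blast
    then show "orthogonal a b" using inner_e[of z z'] by (simp add: orthogonal_def)
  qed
  moreover have "0 \<notin> e ` I"
  proof
    assume "0 \<in> e ` I"
    then obtain z where "z \<in> I" "e z = 0" by (metis imageE)
    then show False using inner_e[of z z] by simp
  qed
  ultimately have "independent (e ` I)" by (rule pairwise_orthogonal_independent)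
  moreover have "card (e ` I) = 2 * m" using inj by (simp add: card_image I_def)
  moreover have "span (e ` I) = range (\<lambda>y. gen_proj m v *v y)"
  proof
    have lin: "linear (\<lambda>y. gen_proj m v *v y)" using orth_projD(1)[OF orth_proj_gen_proj[OF v]] .
    show "span (e ` I) \<subseteq> range (\<lambda>y. gen_proj m v *v y)"
    proof (rule span_minimal)
      show "e ` I \<subseteq> range (\<lambda>y. gen_proj m v *v y)"
      proof
        fix y assume "y \<in> e ` I"
        then obtain i b where "i < m" "y = e (i, b)" by (auto simp: I_def)
        then have "gen_proj m v *v y = y"
          by (cases b) (simp_all add: e_def gen_proj_self[OF v] vector_scalar_commute)
        then show "y \<in> range (\<lambda>y. gen_proj m v *v y)" by (metis rangeI)
      qed
      show "subspace (range (\<lambda>y. gen_proj m v *v y))"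
        using linear_subspace_image[OF lin subspace_UNIV] .
    qed
    show "range (\<lambda>y. gen_proj m v *v y) \<subseteq> span (e ` I)"
    proof
      fix x assume "x \<in> range (\<lambda>y. gen_proj m v *v y)"
      then obtain y where y: "x = (\<Sum>i<m. cinner (v i) y *s v i)" by (auto simp: gen_proj_apply)
      have "c *s v i \<in> span (e ` I)" if "i < m" for c i
      proof -
        have "c *s v i = Re c *\<^sub>R e (i, False) + Im c *\<^sub>R e (i, True)"
          by (simp add: vec_eq_iff e_def complex_eq_iff)
        also have "\<dots> \<in> span (e ` I)"
          using that by (intro span_add span_scale span_base imageI) (auto simp: I_def)
        finally show ?thesis .
      qed
      then show "x \<in> span (e ` I)" unfolding y by (intro span_sum) auto
    qed
  qed
  ultimately show ?thesis by (metis dim_span dim_eq_card_independent)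
qed

section \<open>Gram-Schmidt orthonormalization of Gaussian vectors\<close>

text \<open>If the residual vanishes then \<open>gs g j = 0\<close>; this happens with probability 0 for \<open>j < n\<close>.\<close>

fun gs :: "(nat \<Rightarrow> complex^'n) \<Rightarrow> nat \<Rightarrow> complex^'n" where
  "gs g j = (let w = g j - (\<Sum>i<j. cinner (gs g i) (g j) *s gs g i) in (1 / norm w) *\<^sub>R w)"

declare gs.simps [simp del]

abbreviation gauss_PiM :: "nat set \<Rightarrow> (nat \<Rightarrow> complex^'n) measure" where
  "gauss_PiM I \<equiv> PiM I (\<lambda>_. gauss)"

definition gs_residual :: "(nat \<Rightarrow> complex^'n) \<Rightarrow> nat \<Rightarrow> complex^'n" where
  "gs_residual g j = g j - gen_proj j (gs g) *v g j"

text \<open>Partial sum of the squared chordal distance between P and the span of the Gaussian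
  vectors: for j = m and a rank m projection P it is that distance itself, and for smaller j it is
  the quantity on which the next step is conditioned.\<close>

definition gs_defect :: "complex^'n^'n \<Rightarrow> nat \<Rightarrow> (nat \<Rightarrow> complex^'n) \<Rightarrow> real" where
  "gs_defect P j g = (\<Sum>i<j. (norm (gs g i - P *v gs g i))\<^sup>2)"

lemma gs_eq: "gs g j = (1 / norm (gs_residual g j)) *\<^sub>R gs_residual g j"
  by (subst gs.simps) (simp add: Let_def gs_residual_def gen_proj_apply)

lemma gs_cong: "(\<And>i. i \<le> j \<Longrightarrow> g i = g' i) \<Longrightarrow> gs g j = gs g' j"
proof (induction j rule: less_induct)
  case (less j)
  have "gs g i = gs g' i" if "i < j" for i using that less by simp
  then have "(\<Sum>i<j. cinner (gs g i) (g j) *s gs g i) = (\<Sum>i<j. cinner (gs g' i) (g' j) *s gs g' i)"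
    using less.prems by (intro sum.cong) auto
  then show ?case using less.prems by (subst (1 2) gs.simps) (simp add: Let_def)
qed

lemma gs_upd: "i < j \<Longrightarrow> gs (g(j := y)) i = gs g i"
  by (rule gs_cong) auto

lemma gen_proj_cong: "(\<And>i. i < m \<Longrightarrow> v i = v' i) \<Longrightarrow> gen_proj m v = gen_proj m v'"
  by (simp add: gen_proj_def vec_eq_iff)

lemma gs_residual_upd: "gs_residual (g(j := y)) j = y - gen_proj j (gs g) *v y"
proof -
  have "gen_proj j (gs (g(j := y))) = gen_proj j (gs g)"
    by (rule gen_proj_cong) (rule gs_upd)
  then show ?thesis by (simp add: gs_residual_def)
qed

lemma gs_residual_upd_less: "i < j \<Longrightarrow> gs_residual (g(j := y)) i = gs_residual g i"
proof -
  assume i: "i < j"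
  have "gen_proj i (gs (g(j := y))) = gen_proj i (gs g)"
    by (rule gen_proj_cong) (use i in \<open>auto intro: gs_upd\<close>)
  then show ?thesis using i by (simp add: gs_residual_def)
qed

abbreviation unit_vec :: "'a::real_normed_vector \<Rightarrow> 'a" where
  "unit_vec w \<equiv> (1 / norm w) *\<^sub>R w"

text \<open>One step of orthonormalization for an arbitrary family; it serves both the Gram-Schmidt
  process and the completion of a frame to a full basis.\<close>

lemma orthonormal_cols_SucI:
  assumes u: "orthonormal_cols m u" and y: "y \<noteq> gen_proj m u *v y"
    and um: "u m = unit_vec (y - gen_proj m u *v y)"
  shows "orthonormal_cols (Suc m) u"
proof -
  have on: "cinner (u i) (u j) = (if i = j then 1 else 0)" if "i < m" "j < m" for i j
    using that u by (auto simp: orthonormal_cols_cinner)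
  define w where "w = y - gen_proj m u *v y"
  have w: "norm w \<noteq> 0" using y by (simp add: w_def)
  have um: "u m = (1 / norm w) *\<^sub>R w" unfolding w_def by (rule um)
  have iw: "cinner (u i) w = 0" if i: "i < m" for i
  proof -
    have "cinner (u i) (gen_proj m u *v y) = (\<Sum>j<m. if j = i then cinner (u j) y else 0)"
      unfolding gen_proj_apply cinner_linear_right using i on by (intro sum.cong) auto
    then show ?thesis using i by (simp add: w_def cinner_linear_right)
  qed
  have "cinner (u m) (u m) = 1"
    using w by (simp add: um cinner_linear_left cinner_linear_right cinner_self power2_eq_square)
  moreover have "cinner (u i) (u m) = 0" if "i < m" for i
    using iw[OF that] by (simp add: um cinner_linear_right)
  moreover have "cinner (u m) (u i) = 0" if "i < m" for i
    using iw[OF that] cinner_commute[of w "u i"] by (simp add: um cinner_linear_left)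
  ultimately show ?thesis
    unfolding orthonormal_cols_cinner using on by (auto simp: less_Suc_eq)
qed

lemma orthonormal_cols_gs:
  "(\<And>i. i < m \<Longrightarrow> gs_residual g i \<noteq> 0) \<Longrightarrow> orthonormal_cols m (gs g)"
proof (induction m)
  case 0
  then show ?case by (simp add: orthonormal_cols_def)
next
  case (Suc m)
  then have "orthonormal_cols m (gs g)" by simp
  moreover have "g m \<noteq> gen_proj m (gs g) *v g m"
    using Suc.prems[of m] by (simp add: gs_residual_def)
  moreover have "gs g m = unit_vec (g m - gen_proj m (gs g) *v g m)"
    by (subst gs_eq) (simp only: gs_residual_def)
  ultimately show ?case by (rule orthonormal_cols_SucI)
qed

section \<open>Measurability and almost sure nondegeneracy of the Gram-Schmidt process\<close>

lemma borel_measurable_cinner [measurable]: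
  assumes "f \<in> borel_measurable M" "g \<in> borel_measurable M"
  shows "(\<lambda>x. cinner (f x) (g x)) \<in> borel_measurable M"
proof (rule borel_measurable_continuous_Pair[OF assms])
  show "continuous_on UNIV (\<lambda>x. cinner (fst x) (snd x))"
    unfolding cinner_def by (intro continuous_intros)
qed

lemma borel_measurable_vector_scalar_mult [measurable]:
  fixes g :: "'b \<Rightarrow> complex^'n"
  assumes "f \<in> borel_measurable M" "g \<in> borel_measurable M"
  shows "(\<lambda>x. f x *s g x) \<in> borel_measurable M"
proof (rule borel_measurable_continuous_Pair[OF assms])
  show "continuous_on UNIV (\<lambda>x. fst x *s (snd x :: complex^'n))"
    unfolding vector_scalar_mult_def by (intro continuous_intros)
qed

lemma borel_measurable_matrix_vector_mult [measurable]:
  fixes P :: "complex^'n^'n"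
  assumes [measurable]: "f \<in> borel_measurable M"
  shows "(\<lambda>x. P *v f x) \<in> borel_measurable M"
proof -
  have "linear (\<lambda>y. P *v y)"
    by (intro linearI matrix_vector_right_distrib matrix_vector_mult_scaleR)
  then have "(\<lambda>y. P *v y) \<in> borel_measurable borel"
    by (intro borel_measurable_continuous_onI linear_continuous_on linear_conv_bounded_linear[THEN iffD1])
  then show ?thesis using assms by (rule measurable_compose_rev)
qed

lemma borel_measurable_gauss_component: "j \<in> I \<Longrightarrow> (\<lambda>g. g j) \<in> borel_measurable (gauss_PiM I)"
  using measurable_component_singleton[of j I "\<lambda>_. gauss"]
  by (simp add: measurable_cong_sets[OF refl sets_gauss])

lemma borel_measurable_gs [measurable]:
  "{..j} \<subseteq> I \<Longrightarrow> (\<lambda>g. gs g j) \<in> borel_measurable (gauss_PiM I :: (nat \<Rightarrow> complex^'n) measure)"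
proof (induction j rule: less_induct)
  case (less j)
  have [measurable]: "(\<lambda>g. gs g i) \<in> borel_measurable (gauss_PiM I :: (nat \<Rightarrow> complex^'n) measure)" if "i \<in> {..<j}" for i
    using that less by (intro less.IH) auto
  have [measurable]: "(\<lambda>g. g j) \<in> borel_measurable (gauss_PiM I :: (nat \<Rightarrow> complex^'n) measure)"
    using less.prems by (intro borel_measurable_gauss_component) auto
  have "(\<lambda>g. \<Sum>i<j. cinner (gs g i) (g j) *s gs g i) \<in> borel_measurable (gauss_PiM I :: (nat \<Rightarrow> complex^'n) measure)"
    by (intro borel_measurable_sum borel_measurable_vector_scalar_mult borel_measurable_cinner) measurable
  then show ?case
    by (subst gs.simps) (simp add: Let_def)
qed

lemma borel_measurable_gs_defect [measurable]:
  "{..<j} \<subseteq> I \<Longrightarrow> gs_defect P j \<in> borel_measurable (gauss_PiM I)"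
  unfolding gs_defect_def[abs_def]
  by (intro borel_measurable_sum borel_measurable_power measurable_compose[OF _ borel_measurable_norm] borel_measurable_diff
      borel_measurable_matrix_vector_mult borel_measurable_gs) auto

lemma borel_measurable_gs_residual [measurable]:
  assumes "{..j} \<subseteq> I"
  shows "(\<lambda>g. gs_residual g j) \<in> borel_measurable (gauss_PiM I :: (nat \<Rightarrow> complex^'n) measure)"
proof -
  have [measurable]: "(\<lambda>g. g j) \<in> borel_measurable (gauss_PiM I :: (nat \<Rightarrow> complex^'n) measure)"
    using assms by (intro borel_measurable_gauss_component) auto
  show ?thesis unfolding gs_residual_def gen_proj_apply
    using assms by (intro borel_measurable_diff borel_measurable_sum borel_measurable_vector_scalar_mult
        borel_measurable_cinner borel_measurable_gs) (auto, measurable)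
qed

text \<open>Conditioning on the first j coordinates. It drives both inductions, over Gaussian
  vectors and over the factors of the composite manifold.\<close>

lemma emeasure_PiM_lessThan_Suc:
  assumes N: "prob_space N" and A: "A \<in> sets (PiM {..<Suc j} (\<lambda>_. N))"
  shows "emeasure (PiM {..<Suc j} (\<lambda>_. N)) A
    = (\<integral>\<^sup>+\<xi>. emeasure N {y\<in>space N. \<xi>(j := y) \<in> A} \<partial>PiM {..<j} (\<lambda>_. N))"
proof -
  interpret prob_space N by fact
  interpret product_sigma_finite "\<lambda>_::nat. N" by standard
  note A' = A[unfolded lessThan_Suc]
  have "emeasure (PiM {..<Suc j} (\<lambda>_. N)) A = (\<integral>\<^sup>+f. indicator A f \<partial>PiM (insert j {..<j}) (\<lambda>_. N))"
    using A' by (simp add: lessThan_Suc)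
  also have "\<dots> = (\<integral>\<^sup>+\<xi>. (\<integral>\<^sup>+y. indicator A (\<xi>(j := y)) \<partial>N) \<partial>PiM {..<j} (\<lambda>_. N))"
    using A' by (intro product_nn_integral_insert) auto
  also have "\<dots> = (\<integral>\<^sup>+\<xi>. emeasure N {y\<in>space N. \<xi>(j := y) \<in> A} \<partial>PiM {..<j} (\<lambda>_. N))"
  proof (rule nn_integral_cong)
    fix \<xi> assume \<xi>: "\<xi> \<in> space (PiM {..<j} (\<lambda>_. N))"
    have "(\<lambda>y. \<xi>(j := y)) \<in> N \<rightarrow>\<^sub>M PiM (insert j {..<j}) (\<lambda>_. N)"
      using \<xi> by (intro measurable_component_update) auto
    from measurable_sets[OF this A'] have "{y\<in>space N. \<xi>(j := y) \<in> A} \<in> sets N"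
      by (simp add: vimage_def Int_def conj_commute)
    then have "emeasure N {y\<in>space N. \<xi>(j := y) \<in> A} = (\<integral>\<^sup>+y. indicator {y\<in>space N. \<xi>(j := y) \<in> A} y \<partial>N)" by simp
    also have "\<dots> = (\<integral>\<^sup>+y. indicator A (\<xi>(j := y)) \<partial>N)"
      by (intro nn_integral_cong) (auto simp: indicator_def)
    finally show "(\<integral>\<^sup>+y. indicator A (\<xi>(j := y)) \<partial>N) = emeasure N {y\<in>space N. \<xi>(j := y) \<in> A}" ..
  qed
  finally show ?thesis .
qed

lemma prob_space_PiM_gauss: "prob_space (gauss_PiM I)"
  by (intro prob_space_PiM prob_space_gauss)

lemma AE_gauss_not_in_subspace:
  fixes S :: "'a::euclidean_space set"
  assumes S: "subspace S" "dim S < DIM('a)"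
  shows "emeasure gauss S = 0"
proof -
  have [measurable]: "S \<in> sets borel" using closed_subspace[OF S(1)] by simp
  have "S \<in> null_sets lebesgue" using negligible_lowdim[OF S(2)] by (simp add: negligible_iff_null_sets)
  then have "emeasure lborel S = 0" by (simp add: null_sets_def)
  then have "S \<in> null_sets lborel" by (simp add: null_sets_def)
  then have "AE x in lborel. x \<notin> S" by (rule AE_not_in)
  then have "AE x in gauss. x \<notin> S" unfolding gauss_def by (subst AE_density) auto
  then show ?thesis by (subst AE_iff_measurable[symmetric, of _ _ "\<lambda>x. x \<notin> S"]) auto
qed

text \<open>If the first m residuals do not vanish, their normalizations span a space of real
  dimension 2m < 2n, and the next residual vanishes exactly when the next Gaussian vector falls into
  this null set.\<close>

lemma AE_gs_residual:
  "m \<le> CARD('n) \<Longrightarrow> AE g in (gauss_PiM {..<m} :: (nat \<Rightarrow> complex^'n) measure). \<forall>i<m. gs_residual g i \<noteq> 0"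
proof (induction m)
  case 0
  then show ?case by simp
next
  case (Suc m)
  let ?N = "gauss :: (complex^'n) measure"
  define B where "B = {g \<in> space (PiM {..<Suc m} (\<lambda>_. ?N)). \<exists>i<Suc m. gs_residual g i = 0}"
  have B: "B \<in> sets (PiM {..<Suc m} (\<lambda>_. ?N))"
  proof -
    have "{g \<in> space (PiM {..<Suc m} (\<lambda>_. ?N)). gs_residual g i = 0} \<in> sets (PiM {..<Suc m} (\<lambda>_. ?N))" if "i < Suc m" for i
    proof -
      have "(\<lambda>g. gs_residual g i) -` {0} \<inter> space (PiM {..<Suc m} (\<lambda>_. ?N)) \<in> sets (PiM {..<Suc m} (\<lambda>_. ?N))"
        by (rule measurable_sets[OF borel_measurable_gs_residual]) (use that in auto)
      then show ?thesis by (simp add: vimage_def Int_def conj_commute)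
    qed
    then have "(\<Union>i<Suc m. {g \<in> space (PiM {..<Suc m} (\<lambda>_. ?N)). gs_residual g i = 0}) \<in> sets (PiM {..<Suc m} (\<lambda>_. ?N))"
      by (intro sets.finite_UN) auto
    also have "(\<Union>i<Suc m. {g \<in> space (PiM {..<Suc m} (\<lambda>_. ?N)). gs_residual g i = 0}) = B"
      by (auto simp: B_def)
    finally show ?thesis .
  qed
  have "emeasure (PiM {..<Suc m} (\<lambda>_. ?N)) B
    = (\<integral>\<^sup>+\<xi>. emeasure ?N {y\<in>space ?N. \<xi>(m := y) \<in> B} \<partial>PiM {..<m} (\<lambda>_. ?N))"
    by (rule emeasure_PiM_lessThan_Suc[OF prob_space_gauss B])
  also have "\<dots> = (\<integral>\<^sup>+\<xi>. 0 \<partial>PiM {..<m} (\<lambda>_. ?N))"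
  proof (rule nn_integral_cong_AE)
    have "AE g in PiM {..<m} (\<lambda>_. ?N). \<forall>i<m. gs_residual g i \<noteq> 0" using Suc by simp
    then show "AE \<xi> in PiM {..<m} (\<lambda>_. ?N). emeasure ?N {y\<in>space ?N. \<xi>(m := y) \<in> B} = 0"
    proof eventually_elim
      case (elim \<xi>)
      define U where "U = range (\<lambda>y. gen_proj m (gs \<xi>) *v y)"
      have on: "orthonormal_cols m (gs \<xi>)" using elim by (intro orthonormal_cols_gs) auto
      have sU: "subspace U" unfolding U_def
        by (rule linear_subspace_image[OF orth_projD(1)[OF orth_proj_gen_proj[OF on]] subspace_UNIV])
      have "dim U < DIM(complex^'n)"
        unfolding U_def dim_range_gen_proj[OF on] using Suc.prems by simp
      then have U0: "emeasure ?N U = 0" by (rule AE_gauss_not_in_subspace[OF sU])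
      have "{y\<in>space ?N. \<xi>(m := y) \<in> B} \<subseteq> U"
      proof
        fix y assume "y \<in> {y\<in>space ?N. \<xi>(m := y) \<in> B}"
        then obtain i where i: "i < Suc m" "gs_residual (\<xi>(m := y)) i = 0" by (auto simp: B_def)
        show "y \<in> U"
        proof (cases "i = m")
          case True
          then have "y = gen_proj m (gs \<xi>) *v y" using i(2) by (simp add: gs_residual_upd)
          then show ?thesis unfolding U_def by (rule range_eqI)
        next
          case False
          then have "i < m" using i(1) by simp
          then show ?thesis using i(2) elim by (simp add: gs_residual_upd_less)
        qed
      qed
      moreover have "U \<in> sets ?N" using closed_subspace[OF sU] by simp
      ultimately show ?case using U0 by (metis emeasure_mono le_zero_eq)
    qed
  qed
  finally have "emeasure (PiM {..<Suc m} (\<lambda>_. ?N)) B = 0" by simp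
  then show ?case
    by (intro AE_I[of _ _ B] B) (auto simp: B_def)
qed

text \<open>Supplies the closeness hypothesis of \<open>orth_proj_adapted_frame\<close>. Expanding a
  vector in the frame u and applying P termwise, Cauchy-Schwarz bounds the defect of the vector by
  its norm and the sum of the defects of the u_i.\<close>

lemma gen_proj_close:
  fixes P :: "complex^'n^'n"
  assumes u: "orthonormal_cols j u"
  shows "(norm (gen_proj j u *v z - P *v (gen_proj j u *v z)))\<^sup>2
     \<le> (\<Sum>i<j. (norm (u i - P *v u i))\<^sup>2) * (norm (gen_proj j u *v z))\<^sup>2"
proof -
  define \<alpha> where "\<alpha> i = cinner (u i) z" for i
  have lin: "linear (\<lambda>y. P *v y)"
    by (intro linearI matrix_vector_right_distrib matrix_vector_mult_scaleR)
  have diff: "c *s (a - b) = c *s a - c *s b" for c and a b :: "complex^'n"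
    by (simp add: vec_eq_iff algebra_simps)
  have "gen_proj j u *v z - P *v (gen_proj j u *v z) = (\<Sum>i<j. \<alpha> i *s (u i - P *v u i))"
    by (simp add: gen_proj_apply linear_sum[OF lin] vector_scalar_commute \<alpha>_def sum_subtractf diff)
  then have "norm (gen_proj j u *v z - P *v (gen_proj j u *v z)) \<le> (\<Sum>i<j. norm (\<alpha> i *s (u i - P *v u i)))"
    by (simp only: norm_sum)
  also have "\<dots> = (\<Sum>i<j. \<bar>cmod (\<alpha> i)\<bar> * \<bar>norm (u i - P *v u i)\<bar>)"
    by (simp only: norm_vector_scalar_mult abs_norm_cancel)
  also have "\<dots> \<le> L2_set (\<lambda>i. cmod (\<alpha> i)) {..<j} * L2_set (\<lambda>i. norm (u i - P *v u i)) {..<j}"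
    by (rule L2_set_mult_ineq)
  finally have "(norm (gen_proj j u *v z - P *v (gen_proj j u *v z)))\<^sup>2
      \<le> (L2_set (\<lambda>i. cmod (\<alpha> i)) {..<j} * L2_set (\<lambda>i. norm (u i - P *v u i)) {..<j})\<^sup>2"
    by (rule power_mono) simp
  also have "\<dots> = (\<Sum>i<j. (cmod (\<alpha> i))\<^sup>2) * (\<Sum>i<j. (norm (u i - P *v u i))\<^sup>2)"
    by (simp add: power_mult_distrib L2_set_def sum_nonneg)
  also have "(\<Sum>i<j. (cmod (\<alpha> i))\<^sup>2) = (norm (gen_proj j u *v z))\<^sup>2"
  proof -
    define p where "p = gen_proj j u *v z"
    have "(norm p)\<^sup>2 = p \<bullet> z"
      using orth_projD(2,3)[OF orth_proj_gen_proj[OF u]] by (simp add: power2_norm_eq_inner p_def)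
    also have "\<dots> = Re (cinner p z)" by (simp add: Re_cinner)
    also have "cinner p z = of_real (\<Sum>i<j. (cmod (\<alpha> i))\<^sup>2)"
      by (simp add: p_def cinner_gen_proj \<alpha>_def mult.commute[of "cnj _"] complex_norm_square del: of_real_power)
    finally show ?thesis by (simp add: p_def)
  qed
  finally show ?thesis by (simp add: mult.commute)
qed

text \<open>Let w be the residual, so that Z = |w - p w|^2 / |w|^2 wherever w is nonzero. Writing F
  and G for the two sums of squares of the adapted frame, |w|^2 = F + G and |w - p w|^2 lies between
  (1 - x) F and F. So Z <= x - D forces F <= (x - D) / (1 - 2x) G and follows from F <= (x - D) G,
  and F, G are independent Gamma variables of shapes n - m and m - j.\<close>

lemma gs_step_small_ball:
  fixes v u :: "nat \<Rightarrow> complex^'n"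
  assumes v: "orthonormal_cols m v" and u: "orthonormal_cols j u"
    and n: "CARD('n) = m + Suc k" and m: "m = j + Suc l"
    and D: "D = (\<Sum>i<j. (norm (u i - gen_proj m v *v u i))\<^sup>2)" "D \<le> x" and x: "x < 1 / 2"
  defines "Z \<equiv> \<lambda>y. (norm (unit_vec (y - gen_proj j u *v y)
      - gen_proj m v *v (unit_vec (y - gen_proj j u *v y))))\<^sup>2"
    and "M \<equiv> fact (k + l + 1) / (fact (Suc k) * fact l)"
  shows "emeasure gauss {y. D + Z y \<le> x} \<le> ennreal (M * ((x - D) / (1 - 2 * x)) ^ Suc k)"
    and "ennreal (M * (x - D) ^ Suc k * (1 - (x - D) * real (k + l + 2))) \<le> emeasure gauss {y. D + Z y \<le> x}"
proof -
  define p where "p y = gen_proj m v *v y" for y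
  define w where "w y = y - gen_proj j u *v y" for y
  have p: "orth_proj p" unfolding p_def[abs_def] by (rule orth_proj_gen_proj[OF v])
  have D0: "0 \<le> D" unfolding D by (intro sum_nonneg) auto
  have close: "(norm (gen_proj j u *v z - p (gen_proj j u *v z)))\<^sup>2 \<le> x * (norm (gen_proj j u *v z))\<^sup>2" for z
  proof -
    have "(norm (gen_proj j u *v z - p (gen_proj j u *v z)))\<^sup>2 \<le> D * (norm (gen_proj j u *v z))\<^sup>2"
      unfolding p_def D(1) by (rule gen_proj_close[OF u])
    also have "\<dots> \<le> x * (norm (gen_proj j u *v z))\<^sup>2"
      using D(2) by (intro mult_right_mono) auto
    finally show ?thesis .
  qed
  obtain F G where FG: "finite F" "finite G" "F \<inter> G = {}" "pairwise orthogonal (F \<union> G)"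
    "\<And>f. f \<in> F \<union> G \<Longrightarrow> norm f = 1"
    "card F + dim (range p) = DIM(complex^'n)" "card G + dim (range (\<lambda>y. gen_proj j u *v y)) = dim (range p)"
    and W: "\<And>y. (norm (w y))\<^sup>2 = (sq_sum F y) + (sq_sum G y)"
    "\<And>y. (norm (w y - p (w y)))\<^sup>2 \<le> (sq_sum F y)"
    "\<And>y. (1 - x) * (sq_sum F y) \<le> (norm (w y - p (w y)))\<^sup>2"
    using orth_proj_adapted_frame[OF p orth_proj_gen_proj[OF u] _ _ close] D0 D(2) x unfolding w_def
    by (smt (verit) field_sum_of_halves)
  have dp: "dim (range p) = 2 * m" unfolding p_def[abs_def] by (rule dim_range_gen_proj[OF v])
  have cards: "card F = 2 * Suc k" "card G = 2 * Suc l"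
    using FG(6,7) unfolding dp dim_range_gen_proj[OF u] using n m by simp_all
  have Z: "Z y * (norm (w y))\<^sup>2 = (norm (w y - p (w y)))\<^sup>2" for y
  proof (cases "w y = 0")
    case True
    then show ?thesis using linear_0[OF orth_projD(1)[OF p]] by simp
  next
    case False
    have "Z y = (norm ((1 / norm (w y)) *\<^sub>R (w y - p (w y))))\<^sup>2"
      by (simp only: Z_def p_def w_def matrix_vector_mult_scaleR scaleR_diff_right[symmetric])
    then show ?thesis using False by (simp add: power_divide)
  qed
  \<comment> \<open>A vanishing residual is normalized to 0, since 1 / 0 = 0; then Z y = 0 and the
    inclusion for the lower bound persists.\<close>
  have Z0: "Z y = 0" if "w y = 0" for y
    using that by (simp add: Z_def w_def)
  have nn: "0 \<le> (sq_sum F y)" "0 \<le> (sq_sum G y)" for y by (auto intro: sum_nonneg)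
  have [measurable]: "Z \<in> borel_measurable borel" unfolding Z_def by measurable
  have x2: "0 < 1 - 2 * x" using x by simp
  have "{y. D + Z y \<le> x} \<subseteq> {y. (sq_sum F y) \<le> ((x - D) / (1 - 2 * x)) * (sq_sum G y)}"
  proof
    fix y assume "y \<in> {y. D + Z y \<le> x}"
    then have "Z y * (norm (w y))\<^sup>2 \<le> (x - D) * (norm (w y))\<^sup>2" by (intro mult_right_mono) auto
    then have *: "(1 - x) * (sq_sum F y) \<le> (x - D) * ((sq_sum F y) + (sq_sum G y))"
      using W(3)[of y] unfolding Z W(1)[symmetric] by linarith
    \<comment> \<open>As D >= 0, the bracket 1 - x - (x - D) is at least 1 - 2x, a bound independent
      of D.\<close>
    have "(1 - 2 * x) * (sq_sum F y) \<le> (1 - x - (x - D)) * (sq_sum F y)"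
      using D0 nn by (intro mult_right_mono) auto
    also have "\<dots> \<le> (x - D) * (sq_sum G y)" using * by (simp add: algebra_simps)
    finally show "y \<in> {y. (sq_sum F y) \<le> ((x - D) / (1 - 2 * x)) * (sq_sum G y)}"
      using x2 by (simp add: pos_le_divide_eq mult.commute)
  qed
  then have "emeasure gauss {y. D + Z y \<le> x}
     \<le> emeasure gauss {y. (sq_sum F y) \<le> ((x - D) / (1 - 2 * x)) * (sq_sum G y)}"
    by (rule emeasure_mono) simp
  also have "\<dots> \<le> ennreal (M * ((x - D) / (1 - 2 * x)) ^ Suc k)"
    unfolding M_def using FG(1-5) cards x2 D(2) by (intro gauss_ratio_small_ball(1)) auto
  finally show "emeasure gauss {y. D + Z y \<le> x} \<le> ennreal (M * ((x - D) / (1 - 2 * x)) ^ Suc k)" .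
  have sub: "{y. (sq_sum F y) \<le> (x - D) * (sq_sum G y)} \<subseteq> {y. D + Z y \<le> x}"
  proof
    fix y assume "y \<in> {y. (sq_sum F y) \<le> (x - D) * (sq_sum G y)}"
    then have "(sq_sum F y) \<le> (x - D) * (sq_sum G y)" by simp
    also have "\<dots> \<le> (x - D) * (norm (w y))\<^sup>2" unfolding W(1) using nn D(2) by (intro mult_left_mono) auto
    finally have *: "Z y * (norm (w y))\<^sup>2 \<le> (x - D) * (norm (w y))\<^sup>2" using W(2)[of y] unfolding Z by linarith
    have "Z y \<le> x - D"
    proof (cases "w y = 0")
      case True
      then show ?thesis using Z0 D(2) by simp
    next
      case False
      then show ?thesis using * by (simp add: mult_le_cancel_right)
    qed
    then show "y \<in> {y. D + Z y \<le> x}" by simp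
  qed
  have "ennreal (M * (x - D) ^ Suc k * (1 - (x - D) * real (k + l + 2)))
     \<le> emeasure gauss {y. (sq_sum F y) \<le> (x - D) * (sq_sum G y)}"
    unfolding M_def using FG(1-5) cards D(2) by (intro gauss_ratio_small_ball(2)) auto
  also have "\<dots> \<le> emeasure gauss {y. D + Z y \<le> x}"
    using sub by (rule emeasure_mono) simp
  finally show "ennreal (M * (x - D) ^ Suc k * (1 - (x - D) * real (k + l + 2))) \<le> emeasure gauss {y. D + Z y \<le> x}" .
qed

text \<open>Leading coefficient of the law of \<open>gs_defect\<close> after j steps, with c = n -
  m. Each step contributes the coefficient of a Gamma ratio and a Beta factor; c! cancels between
  them and the factorials of multiples of c telescope to 1 / (c j)!.\<close>

definition gs_coeff :: "nat \<Rightarrow> nat \<Rightarrow> nat \<Rightarrow> real" where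
  "gs_coeff c m j = (\<Prod>i<j. fact (c + m - Suc i) / fact (m - Suc i)) / fact (c * j)"

lemma gs_coeff_pos: "0 < gs_coeff c m j"
  by (auto simp: gs_coeff_def intro!: divide_pos_pos prod_pos)

lemma gs_coeff_Suc:
  assumes "m = j + Suc l"
  shows "gs_coeff (Suc k) m (Suc j) = gs_coeff (Suc k) m j * (fact (k + l + 1) / (fact (Suc k) * fact l))
     * (fact (Suc k) * fact (Suc k * j) / fact (Suc k * j + Suc k))"
proof -
  have "Suc k + m - Suc j = k + l + 1" "m - Suc j = l" "Suc k * Suc j = Suc k * j + Suc k" using assms by auto
  then show ?thesis unfolding gs_coeff_def prod.lessThan_Suc
    by (simp del: fact_Suc mult_Suc mult_Suc_right add_Suc_right)
qed

text \<open>The error factors contain x0 rather than x, because the convolution uses the bound for j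
  at all radii below x with a single coefficient. The upper error enters once for each power of x -
  D, hence the exponent (n - m) j; the lower one enters once for each step.\<close>

lemma gs_defect_small_ball:
  fixes v :: "nat \<Rightarrow> complex^'n"
  assumes v: "orthonormal_cols m v" and n: "CARD('n) = m + Suc k"
    and x0: "x0 < 1 / 2" "real CARD('n) * x0 < 1"
    and j: "j \<le> m" and x: "0 \<le> x" "x \<le> x0"
  shows "emeasure (gauss_PiM {..<j}) {g \<in> space (gauss_PiM {..<j}). gs_defect (gen_proj m v) j g \<le> x}
      \<le> ennreal ((1 / (1 - 2 * x0)) ^ (Suc k * j) * gs_coeff (Suc k) m j * x ^ (Suc k * j))" (is "?E j x \<le> ?U j x")
    and "ennreal ((1 - real CARD('n) * x0) ^ j * gs_coeff (Suc k) m j * x ^ (Suc k * j))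
      \<le> emeasure (gauss_PiM {..<j}) {g \<in> space (gauss_PiM {..<j}). gs_defect (gen_proj m v) j g \<le> x}" (is "?L j x \<le> _")
proof -
  let ?\<theta> = "1 / (1 - 2 * x0)" and ?\<zeta> = "1 - real CARD('n) * x0"
  have "?E j x \<le> ?U j x \<and> ?L j x \<le> ?E j x" using j x
  proof (induction j arbitrary: x)
    case 0
    interpret prob_space "PiM {..<0::nat} (\<lambda>_. gauss :: (complex^'n) measure)" by (rule prob_space_PiM_gauss)
    have "?E 0 x = 1" using emeasure_space_1 0 by (simp add: gs_defect_def)
    then show ?case by (simp add: gs_coeff_def)
  next
    case (Suc j)
    obtain l where l: "m = j + Suc l" using Suc.prems(1) by (metis add_Suc_right less_eq_Suc_le less_iff_Suc_add)
    let ?N = "gauss :: (complex^'n) measure"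
    let ?P = "gen_proj m v"
    let ?D = "gs_defect ?P j"
    let ?M = "PiM {..<j} (\<lambda>_. ?N)"
    define M where "M = (fact (k + l + 1) / (fact (Suc k) * fact l) :: real)"
    have M0: "0 \<le> M" by (simp add: M_def)
    interpret prob_space ?M by (rule prob_space_PiM_gauss)
    define A where "A = {g \<in> space (PiM {..<Suc j} (\<lambda>_. ?N)). gs_defect ?P (Suc j) g \<le> x}"
    have A: "A \<in> sets (PiM {..<Suc j} (\<lambda>_. ?N))"
    proof -
      have [measurable]: "gs_defect ?P (Suc j) \<in> borel_measurable (PiM {..<Suc j} (\<lambda>_. ?N))"
        by (rule borel_measurable_gs_defect) simp
      show ?thesis unfolding A_def by measurable
    qed
    define h where "h \<xi> = emeasure ?N {y\<in>space ?N. \<xi>(j := y) \<in> A}" for \<xi>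
    have E: "?E (Suc j) x = (\<integral>\<^sup>+\<xi>. h \<xi> \<partial>?M)"
      unfolding A_def[symmetric] h_def by (rule emeasure_PiM_lessThan_Suc[OF prob_space_gauss A])
    define Z where "Z \<xi> y = (norm (unit_vec (y - gen_proj j (gs \<xi>) *v y)
      - ?P *v (unit_vec (y - gen_proj j (gs \<xi>) *v y))))\<^sup>2" for \<xi> y
    have h: "h \<xi> = emeasure ?N {y. ?D \<xi> + Z \<xi> y \<le> x}" if \<xi>: "\<xi> \<in> space ?M" for \<xi>
    proof -
      have "gs_defect ?P (Suc j) (\<xi>(j := y)) = ?D \<xi> + Z \<xi> y" for y
      proof -
        have "gs (\<xi>(j := y)) j = unit_vec (y - gen_proj j (gs \<xi>) *v y)"
          by (subst gs_eq) (simp only: gs_residual_upd)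
        then show ?thesis unfolding gs_defect_def Z_def by (simp add: gs_upd)
      qed
      moreover have "\<xi>(j := y) \<in> space (PiM {..<Suc j} (\<lambda>_. ?N))" for y
        using \<xi> by (auto simp: space_PiM PiE_def extensional_def)
      ultimately show ?thesis by (simp add: h_def A_def)
    qed
    have DX: "?D \<in> borel_measurable ?M" by (rule borel_measurable_gs_defect) simp
    have D0: "0 \<le> ?D \<xi>" for \<xi> by (auto simp: gs_defect_def intro: sum_nonneg)
    have xx: "x < 1 / 2" using Suc.prems x0 by simp
    have good: "AE \<xi> in ?M. \<xi> \<in> space ?M \<and> orthonormal_cols j (gs \<xi>)"
    proof -
      have "AE g in ?M. \<forall>i<j. gs_residual g i \<noteq> 0" using Suc.prems n by (intro AE_gs_residual) simp
      with AE_space show ?thesis by eventually_elim (auto intro: orthonormal_cols_gs)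
    qed
    have h0: "h \<xi> = 0" if "\<xi> \<in> space ?M" "\<not> ?D \<xi> \<le> x" for \<xi>
    proof -
      have "0 \<le> Z \<xi> y" for y by (simp add: Z_def)
      then have "{y. ?D \<xi> + Z \<xi> y \<le> x} = {}" using that(2) by (auto simp: not_le add_strict_increasing2 less_le_trans)
      then show ?thesis using h[OF that(1)] by simp
    qed
    have "?E (Suc j) x \<le> ennreal ((?\<theta> ^ (Suc k * j) * gs_coeff (Suc k) m j)
       * (M * ?\<theta> ^ Suc k) * (fact (Suc k) * fact (Suc k * j) / fact (Suc k * j + Suc k)) * x ^ (Suc k * j + Suc k))"
      unfolding E
    proof (rule small_ball_convolution_upper[where X="?D"])
      show "sigma_finite_measure ?M" ..
      show "AE \<xi> in ?M. h \<xi> \<le> ennreal (M * ?\<theta> ^ Suc k * (x - ?D \<xi>) ^ Suc k)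
          * indicator {..x} (?D \<xi>)"
        using good
      proof eventually_elim
        case (elim \<xi>)
        show ?case
        proof (cases "?D \<xi> \<le> x")
          case True
          have "h \<xi> \<le> ennreal (M * ((x - ?D \<xi>) / (1 - 2 * x)) ^ Suc k)"
            unfolding h[OF elim[THEN conjunct1]] Z_def M_def
            by (rule gs_step_small_ball(1)[OF v elim[THEN conjunct2] n l _ True xx]) (simp add: gs_defect_def)
          also have "\<dots> \<le> ennreal (M * ?\<theta> ^ Suc k * (x - ?D \<xi>) ^ Suc k)"
          proof (rule ennreal_leI)
            have "((x - ?D \<xi>) / (1 - 2 * x)) ^ Suc k \<le> ((x - ?D \<xi>) * ?\<theta>) ^ Suc k"
              using True Suc.prems x0 by (intro power_mono) (auto simp: divide_simps mult_left_mono)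
            then show "M * ((x - ?D \<xi>) / (1 - 2 * x)) ^ Suc k
                \<le> M * ?\<theta> ^ Suc k * (x - ?D \<xi>) ^ Suc k"
              unfolding mult.assoc using M0 by (intro mult_left_mono) (simp_all only: power_mult_distrib mult.commute)
          qed
          finally show ?thesis using True by simp
        next
          case False
          then show ?thesis using h0[of \<xi>] elim by simp
        qed
      qed
      show "0 \<le> ?\<theta> ^ (Suc k * j) * gs_coeff (Suc k) m j"
        using x0 gs_coeff_pos[of "Suc k" m j] by (intro mult_nonneg_nonneg zero_le_power) auto
      show "0 \<le> M * ?\<theta> ^ Suc k"
        using x0 M0 by (intro mult_nonneg_nonneg zero_le_power) auto
    qed (use DX D0 Suc in auto)
    also have "(?\<theta> ^ (Suc k * j) * gs_coeff (Suc k) m j)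
       * (M * ?\<theta> ^ Suc k) * (fact (Suc k) * fact (Suc k * j) / fact (Suc k * j + Suc k)) * x ^ (Suc k * j + Suc k)
       = ?\<theta> ^ (Suc k * Suc j) * gs_coeff (Suc k) m (Suc j) * x ^ (Suc k * Suc j)"
    proof -
      have e: "Suc k * Suc j = Suc k * j + Suc k" by simp
      show ?thesis unfolding gs_coeff_Suc[OF l] M_def e power_add[of ?\<theta>] by (simp only: ac_simps)
    qed
    finally have up: "?E (Suc j) x \<le> ?U (Suc j) x" .
    have "ennreal ((?\<zeta> ^ j * gs_coeff (Suc k) m j)
       * (M * ?\<zeta>) * (fact (Suc k) * fact (Suc k * j) / fact (Suc k * j + Suc k)) * x ^ (Suc k * j + Suc k))
       \<le> ?E (Suc j) x"
      unfolding E
    proof (rule small_ball_convolution_lower[where X="?D"])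
      show "sigma_finite_measure ?M" ..
      show "AE \<xi> in ?M. ennreal (M * ?\<zeta> * (x - ?D \<xi>) ^ Suc k)
          * indicator {..x} (?D \<xi>) \<le> h \<xi>"
        using good
      proof eventually_elim
        case (elim \<xi>)
        show ?case
        proof (cases "?D \<xi> \<le> x")
          case True
          have "M * ?\<zeta> * (x - ?D \<xi>) ^ Suc k
             \<le> M * (x - ?D \<xi>) ^ Suc k * (1 - (x - ?D \<xi>) * real (k + l + 2))"
          proof -
            \<comment> \<open>Here k + l + 2 = n - j, so n bounds the error coefficient in every
              step.\<close>
            have "(x - ?D \<xi>) * real (k + l + 2) \<le> x0 * real CARD('n)"
              using True Suc.prems D0[of \<xi>] n l by (intro mult_mono) auto
            then have "M * (x - ?D \<xi>) ^ Suc k * ?\<zeta>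
               \<le> M * (x - ?D \<xi>) ^ Suc k * (1 - (x - ?D \<xi>) * real (k + l + 2))"
              using True M0 by (intro mult_left_mono) (auto simp: mult.commute)
            then show ?thesis by (simp only: ac_simps)
          qed
          then have "ennreal (M * ?\<zeta> * (x - ?D \<xi>) ^ Suc k)
             \<le> ennreal (M * (x - ?D \<xi>) ^ Suc k * (1 - (x - ?D \<xi>) * real (k + l + 2)))"
            by (rule ennreal_leI)
          also have "\<dots> \<le> h \<xi>"
            unfolding h[OF elim[THEN conjunct1]] Z_def M_def
            by (rule gs_step_small_ball(2)[OF v elim[THEN conjunct2] n l _ True xx]) (simp add: gs_defect_def)
          finally show ?thesis using True by simp
        next
          case False
          then show ?thesis by simp
        qed
      qed
      show "0 \<le> ?\<zeta> ^ j * gs_coeff (Suc k) m j"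
        using x0 gs_coeff_pos[of "Suc k" m j] by (intro mult_nonneg_nonneg zero_le_power) auto
      show "0 \<le> M * ?\<zeta>"
        using x0 M0 by (intro mult_nonneg_nonneg) auto
    qed (use DX D0 Suc in auto)
    also have "(?\<zeta> ^ j * gs_coeff (Suc k) m j)
       * (M * ?\<zeta>) * (fact (Suc k) * fact (Suc k * j) / fact (Suc k * j + Suc k)) * x ^ (Suc k * j + Suc k)
       = ?\<zeta> ^ Suc j * gs_coeff (Suc k) m (Suc j) * x ^ (Suc k * Suc j)"
    proof -
      have e: "Suc k * Suc j = Suc k * j + Suc k" by simp
      show ?thesis unfolding gs_coeff_Suc[OF l] M_def e power_Suc by (simp only: ac_simps)
    qed
    finally have "?L (Suc j) x \<le> ?E (Suc j) x" .
    with up show ?case by simp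
  qed
  then show "?E j x \<le> ?U j x" and "?L j x \<le> ?E j x" by auto
qed

section \<open>Volume of chordal balls\<close>

lemma inner_complex_Re: "(x::complex) \<bullet> y = Re (cnj x * y)"
  by (simp add: inner_complex_def)

text \<open>The real inner product of matrices is the real part of the trace form, and a rank one
  matrix built from u evaluates the quadratic form at u.\<close>

lemma inner_matrix_gen_proj:
  "(M :: complex^'n^'n) \<bullet> gen_proj m u = (\<Sum>i<m. u i \<bullet> (M *v u i))"
proof -
  have e: "cinner (M *v u i) (u i) = (\<Sum>a\<in>UNIV. \<Sum>b\<in>UNIV. cnj (M $ a $ b) * (u i $ a * cnj (u i $ b)))" for i
    by (simp add: cinner_def matrix_vector_mult_def sum_distrib_right sum_distrib_left ac_simps)
  have "M \<bullet> gen_proj m u = Re (\<Sum>a\<in>UNIV. \<Sum>b\<in>UNIV. \<Sum>i<m. cnj (M $ a $ b) * (u i $ a * cnj (u i $ b)))"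
    by (simp add: inner_vec_def inner_complex_Re gen_proj_def sum_distrib_left)
  also have "(\<Sum>a\<in>UNIV. \<Sum>b\<in>UNIV. \<Sum>i<m. cnj (M $ a $ b) * (u i $ a * cnj (u i $ b)))
     = (\<Sum>a\<in>UNIV. \<Sum>i<m. \<Sum>b\<in>UNIV. cnj (M $ a $ b) * (u i $ a * cnj (u i $ b)))"
    by (intro sum.cong refl sum.swap)
  also have "\<dots> = (\<Sum>i<m. cinner (M *v u i) (u i))"
    unfolding e by (rule sum.swap)
  finally show ?thesis by (simp add: Re_cinner inner_commute)
qed

lemma frob_norm_eq_norm: "frob_norm M = norm M"
  by (simp add: frob_norm_def norm_vec_def L2_set_def sum_nonneg)

lemma chordal_dist_commute: "chordal_dist P Q = chordal_dist Q P"
  by (simp add: chordal_dist_def frob_norm_eq_norm norm_minus_commute)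

lemma chordal_dist_power2_eq: "(chordal_dist P Q)\<^sup>2 = (norm (P - Q))\<^sup>2 / 2"
  by (simp add: chordal_dist_def frob_norm_eq_norm power_divide)

text \<open>Expanding the Frobenius norm gives 2 (m - sum of u_i . P u_i), where P is the projection
  from v; the normalization of the chordal distance removes the 2, and 1 - u_i . P u_i is the
  squared residual of the unit vector u_i. The distance thus becomes a sum over the vectors of one
  frame.\<close>

lemma chordal_dist_gen_proj:
  assumes v: "orthonormal_cols m v" and u: "orthonormal_cols m u"
  shows "(chordal_dist (gen_proj m v) (gen_proj m u))\<^sup>2 = (\<Sum>i<m. (norm (u i - gen_proj m v *v u i))\<^sup>2)"
proof -
  have self: "gen_proj m w \<bullet> gen_proj m w = real m" if w: "orthonormal_cols m w" for w :: "nat \<Rightarrow> complex^'n"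
  proof -
    have "w i \<bullet> (gen_proj m w *v w i) = 1" if i: "i < m" for i
      using w i unfolding gen_proj_self[OF w i] Re_cinner[symmetric] by (simp add: orthonormal_cols_cinner)
    then show ?thesis by (simp add: inner_matrix_gen_proj)
  qed
  have n: "(norm (u i - gen_proj m v *v u i))\<^sup>2 = 1 - u i \<bullet> (gen_proj m v *v u i)" if i: "i < m" for i
  proof -
    have "u i \<bullet> u i = 1"
      using u i unfolding Re_cinner[symmetric] by (simp add: orthonormal_cols_cinner)
    then show ?thesis
      using orth_projD(2)[OF orth_proj_gen_proj[OF v], of "u i" "gen_proj m v *v u i"]
        orth_projD(3)[OF orth_proj_gen_proj[OF v], of "u i"]
      by (simp add: power2_norm_eq_inner inner_diff_left inner_diff_right inner_commute)
  qed
  have "(norm (gen_proj m v - gen_proj m u))\<^sup>2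
     = gen_proj m v \<bullet> gen_proj m v + gen_proj m u \<bullet> gen_proj m u - 2 * (gen_proj m v \<bullet> gen_proj m u)"
    by (simp add: power2_norm_eq_inner inner_diff_left inner_diff_right inner_commute)
  also have "\<dots> = 2 * (real m - (\<Sum>i<m. u i \<bullet> (gen_proj m v *v u i)))"
    unfolding self[OF v] self[OF u] by (simp add: inner_matrix_gen_proj)
  also have "real m - (\<Sum>i<m. u i \<bullet> (gen_proj m v *v u i)) = (\<Sum>i<m. (norm (u i - gen_proj m v *v u i))\<^sup>2)"
    by (simp add: n sum_subtractf)
  finally show ?thesis by (simp add: chordal_dist_power2_eq)
qed

lemma grassmannE:
  assumes "P \<in> grassmann m"
  obtains v where "orthonormal_cols m v" "P = gen_proj m v"
  using assms by (auto simp: grassmann_def)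

text \<open>Residuals of unit vectors have norm at most 1. This bound makes the distortion
  integrable and ends the tail integral of the random code at a finite radius.\<close>

lemma chordal_dist_power2_le:
  fixes P Q :: "complex^'n^'n"
  assumes "P \<in> grassmann m" "Q \<in> grassmann m"
  shows "(chordal_dist P Q)\<^sup>2 \<le> real m"
proof -
  obtain v where v: "orthonormal_cols m v" "P = gen_proj m v" using assms(1) by (rule grassmannE)
  obtain u where u: "orthonormal_cols m u" "Q = gen_proj m u" using assms(2) by (rule grassmannE)
  have "(norm (u i - gen_proj m v *v u i))\<^sup>2 \<le> 1" if i: "i < m" for i
  proof -
    have "(norm (u i))\<^sup>2 = 1"
      using u(1) i unfolding power2_norm_eq_inner Re_cinner[symmetric] by (simp add: orthonormal_cols_cinner)
    then show ?thesis
      using orth_proj_norm[OF orth_proj_gen_proj[OF v(1)], of "u i"] zero_le_power2[of "norm (gen_proj m v *v u i)"]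
      by linarith
  qed
  then have "(\<Sum>i<m. (norm (u i - gen_proj m v *v u i))\<^sup>2) \<le> (\<Sum>i<m. 1)" by (intro sum_mono) auto
  then show ?thesis unfolding v(2) u(2) chordal_dist_gen_proj[OF v(1) u(1)] by simp
qed

lemma cinner_unitary:
  assumes "unitary_mat U"
  shows "cinner (U *v x) (U *v y) = cinner x y"
proof -
  have adj: "cinner (U *v x) z = cinner x (cadj U *v z)" for z
  proof -
    have "cinner (U *v x) z = (\<Sum>a\<in>UNIV. \<Sum>b\<in>UNIV. cnj (x $ b) * (cnj (U $ a $ b) * z $ a))"
      by (simp add: cinner_def matrix_vector_mult_def sum_distrib_right sum_distrib_left ac_simps)
    also have "\<dots> = (\<Sum>b\<in>UNIV. \<Sum>a\<in>UNIV. cnj (x $ b) * (cnj (U $ a $ b) * z $ a))" by (rule sum.swap)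
    also have "\<dots> = cinner x (cadj U *v z)"
      by (simp add: cinner_def cadj_def matrix_vector_mult_def sum_distrib_left)
    finally show ?thesis .
  qed
  have "cinner (U *v x) (U *v y) = cinner x ((cadj U ** U) *v y)"
    by (simp add: adj matrix_vector_mul_assoc)
  then show ?thesis using assms by (simp add: unitary_mat_def)
qed

lemma norm_unitary_vec:
  assumes "unitary_mat U"
  shows "norm (U *v x) = norm x"
  using cinner_unitary[OF assms, of x x] by (simp add: cinner_self del: of_real_power)

lemma cadj_mult: "cadj (A ** B) = cadj B ** cadj A"
  by (simp add: vec_eq_iff cadj_def matrix_matrix_mult_def mult.commute)

lemma cadj_cadj [simp]: "cadj (cadj A) = A"
  by (simp add: vec_eq_iff cadj_def)

lemma norm_cadj: "norm (cadj A) = norm A"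
  unfolding frob_norm_eq_norm[symmetric] frob_norm_def
  by (simp add: cadj_def) (rule sum.swap)

lemma norm_unitary_mult:
  assumes U: "unitary_mat U"
  shows "norm (U ** M) = norm (M :: complex^'n^'n)"
proof -
  have "(norm (U ** M))\<^sup>2 = (norm M)\<^sup>2"
  proof -
    have sq: "(norm A)\<^sup>2 = (\<Sum>b\<in>UNIV. (norm (column b A))\<^sup>2)" for A :: "complex^'n^'n"
    proof -
      have "(norm A)\<^sup>2 = (\<Sum>a\<in>UNIV. \<Sum>b\<in>UNIV. (cmod (A $ a $ b))\<^sup>2)"
        unfolding frob_norm_eq_norm[symmetric] frob_norm_def by (simp add: sum_nonneg)
      also have "\<dots> = (\<Sum>b\<in>UNIV. \<Sum>a\<in>UNIV. (cmod (A $ a $ b))\<^sup>2)" by (rule sum.swap)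
      also have "\<dots> = (\<Sum>b\<in>UNIV. (norm (column b A))\<^sup>2)"
        by (simp add: norm_vec_def L2_set_def column_def sum_nonneg)
      finally show ?thesis .
    qed
    have "column b (U ** M) = U *v column b M" for b
      by (simp add: vec_eq_iff column_def matrix_matrix_mult_def matrix_vector_mult_def)
    then show ?thesis by (simp add: sq norm_unitary_vec[OF U])
  qed
  then show ?thesis by simp
qed

text \<open>The adjoint preserves the norm and turns the right factor into a left one, so left
  invariance suffices.\<close>

lemma norm_unitary_conj:
  assumes U: "unitary_mat U"
  shows "norm (U ** M ** cadj U) = norm M"
proof -
  have "norm (U ** M ** cadj U) = norm (U ** (M ** cadj U))" by (simp only: matrix_mul_assoc)
  also have "\<dots> = norm (M ** cadj U)" by (rule norm_unitary_mult[OF U])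
  also have "\<dots> = norm (cadj (M ** cadj U))" by (simp only: norm_cadj)
  also have "\<dots> = norm (U ** cadj M)" by (simp only: cadj_mult cadj_cadj)
  also have "\<dots> = norm (cadj M)" by (rule norm_unitary_mult[OF U])
  finally show ?thesis by (simp only: norm_cadj)
qed

lemma chordal_dist_unitary_conj:
  assumes U: "unitary_mat U"
  shows "chordal_dist (U ** P ** cadj U) (U ** Q ** cadj U) = chordal_dist P Q"
proof -
  have "U ** P ** cadj U - U ** Q ** cadj U = U ** (P - Q) ** cadj U"
    by (simp add: vec_eq_iff matrix_matrix_mult_def algebra_simps sum_subtractf)
  then show ?thesis by (simp add: chordal_dist_def frob_norm_eq_norm norm_unitary_conj[OF U])
qed

lemma gen_proj_unitary_conj:
  "U ** gen_proj m v ** cadj U = gen_proj m (\<lambda>i. U *v v i)"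
proof -
  have "(U ** gen_proj m v ** cadj U) $ a $ b = gen_proj m (\<lambda>i. U *v v i) $ a $ b" for a b
  proof -
    have "(U ** gen_proj m v ** cadj U) $ a $ b
       = (\<Sum>d\<in>UNIV. \<Sum>c\<in>UNIV. \<Sum>i<m. (U $ a $ c * v i $ c) * cnj (U $ b $ d * v i $ d))"
      by (simp add: matrix_matrix_mult_def gen_proj_def cadj_def sum_distrib_left sum_distrib_right ac_simps)
    also have "\<dots> = (\<Sum>d\<in>UNIV. \<Sum>i<m. \<Sum>c\<in>UNIV. (U $ a $ c * v i $ c) * cnj (U $ b $ d * v i $ d))"
      by (intro sum.cong refl sum.swap)
    also have "\<dots> = (\<Sum>i<m. \<Sum>d\<in>UNIV. \<Sum>c\<in>UNIV. (U $ a $ c * v i $ c) * cnj (U $ b $ d * v i $ d))"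
      by (rule sum.swap)
    also have "\<dots> = gen_proj m (\<lambda>i. U *v v i) $ a $ b"
      by (simp only: gen_proj_def matrix_vector_mult_def vec_lambda_beta sum_distrib_left[symmetric]
          sum_distrib_right[symmetric] cnj_sum[symmetric])
    finally show ?thesis .
  qed
  then show ?thesis by (simp add: vec_eq_iff)
qed

text \<open>Downward induction from n: fewer than n orthonormal vectors have a span of real
  dimension below 2n, so some vector lies outside it, and its normalized residual is
  appended.\<close>

lemma orthonormal_cols_extend:
  fixes v :: "nat \<Rightarrow> complex^'n"
  assumes "orthonormal_cols m v" "m \<le> CARD('n)"
  shows "\<exists>v'. orthonormal_cols CARD('n) v' \<and> (\<forall>i<m. v' i = v i)"
  using assms(2,1)
proof (induction m arbitrary: v rule: inc_induct)
  case base
  then show ?case by blast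
next
  case (step m)
  have "dim (range (\<lambda>y. gen_proj m v *v y)) < DIM(complex^'n)"
    unfolding dim_range_gen_proj[OF step.prems] using step.hyps by simp
  then have "range (\<lambda>y. gen_proj m v *v y) \<noteq> UNIV" by (metis dim_UNIV less_irrefl)
  then obtain y where "y \<notin> range (\<lambda>y. gen_proj m v *v y)" by blast
  then have y: "y \<noteq> gen_proj m v *v y" by blast
  define w where "w = v(m := unit_vec (y - gen_proj m v *v y))"
  have gp: "gen_proj m w = gen_proj m v" by (rule gen_proj_cong) (simp add: w_def)
  have "orthonormal_cols m w" using step.prems by (simp add: orthonormal_cols_cinner w_def)
  then have "orthonormal_cols (Suc m) w"
    by (rule orthonormal_cols_SucI[where y=y]) (use y in \<open>simp_all add: gp\<close>, simp add: w_def)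
  from step.IH[OF this] obtain v' where "orthonormal_cols CARD('n) v'" "\<forall>i<Suc m. v' i = w i" by blast
  then show ?case by (intro exI[of _ v']) (auto simp: w_def)
qed

lemma gen_proj_full:
  fixes v :: "nat \<Rightarrow> complex^'n"
  assumes v: "orthonormal_cols CARD('n) v"
  shows "gen_proj CARD('n) v = mat 1"
proof -
  note p = orth_proj_gen_proj[OF v]
  have sub: "subspace (range (\<lambda>y. gen_proj CARD('n) v *v y))"
    by (rule linear_subspace_image[OF orth_projD(1)[OF p] subspace_UNIV])
  have "dim (range (\<lambda>y. gen_proj CARD('n) v *v y)) = DIM(complex^'n)"
    unfolding dim_range_gen_proj[OF v] by simp
  then have "range (\<lambda>y. gen_proj CARD('n) v *v y) = UNIV"
    using sub by (metis dim_eq_full span_eq_iff)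
  then have "gen_proj CARD('n) v *v y = y" for y
    using orth_projD(3)[OF p] by (metis UNIV_I imageE)
  then show ?thesis unfolding matrix_eq by simp
qed

text \<open>Complete both frames to orthonormal bases of the whole space and map one basis to the
  other. The adjoint of this map is the map in the opposite direction, and composing the two gives
  the projection of a full basis, which is the identity.\<close>

lemma unitary_transitive:
  fixes v w :: "nat \<Rightarrow> complex^'n"
  assumes v: "orthonormal_cols m v" and w: "orthonormal_cols m w" and m: "m \<le> CARD('n)"
  obtains U where "unitary_mat U" "U ** gen_proj m v ** cadj U = gen_proj m w"
proof -
  obtain v' where v': "orthonormal_cols CARD('n) v'" "\<forall>i<m. v' i = v i"
    using orthonormal_cols_extend[OF v m] by blast
  obtain w' where w': "orthonormal_cols CARD('n) w'" "\<forall>i<m. w' i = w i"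
    using orthonormal_cols_extend[OF w m] by blast
  \<comment> \<open>The sum of w_i times the adjoint of v_i, that is the matrix sending v_i to w_i;
    \<open>cadj\<close> exchanges the roles of v and w.\<close>
  define T where "T v w = (\<chi> a b. \<Sum>i<CARD('n). w i $ a * cnj (v i $ b))" for v w :: "nat \<Rightarrow> complex^'n"
  have cadj_T: "cadj (T v w) = T w v" for v w
    by (simp add: T_def cadj_def vec_eq_iff mult.commute)
  have T_apply: "T v w *v y = (\<Sum>i<CARD('n). cinner (v i) y *s w i)" for v w y
  proof -
    have "(T v w *v y) $ a = (\<Sum>b\<in>UNIV. \<Sum>i<CARD('n). w i $ a * cnj (v i $ b) * y $ b)" for a
      by (simp add: T_def matrix_vector_mult_def sum_distrib_right)
    also have "\<dots> a = (\<Sum>i<CARD('n). \<Sum>b\<in>UNIV. w i $ a * cnj (v i $ b) * y $ b)" for a by (rule sum.swap)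
    finally show ?thesis
      by (simp add: vec_eq_iff cinner_def sum_distrib_right sum_distrib_left ac_simps)
  qed
  have T_basis: "T v w *v v i = w i" if "orthonormal_cols CARD('n) v" "i < CARD('n)" for v w i
  proof -
    have "T v w *v v i = (\<Sum>j<CARD('n). if j = i then w i else 0)"
      unfolding T_apply using that by (intro sum.cong refl) (auto simp: orthonormal_cols_cinner)
    then show ?thesis using that(2) by simp
  qed
  have inv: "T w v ** T v w = mat 1" if v: "orthonormal_cols CARD('n) v" and w: "orthonormal_cols CARD('n) w" for v w
  proof -
    have "(T w v ** T v w) *v y = gen_proj CARD('n) v *v y" for y
    proof -
      have lin: "linear (\<lambda>y. T w v *v y)"
        by (intro linearI matrix_vector_right_distrib matrix_vector_mult_scaleR)
      have "(T w v ** T v w) *v y = T w v *v (T v w *v y)" by (simp only: matrix_vector_mul_assoc)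
      also have "\<dots> = (\<Sum>i<CARD('n). cinner (v i) y *s (T w v *v w i))"
        by (simp add: T_apply[of v w] linear_sum[OF lin] vector_scalar_commute)
      also have "\<dots> = (\<Sum>i<CARD('n). cinner (v i) y *s v i)"
        by (intro sum.cong refl) (simp add: T_basis[OF w])
      finally show ?thesis by (simp only: gen_proj_apply)
    qed
    then show ?thesis unfolding gen_proj_full[OF v] by (simp add: matrix_eq)
  qed
  define U where "U = T v' w'"
  have U: "unitary_mat U"
    unfolding unitary_mat_def U_def cadj_T using inv[OF v'(1) w'(1)] inv[OF w'(1) v'(1)] by blast
  have "U ** gen_proj m v ** cadj U = gen_proj m (\<lambda>i. U *v v i)" by (rule gen_proj_unitary_conj)
  also have "\<dots> = gen_proj m w"
  proof (rule gen_proj_cong)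
    fix i assume i: "i < m"
    then show "U *v v i = w i" using T_basis[OF v'(1), of i w'] v'(2) w'(2) m by (simp add: U_def)
  qed
  finally show thesis using U that by blast
qed

text \<open>The parameter is the squared radius, the variable in which volumes behave like
  x^t.\<close>

abbreviation chordal_ball :: "complex^'n^'n \<Rightarrow> real \<Rightarrow> (complex^'n^'n) set" where
  "chordal_ball P x \<equiv> {Q. (chordal_dist P Q)\<^sup>2 \<le> x}"

lemma chordal_ball_sets [measurable]: "chordal_ball P x \<in> sets borel"
  unfolding chordal_dist_power2_eq by measurable

lemma uniform_grassmannD:
  assumes "uniform_grassmann m \<mu>"
  shows "sets \<mu> = sets borel" "prob_space \<mu>" "space \<mu> = UNIV" "AE Q in \<mu>. Q \<in> grassmann m"
    "\<And>U. unitary_mat U \<Longrightarrow> distr \<mu> \<mu> (\<lambda>P. U ** P ** cadj U) = \<mu>"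
proof -
  show s: "sets \<mu> = sets borel" and p: "prob_space \<mu>"
    "\<And>U. unitary_mat U \<Longrightarrow> distr \<mu> \<mu> (\<lambda>P. U ** P ** cadj U) = \<mu>"
    using assms by (auto simp: uniform_grassmann_def)
  show "space \<mu> = UNIV" using sets_eq_imp_space_eq[OF s] by simp
  interpret prob_space \<mu> by fact
  have e: "emeasure \<mu> (grassmann m) = 1" using assms by (simp add: uniform_grassmann_def)
  \<comment> \<open>A nonmeasurable set would have \<open>emeasure\<close> 0, so the value 1 forces
    measurability.\<close>
  then have "grassmann m \<in> sets \<mu>" by (metis emeasure_notin_sets zero_neq_one)
  then show "AE Q in \<mu>. Q \<in> grassmann m" using e by (simp add: AE_in_set_eq_1 emeasure_eq_measure)
qed

text \<open>Conjugation by a unitary carrying P to P' pulls the ball around P' back to the ball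
  around P, and it preserves the measure.\<close>

lemma chordal_ball_homogeneous:
  fixes \<mu> :: "(complex^'n^'n) measure"
  assumes \<mu>: "uniform_grassmann m \<mu>" and P: "P \<in> grassmann m" "P' \<in> grassmann m" and m: "m \<le> CARD('n)"
  shows "emeasure \<mu> (chordal_ball P x) = emeasure \<mu> (chordal_ball P' x)"
proof -
  note D = uniform_grassmannD[OF \<mu>]
  obtain v where v: "orthonormal_cols m v" "P = gen_proj m v" using P(1) by (rule grassmannE)
  obtain w where w: "orthonormal_cols m w" "P' = gen_proj m w" using P(2) by (rule grassmannE)
  obtain U where U: "unitary_mat U" "U ** P ** cadj U = P'"
    using unitary_transitive[OF v(1) w(1) m] v(2) w(2) by blast
  have "linear (\<lambda>Q :: complex^'n^'n. U ** Q ** cadj U)"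
    by (intro linearI) (simp_all add: vec_eq_iff matrix_matrix_mult_def algebra_simps sum.distrib scaleR_sum_right sum_distrib_left)
  then have meas: "(\<lambda>Q. U ** Q ** cadj U) \<in> borel_measurable borel"
    by (intro borel_measurable_continuous_onI linear_continuous_on linear_conv_bounded_linear[THEN iffD1])
  then have meas: "(\<lambda>Q. U ** Q ** cadj U) \<in> \<mu> \<rightarrow>\<^sub>M \<mu>"
    by (simp add: measurable_cong_sets[OF D(1) D(1)])
  have "emeasure \<mu> (chordal_ball P' x) = emeasure (distr \<mu> \<mu> (\<lambda>Q. U ** Q ** cadj U)) (chordal_ball P' x)"
    by (simp only: D(5)[OF U(1)])
  also have "\<dots> = emeasure \<mu> ((\<lambda>Q. U ** Q ** cadj U) -` (chordal_ball P' x) \<inter> space \<mu>)"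
    using meas by (rule emeasure_distr) (simp add: D(1))
  also have "(\<lambda>Q. U ** Q ** cadj U) -` (chordal_ball P' x) \<inter> space \<mu> = chordal_ball P x"
    by (auto simp: D(3) U(2)[symmetric] chordal_dist_unitary_conj[OF U(1)])
  finally show ?thesis by (rule sym)
qed

lemma borel_measurable_gen_proj_gs [measurable]:
  "{..<m} \<subseteq> I \<Longrightarrow> (\<lambda>g. gen_proj m (gs g)) \<in> borel_measurable (gauss_PiM I :: (nat \<Rightarrow> complex^'n) measure)"
proof -
  assume I: "{..<m} \<subseteq> I"
  define T :: "complex^'n \<Rightarrow> complex^'n^'n" where "T x = (\<chi> a b. x $ a * cnj (x $ b))" for x
  have "continuous_on UNIV T" unfolding T_def[abs_def] by (intro continuous_intros)
  then have T: "T \<in> borel_measurable borel" by (rule borel_measurable_continuous_onI)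
  have "(\<lambda>g. \<Sum>i<m. T (gs g i)) \<in> borel_measurable (gauss_PiM I :: (nat \<Rightarrow> complex^'n) measure)"
    using I by (intro borel_measurable_sum measurable_compose[OF borel_measurable_gs T]) auto
  moreover have "gen_proj m u = (\<Sum>i<m. T (u i))" for u
    by (simp add: gen_proj_def T_def vec_eq_iff)
  ultimately show ?thesis by simp
qed

text \<open>\<open>I\<close> is the probability that an independent Gaussian span and a point Q
  drawn from the invariant measure are within squared distance x. Integrating over Q first gives the
  common volume of all balls by homogeneity; integrating over the Gaussian vectors first gives
  bounds that are the same for almost every Q.\<close>

lemma chordal_ball_bounds:
  fixes \<mu> :: "(complex^'n^'n) measure"
  assumes \<mu>: "uniform_grassmann m \<mu>" and P: "P \<in> grassmann m" and n: "CARD('n) = m + Suc k"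
    and x0: "x0 < 1 / 2" "real CARD('n) * x0 < 1" and x: "0 \<le> x" "x \<le> x0"
  shows "emeasure \<mu> (chordal_ball P x)
      \<le> ennreal ((1 / (1 - 2 * x0)) ^ (Suc k * m) * gs_coeff (Suc k) m m * x ^ (Suc k * m))" (is "_ \<le> ?U")
    and "ennreal ((1 - real CARD('n) * x0) ^ m * gs_coeff (Suc k) m m * x ^ (Suc k * m))
      \<le> emeasure \<mu> (chordal_ball P x)" (is "?L \<le> _")
proof -
  note D = uniform_grassmannD[OF \<mu>]
  let ?N = "gauss_PiM {..<m} :: (nat \<Rightarrow> complex^'n) measure"
  interpret mu: prob_space \<mu> by (rule D(2))
  interpret N: prob_space ?N by (rule prob_space_PiM_gauss)
  interpret pair_sigma_finite ?N \<mu> by standard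
  define G where "G g = gen_proj m (gs g)" for g :: "nat \<Rightarrow> complex^'n"
  have [measurable]: "G \<in> borel_measurable ?N" unfolding G_def[abs_def] by (rule borel_measurable_gen_proj_gs) simp
  note [measurable_cong] = D(1)
  have good: "AE g in ?N. orthonormal_cols m (gs g)"
  proof -
    have "AE g in ?N. \<forall>i<m. gs_residual g i \<noteq> 0" using n by (intro AE_gs_residual) simp
    then show ?thesis by eventually_elim (auto intro: orthonormal_cols_gs)
  qed
  define f where "f g Q = (if (chordal_dist (G g) Q)\<^sup>2 \<le> x then 1 else 0 :: ennreal)" for g Q
  have [measurable]: "case_prod f \<in> borel_measurable (?N \<Otimes>\<^sub>M \<mu>)"
    unfolding f_def[abs_def] chordal_dist_power2_eq by measurable
  define I where "I = (\<integral>\<^sup>+g. \<integral>\<^sup>+Q. f g Q \<partial>\<mu> \<partial>?N)"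
  have "I = (\<integral>\<^sup>+g. emeasure \<mu> (chordal_ball P x) \<partial>?N)"
    unfolding I_def
  proof (rule nn_integral_cong_AE)
    show "AE g in ?N. (\<integral>\<^sup>+Q. f g Q \<partial>\<mu>) = emeasure \<mu> (chordal_ball P x)"
      using good
    proof eventually_elim
      case (elim g)
      then have "G g \<in> grassmann m" by (auto simp: G_def grassmann_def)
      then have "emeasure \<mu> (chordal_ball P x) = emeasure \<mu> (chordal_ball (G g) x)"
        using n by (intro chordal_ball_homogeneous[OF \<mu> P]) simp_all
      also have "\<dots> = (\<integral>\<^sup>+Q. indicator (chordal_ball (G g) x) Q \<partial>\<mu>)"
        by (rule nn_integral_indicator[symmetric]) (simp add: D(1))
      also have "\<dots> = (\<integral>\<^sup>+Q. f g Q \<partial>\<mu>)"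
        by (intro nn_integral_cong) (simp add: f_def indicator_def)
      finally show ?case by (rule sym)
    qed
  qed
  then have I1: "I = emeasure \<mu> (chordal_ball P x)"
    using N.emeasure_space_1 by simp
  have I2: "I = (\<integral>\<^sup>+Q. (\<integral>\<^sup>+g. f g Q \<partial>?N) \<partial>\<mu>)"
    unfolding I_def by (rule Fubini'[symmetric]) measurable
  have inner: "AE Q in \<mu>. ?L \<le> (\<integral>\<^sup>+g. f g Q \<partial>?N) \<and> (\<integral>\<^sup>+g. f g Q \<partial>?N) \<le> ?U"
    using D(4)
  proof eventually_elim
    case (elim Q)
    then obtain v where v: "orthonormal_cols m v" "Q = gen_proj m v" by (rule grassmannE)
    have [measurable]: "gs_defect Q m \<in> borel_measurable ?N" by (rule borel_measurable_gs_defect) simp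
    have "(\<integral>\<^sup>+g. f g Q \<partial>?N) = (\<integral>\<^sup>+g. indicator {g \<in> space ?N. gs_defect Q m g \<le> x} g \<partial>?N)"
    proof (rule nn_integral_cong_AE)
      show "AE g in ?N. f g Q = indicator {g \<in> space ?N. gs_defect Q m g \<le> x} g"
        using good AE_space
      proof eventually_elim
        case (elim g)
        have "(chordal_dist (G g) Q)\<^sup>2 = (chordal_dist Q (G g))\<^sup>2"
          by (subst chordal_dist_commute) (rule refl)
        also have "\<dots> = gs_defect Q m g"
          unfolding G_def v(2) gs_defect_def by (rule chordal_dist_gen_proj[OF v(1) elim(1)])
        finally show ?case using elim(2) by (simp add: f_def indicator_def)
      qed
    qed
    also have "\<dots> = emeasure ?N {g \<in> space ?N. gs_defect Q m g \<le> x}"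
      by (rule nn_integral_indicator) measurable
    finally have e: "(\<integral>\<^sup>+g. f g Q \<partial>?N) = emeasure ?N {g \<in> space ?N. gs_defect (gen_proj m v) m g \<le> x}"
      by (simp only: v(2))
    show ?case unfolding e
      using gs_defect_small_ball[OF v(1) n x0 order_refl x] by blast
  qed
  have "I \<le> (\<integral>\<^sup>+Q. ?U \<partial>\<mu>)" unfolding I2 using inner by (intro nn_integral_mono_AE) auto
  then show "emeasure \<mu> (chordal_ball P x) \<le> ?U" using mu.emeasure_space_1 by (simp add: I1)
  have "(\<integral>\<^sup>+Q. ?L \<partial>\<mu>) \<le> I" unfolding I2 using inner by (intro nn_integral_mono_AE) auto
  then show "?L \<le> emeasure \<mu> (chordal_ball P x)" using mu.emeasure_space_1 by (simp add: I1)
qed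

text \<open>Both sides are the product of i + j + 1 over i < m and j < c.\<close>

lemma prod_fact_ratio_symmetric:
  "(\<Prod>i<m. fact (c + i) / fact i :: real) = (\<Prod>i<c. fact (m + i) / fact i)"
proof (induction m)
  case 0
  then show ?case by simp
next
  case (Suc m)
  have ratio: "(\<Prod>i<c. fact (Suc m + i) / fact i :: real) = (\<Prod>i<c. fact (m + i) / fact i) * (fact (c + m) / fact m)" for c
  proof (induction c)
    case 0
    then show ?case by simp
  next
    case (Suc c)
    have "fact (Suc m + c) = (fact (Suc c + m) :: real)" by (rule arg_cong[where f=fact]) simp
    moreover have "fact (m + c) = (fact (c + m) :: real)" by (rule arg_cong[where f=fact]) simp
    ultimately show ?case using Suc by (simp del: fact_Suc)
  qed
  show ?case unfolding prod.lessThan_Suc Suc.IH ratio ..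
qed

text \<open>The two cases in the definition of \<open>eta_const\<close> have the same value.\<close>

lemma eta_const_eq_gs_coeff: "eta_const (m + c) m = gs_coeff c m m"
proof -
  have rev: "(\<Prod>i<m. fact (c + m - Suc i) / fact (m - Suc i) :: real) = (\<Prod>i<m. fact (c + i) / fact i)" for c m
  proof -
    have "(\<Prod>i<m. fact (c + i) / fact i :: real) = (\<Prod>i<m. fact (c + (m - Suc i)) / fact (m - Suc i))"
      by (rule prod.nat_diff_reindex[symmetric])
    also have "\<dots> = (\<Prod>i<m. fact (c + m - Suc i) / fact (m - Suc i))"
      by (intro prod.cong refl) auto
    finally show ?thesis by (rule sym)
  qed
  have "(\<Prod>i=1..m. fact (m + c - i) / fact (m - i) :: real) = (\<Prod>i<m. fact (c + m - Suc i) / fact (m - Suc i))"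
    by (simp add: prod.atLeast1_atMost_eq add.commute)
  also have "\<dots> = (\<Prod>i<m. fact (c + i) / fact i)" by (rule rev)
  finally have 1: "(\<Prod>i=1..m. fact (m + c - i) / fact (m - i) :: real) = (\<Prod>i<m. fact (c + i) / fact i)" .
  have "(\<Prod>i=1..c. fact (m + c - i) / fact (c - i) :: real) = (\<Prod>i<c. fact (m + c - Suc i) / fact (c - Suc i))"
    by (simp add: prod.atLeast1_atMost_eq)
  also have "\<dots> = (\<Prod>i<c. fact (m + i) / fact i)" by (rule rev)
  also have "\<dots> = (\<Prod>i<m. fact (c + i) / fact i)" by (rule prod_fact_ratio_symmetric[symmetric])
  finally have 2: "(\<Prod>i=1..c. fact (m + c - i) / fact (c - i) :: real) = (\<Prod>i<m. fact (c + i) / fact i)" .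
  show ?thesis
    unfolding eta_const_def Let_def gs_coeff_def rev add_diff_cancel_left' 1 2 by (simp add: mult.commute)
qed

section \<open>Balls in the composite manifold\<close>

lemma borel_measurable_comp_chordal_dist [measurable]:
  assumes s: "sets \<mu> = sets borel" and k: "{..<k} \<subseteq> I"
  shows "(\<lambda>Q. \<Sum>i<k. (chordal_dist (P i) (Q i))\<^sup>2) \<in> borel_measurable (PiM I (\<lambda>_. \<mu>))"
proof (rule borel_measurable_sum)
  fix i assume "i \<in> {..<k}"
  then have "(\<lambda>Q. Q i) \<in> PiM I (\<lambda>_. \<mu>) \<rightarrow>\<^sub>M \<mu>"
    using k by (intro measurable_component_singleton) auto
  then have "(\<lambda>Q. Q i) \<in> borel_measurable (PiM I (\<lambda>_. \<mu>))"
    by (simp add: measurable_cong_sets[OF refl s])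
  then show "(\<lambda>Q. (chordal_dist (P i) (Q i))\<^sup>2) \<in> borel_measurable (PiM I (\<lambda>_. \<mu>))"
    unfolding chordal_dist_power2_eq by measurable
qed

text \<open>Induction over the factors, conditioning on the first j of them: given their
  contribution \<open>X Q\<close>, the last component must lie in a ball of squared radius x - X Q
  <= x0. Each convolution contributes t! (tj)! / (tj + t)!, and the product telescopes to t!^j /
  (tj)!, so no error arises beyond the one already in a and b.\<close>

lemma comp_chordal_ball_bounds:
  fixes \<mu> :: "(complex^'n^'n) measure"
  assumes \<mu>: "sets \<mu> = sets borel" "prob_space \<mu>" and t: "t = Suc r" and ab: "0 \<le> a" "0 \<le> b"
    and ball: "\<And>x i. 0 \<le> x \<Longrightarrow> x \<le> x0 \<Longrightarrow> i < k \<Longrightarrow> emeasure \<mu> (chordal_ball (P i) x) \<le> ennreal (a * x ^ t)"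
      "\<And>x i. 0 \<le> x \<Longrightarrow> x \<le> x0 \<Longrightarrow> i < k \<Longrightarrow> ennreal (b * x ^ t) \<le> emeasure \<mu> (chordal_ball (P i) x)"
    and x: "0 \<le> x" "x \<le> x0" and j: "j \<le> k"
  shows "emeasure (PiM {..<j} (\<lambda>_. \<mu>)) {Q \<in> space (PiM {..<j} (\<lambda>_. \<mu>)). (\<Sum>i<j. (chordal_dist (P i) (Q i))\<^sup>2) \<le> x}
      \<le> ennreal (a ^ j * (fact t ^ j / fact (t * j)) * x ^ (t * j))" (is "?E j x \<le> ?U j x")
    and "ennreal (b ^ j * (fact t ^ j / fact (t * j)) * x ^ (t * j))
      \<le> emeasure (PiM {..<j} (\<lambda>_. \<mu>)) {Q \<in> space (PiM {..<j} (\<lambda>_. \<mu>)). (\<Sum>i<j. (chordal_dist (P i) (Q i))\<^sup>2) \<le> x}" (is "?L j x \<le> _")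
proof -
  have sp: "space \<mu> = UNIV" using sets_eq_imp_space_eq[OF \<mu>(1)] by simp
  have "?E j x \<le> ?U j x \<and> ?L j x \<le> ?E j x" using j x
  proof (induction j arbitrary: x)
    case 0
    interpret prob_space "PiM {..<0::nat} (\<lambda>_. \<mu>)" by (intro prob_space_PiM \<mu>(2))
    have "?E 0 x = 1" using emeasure_space_1 0 by simp
    then show ?case by simp
  next
    case (Suc j)
    let ?M = "PiM {..<j} (\<lambda>_. \<mu>)"
    interpret prob_space ?M by (intro prob_space_PiM \<mu>(2))
    define X where "X Q = (\<Sum>i<j. (chordal_dist (P i) (Q i))\<^sup>2)" for Q
    have X: "X \<in> borel_measurable ?M" unfolding X_def[abs_def] by (rule borel_measurable_comp_chordal_dist[OF \<mu>(1)]) simp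
    have X0: "0 \<le> X Q" for Q unfolding X_def by (intro sum_nonneg) simp
    define A where "A = {Q \<in> space (PiM {..<Suc j} (\<lambda>_. \<mu>)). (\<Sum>i<Suc j. (chordal_dist (P i) (Q i))\<^sup>2) \<le> x}"
    have A: "A \<in> sets (PiM {..<Suc j} (\<lambda>_. \<mu>))"
    proof -
      have [measurable]: "(\<lambda>Q. \<Sum>i<Suc j. (chordal_dist (P i) (Q i))\<^sup>2) \<in> borel_measurable (PiM {..<Suc j} (\<lambda>_. \<mu>))"
        by (rule borel_measurable_comp_chordal_dist[OF \<mu>(1)]) simp
      show ?thesis unfolding A_def by measurable
    qed
    define h where "h Q = emeasure \<mu> {y\<in>space \<mu>. Q(j := y) \<in> A}" for Q
    have E: "?E (Suc j) x = (\<integral>\<^sup>+Q. h Q \<partial>?M)"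
      unfolding A_def[symmetric] h_def by (rule emeasure_PiM_lessThan_Suc[OF \<mu>(2) A])
    have h: "h Q = emeasure \<mu> {y. (chordal_dist (P j) y)\<^sup>2 \<le> x - X Q}" if Q: "Q \<in> space ?M" for Q
    proof -
      have "Q(j := y) \<in> space (PiM {..<Suc j} (\<lambda>_. \<mu>))" for y
        using Q by (auto simp: space_PiM PiE_def extensional_def sp)
      moreover have "(\<Sum>i<Suc j. (chordal_dist (P i) ((Q(j := y)) i))\<^sup>2) = X Q + (chordal_dist (P j) y)\<^sup>2" for y
        by (simp add: X_def)
      ultimately show ?thesis unfolding h_def A_def by (simp add: sp algebra_simps)
    qed
    have h0: "h Q = 0" if "Q \<in> space ?M" "\<not> X Q \<le> x" for Q
    proof -
      have "{y. (chordal_dist (P j) y)\<^sup>2 \<le> x - X Q} = {}"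
      proof (intro equals0I)
        fix y assume "y \<in> {y. (chordal_dist (P j) y)\<^sup>2 \<le> x - X Q}"
        then show False using that(2) zero_le_power2[of "chordal_dist (P j) y"] by (simp add: not_le del: zero_le_power2)
      qed
      then show ?thesis using h[OF that(1)] by simp
    qed
    have e: "t * Suc j = t * j + Suc r" by (simp add: t)
    have coeff: "(c ^ j * (fact t ^ j / fact (t * j))) * c * (fact (Suc r) * fact (t * j) / fact (t * j + Suc r))
       = c ^ Suc j * (fact t ^ Suc j / fact (t * Suc j))" for c :: real
      unfolding e t[symmetric] by (simp del: fact_Suc)
    have "?E (Suc j) x \<le> ennreal ((a ^ j * (fact t ^ j / fact (t * j))) * a * (fact (Suc r) * fact (t * j) / fact (t * j + Suc r)) * x ^ (t * j + Suc r))"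
      unfolding E
    proof (rule small_ball_convolution_upper[where X=X])
      show "sigma_finite_measure ?M" ..
      show "AE Q in ?M. h Q \<le> ennreal (a * (x - X Q) ^ Suc r) * indicator {..x} (X Q)"
      proof (rule AE_I2)
        fix Q assume Q: "Q \<in> space ?M"
        show "h Q \<le> ennreal (a * (x - X Q) ^ Suc r) * indicator {..x} (X Q)"
        proof (cases "X Q \<le> x")
          case True
          then show ?thesis unfolding h[OF Q] using ball(1)[of "x - X Q" j] X0[of Q] Suc.prems by (simp add: t)
        qed (simp add: h0[OF Q])
      qed
      show "emeasure ?M (sublevel ?M X y) \<le> ennreal (a ^ j * (fact t ^ j / fact (t * j)) * y ^ (t * j))"
        if "0 \<le> y" "y \<le> x" for y
        using Suc.IH[of y] Suc.prems that unfolding X_def by simp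
    qed (use X X0 ab Suc.prems in auto)
    then have up: "?E (Suc j) x \<le> ?U (Suc j) x" unfolding coeff unfolding e[symmetric] .
    have "ennreal ((b ^ j * (fact t ^ j / fact (t * j))) * b * (fact (Suc r) * fact (t * j) / fact (t * j + Suc r)) * x ^ (t * j + Suc r)) \<le> ?E (Suc j) x"
      unfolding E
    proof (rule small_ball_convolution_lower[where X=X])
      show "sigma_finite_measure ?M" ..
      show "AE Q in ?M. ennreal (b * (x - X Q) ^ Suc r) * indicator {..x} (X Q) \<le> h Q"
      proof (rule AE_I2)
        fix Q assume Q: "Q \<in> space ?M"
        show "ennreal (b * (x - X Q) ^ Suc r) * indicator {..x} (X Q) \<le> h Q"
        proof (cases "X Q \<le> x")
          case True
          then show ?thesis unfolding h[OF Q] using ball(2)[of "x - X Q" j] X0[of Q] Suc.prems by (simp add: t)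
        qed simp
      qed
      show "ennreal (b ^ j * (fact t ^ j / fact (t * j)) * y ^ (t * j)) \<le> emeasure ?M (sublevel ?M X y)"
        if "0 \<le> y" "y \<le> x" for y
        using Suc.IH[of y] Suc.prems that unfolding X_def by simp
    qed (use X X0 ab Suc.prems in auto)
    then have "?L (Suc j) x \<le> ?E (Suc j) x" unfolding coeff unfolding e[symmetric] .
    with up show ?case by simp
  qed
  then show "?E j x \<le> ?U j x" and "?L j x \<le> ?E j x" by auto
qed

section \<open>Covering and random coding\<close>

text \<open>The change of variables u = a y^p is carried out by Fubini: exp (- s) is the integral of
  exp (- u) over u >= s, and for fixed u >= 0 the admissible y form the interval from 0 to (u /
  a)^(1/p). What remains is Gamma (1 + 1/p).\<close>

lemma nn_integral_exp_power:
  fixes a :: real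
  assumes a: "0 < a" and p: "0 < p"
  shows "(\<integral>\<^sup>+y. ennreal (exp (- (a * y ^ p))) * indicator {0..} y \<partial>lborel)
    = ennreal (Gamma (1 / real p) / real p * a powr (- 1 / real p))"
proof -
  let ?f = "\<lambda>u y. (ennreal (exp (- u)) * indicator {a * y ^ p..} u) * indicator {0..} y"
    and ?g = "\<lambda>u. ennreal (indicator {0..} u * (u powr (1 + 1 / real p - 1) / exp u))"
  have tail: "ennreal (exp (- s)) = (\<integral>\<^sup>+u. ennreal (exp (- u)) * indicator {s..} u \<partial>lborel)" for s :: real
  proof -
    have "(\<integral>\<^sup>+u. ennreal (exp (- u)) * indicator {s..} u \<partial>lborel) = ennreal (0 - (- exp (- s)))"
    proof (rule nn_integral_FTC_atLeast[where F="\<lambda>u. - exp (- u)"])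
      show "((\<lambda>u. - exp (- u)) has_real_derivative exp (- x)) (at x)" for x :: real
        by (auto intro!: derivative_eq_intros)
      have "((\<lambda>u::real. - exp (- u)) \<longlongrightarrow> - 0) at_top"
        by (intro tendsto_minus filterlim_compose[OF exp_at_bot filterlim_uminus_at_bot_at_top])
      then show "((\<lambda>u::real. - exp (- u)) \<longlongrightarrow> 0) at_top" by simp
    qed auto
    then show ?thesis by simp
  qed
  have "(\<integral>\<^sup>+y. ennreal (exp (- (a * y ^ p))) * indicator {0..} y \<partial>lborel)
    = (\<integral>\<^sup>+y. \<integral>\<^sup>+u. ?f u y \<partial>lborel \<partial>lborel)"
  proof (rule nn_integral_cong)
    fix y :: real
    have "(\<integral>\<^sup>+u. ?f u y \<partial>lborel)
      = (\<integral>\<^sup>+u. ennreal (exp (- u)) * indicator {a * y ^ p..} u \<partial>lborel) * indicator {0..} y"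
      by (rule nn_integral_multc) measurable
    also have "\<dots> = ennreal (exp (- (a * y ^ p))) * indicator {0..} y"
      by (rule arg_cong2[where f="(*)", OF tail[symmetric] refl])
    finally show "ennreal (exp (- (a * y ^ p))) * indicator {0..} y
      = (\<integral>\<^sup>+u. ?f u y \<partial>lborel)"
      by (rule sym)
  qed
  also have "\<dots> = (\<integral>\<^sup>+u. \<integral>\<^sup>+y. ?f u y \<partial>lborel \<partial>lborel)"
  proof (rule lborel_pair.Fubini')
    have "(\<lambda>(u, y). ennreal (exp (- u)) * indicator {a * y ^ p..} u * indicator {0..} y)
       = (\<lambda>z. ennreal (exp (- fst z)) * (if a * snd z ^ p \<le> fst z then 1 else 0) * indicator {0..} (snd z))"
      by (auto simp: indicator_def fun_eq_iff)
    also have "\<dots> \<in> borel_measurable (lborel \<Otimes>\<^sub>M lborel)" by measurable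
    finally show "(\<lambda>(u, y). ennreal (exp (- u)) * indicator {a * y ^ p..} u * indicator {0..} y)
      \<in> borel_measurable (lborel \<Otimes>\<^sub>M lborel)" .
  qed
  also have "\<dots> = (\<integral>\<^sup>+u. ennreal (a powr (- 1 / real p)) * ?g u \<partial>lborel)"
  proof (rule nn_integral_cong)
    fix u :: real
    have root: "a * y ^ p \<le> u \<longleftrightarrow> y \<le> (u / a) powr (1 / real p)" if "0 \<le> u" "0 \<le> y" for y
    proof -
      have r: "((u / a) powr (1 / real p)) ^ p = u / a"
        using a p that(1) by (cases "u = 0") (simp_all add: powr_realpow[symmetric] powr_powr power_0_left)
      have "a * y ^ p \<le> u \<longleftrightarrow> y ^ p \<le> ((u / a) powr (1 / real p)) ^ p"
        unfolding r using a by (simp add: pos_le_divide_eq mult.commute)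
      also have "\<dots> \<longleftrightarrow> y \<le> (u / a) powr (1 / real p)"
        using p that(2) by (simp add: power_mono_iff)
      finally show ?thesis .
    qed
    have "(\<integral>\<^sup>+y. ?f u y \<partial>lborel)
      = (\<integral>\<^sup>+y. (ennreal (exp (- u)) * indicator {0..} u) * indicator {0..(u / a) powr (1 / real p)} y \<partial>lborel)"
    proof (rule nn_integral_cong)
      fix y :: real
      show "?f u y
         = (ennreal (exp (- u)) * indicator {0..} u) * indicator {0..(u / a) powr (1 / real p)} y"
      proof (cases "0 \<le> y")
        case y: True
        show ?thesis
        proof (cases "0 \<le> u")
          case True then show ?thesis using root[OF True y] y by (simp add: indicator_def)
        next
          case False
          have "0 \<le> a * y ^ p" using a y by simp
          then show ?thesis using False by (simp add: indicator_def)
        qed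
      qed simp
    qed
    also have "\<dots> = (ennreal (exp (- u)) * indicator {0..} u) * ennreal ((u / a) powr (1 / real p))"
      by (subst nn_integral_cmult_indicator) auto
    also have "\<dots> = ennreal (a powr (- 1 / real p)) * ?g u"
    proof (cases "0 \<le> u")
      case True
      have "(u / a) powr (1 / real p) = a powr (- 1 / real p) * u powr (1 / real p)"
        using True a by (simp add: powr_divide powr_minus_divide)
      then show ?thesis using True
        by (simp add: ennreal_mult'[symmetric] exp_minus field_simps)
    qed simp
    finally show "(\<integral>\<^sup>+y. ?f u y \<partial>lborel)
      = ennreal (a powr (- 1 / real p)) * ?g u" .
  qed
  also have "\<dots> = ennreal (a powr (- 1 / real p)) * (\<integral>\<^sup>+u. ?g u \<partial>lborel)"
    by (rule nn_integral_cmult) measurable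
  also have "(\<integral>\<^sup>+u. ?g u \<partial>lborel) = ennreal (Gamma (1 + 1 / real p))"
  proof (rule nn_integral_has_integral_lebesgue)
    show "((\<lambda>u. u powr (1 + 1 / real p - 1) / exp u) has_integral Gamma (1 + 1 / real p)) {0..}"
      by (rule Gamma_integral_real) (simp add: add_pos_nonneg)
  qed simp
  also have "ennreal (a powr (- 1 / real p)) * ennreal (Gamma (1 + 1 / real p)) = ennreal (a powr (- 1 / real p) * Gamma (1 + 1 / real p))"
    by (rule ennreal_mult'[symmetric]) simp
  also have "Gamma (1 + 1 / real p) = 1 / real p * Gamma (1 / real p)"
    using Gamma_plus1[of "1 / real p"] p nonpos_Ints_nonpos[of "1 / real p"]
    by (auto simp: add.commute)
  finally show ?thesis by (simp add: ac_simps)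
qed

text \<open>Pointwise x <= Y + (sum over P of the positive part of x - f P): if Y < x, the term of a
  nearest codeword already fills the gap. Integrating this union-type bound needs only the volume of
  single balls and leaves x free to be optimized.\<close>

lemma Min_code_lower_bound:
  fixes f :: "'p \<Rightarrow> 'b \<Rightarrow> real"
  assumes M: "prob_space M" and C: "finite C" "C \<noteq> {}"
    and f: "\<And>P. P \<in> C \<Longrightarrow> f P \<in> borel_measurable M" "\<And>P Q. P \<in> C \<Longrightarrow> 0 \<le> f P Q"
    and bdd: "\<And>P. P \<in> C \<Longrightarrow> AE Q in M. f P Q \<le> B"
    and ball: "\<And>P y. P \<in> C \<Longrightarrow> 0 \<le> y \<Longrightarrow> y \<le> x \<Longrightarrow> emeasure M (sublevel M (f P) y) \<le> ennreal (a * y ^ p)"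
    and x: "0 \<le> x" and a: "0 \<le> a"
  shows "x - real (card C) * (a * x ^ Suc p / real (Suc p)) \<le> (\<integral>Q. Min ((\<lambda>P. f P Q) ` C) \<partial>M)"
proof -
  interpret prob_space M by fact
  note f(1)[measurable]
  define Y where "Y Q = Min ((\<lambda>P. f P Q) ` C)" for Q
  have [measurable]: "Y \<in> borel_measurable M" unfolding Y_def[abs_def] using C f(1) by (intro borel_measurable_Min) auto
  have Y_in: "\<exists>P\<in>C. Y Q = f P Q" for Q
  proof -
    have "Y Q \<in> (\<lambda>P. f P Q) ` C" unfolding Y_def using C by (intro Min_in) auto
    then show ?thesis by blast
  qed
  have Y0: "0 \<le> Y Q" for Q using Y_in[of Q] f(2) by auto
  obtain P0 where P0: "P0 \<in> C" using C by auto
  have YB: "AE Q in M. norm (Y Q) \<le> B"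
    using bdd[OF P0]
  proof eventually_elim
    case (elim Q)
    have "Y Q \<le> f P0 Q" unfolding Y_def using C P0 by (intro Min_le) auto
    then show ?case using elim Y0[of Q] by simp
  qed
  have int: "integrable M Y" by (rule integrable_const_bound[OF YB]) measurable
  have Yint: "(\<integral>\<^sup>+Q. ennreal (Y Q) \<partial>M) = ennreal (\<integral>Q. Y Q \<partial>M)"
    using int Y0 by (intro nn_integral_eq_integral) auto
  define g where "g P Q = ennreal (1 * (x - f P Q) ^ Suc 0) * indicator {..x} (f P Q)" for P Q
  have [measurable]: "g P \<in> borel_measurable M" if "P \<in> C" for P
  proof -
    note f(1)[OF that, measurable]
    show ?thesis unfolding g_def[abs_def] by measurable
  qed
  \<comment> \<open>The convolution bound with exponent 1 and coefficient 1 for the second term; its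
    Beta factor is 1 / (p + 1).\<close>
  have gP: "(\<integral>\<^sup>+Q. g P Q \<partial>M) \<le> ennreal (a * x ^ Suc p / real (Suc p))" if P: "P \<in> C" for P
  proof -
    have "(\<integral>\<^sup>+Q. g P Q \<partial>M) \<le> ennreal (a * 1 * (fact (Suc 0) * fact p / fact (p + Suc 0)) * x ^ (p + Suc 0))"
      by (rule small_ball_convolution_upper[where X="f P" and x=x])
        (use f P x a ball sigma_finite_measure_axioms in \<open>auto simp: g_def\<close>)
    also have "a * 1 * (fact (Suc 0) * fact p / fact (p + Suc 0)) * x ^ (p + Suc 0) = a * x ^ Suc p / real (Suc p)"
      by (simp del: of_nat_Suc power_Suc)
    finally show ?thesis .
  qed
  have "ennreal x = (\<integral>\<^sup>+Q. ennreal x \<partial>M)" using emeasure_space_1 by simp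
  also have "\<dots> \<le> (\<integral>\<^sup>+Q. ennreal (Y Q) + (\<Sum>P\<in>C. g P Q) \<partial>M)"
  proof (rule nn_integral_mono)
    fix Q
    obtain P where P: "P \<in> C" "Y Q = f P Q" using Y_in by blast
    show "ennreal x \<le> ennreal (Y Q) + (\<Sum>P\<in>C. g P Q)"
    proof (cases "x \<le> Y Q")
      case True
      then have "ennreal x \<le> ennreal (Y Q)" by (rule ennreal_leI)
      then show ?thesis by (rule order_trans) simp
    next
      case False
      then have "ennreal x = ennreal (Y Q) + g P Q"
        using P f(2) Y0[of Q] by (simp add: g_def ennreal_plus[symmetric] del: ennreal_plus)
      also have "\<dots> \<le> ennreal (Y Q) + (\<Sum>P\<in>C. g P Q)"
        using C P by (intro add_left_mono member_le_sum) auto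
      finally show ?thesis .
    qed
  qed
  also have "\<dots> = (\<integral>\<^sup>+Q. ennreal (Y Q) \<partial>M) + (\<Sum>P\<in>C. \<integral>\<^sup>+Q. g P Q \<partial>M)"
    by (subst nn_integral_add) (auto intro!: nn_integral_sum)
  also have "\<dots> \<le> ennreal (\<integral>Q. Y Q \<partial>M) + (\<Sum>P\<in>C. ennreal (a * x ^ Suc p / real (Suc p)))"
    unfolding Yint using gP by (intro add_left_mono sum_mono) auto
  also have "(\<Sum>P\<in>C. ennreal (a * x ^ Suc p / real (Suc p))) = ennreal (real (card C) * (a * x ^ Suc p / real (Suc p)))"
    unfolding sum_constant ennreal_of_nat_eq_real_of_nat
    by (rule ennreal_mult[symmetric]) (use a x in auto)
  also have "ennreal (\<integral>Q. Y Q \<partial>M) + \<dots> = ennreal ((\<integral>Q. Y Q \<partial>M) + real (card C) * (a * x ^ Suc p / real (Suc p)))"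
    using a x Y0 by (intro ennreal_plus[symmetric] integral_nonneg_AE mult_nonneg_nonneg) auto
  finally have "x \<le> (\<integral>Q. Y Q \<partial>M) + real (card C) * (a * x ^ Suc p / real (Suc p))"
    using a x Y0 by (subst (asm) ennreal_le_iff) (auto intro!: add_nonneg_nonneg integral_nonneg_AE mult_nonneg_nonneg)
  then show ?thesis unfolding Y_def by simp
qed

text \<open>For fixed Q and K independent codewords, the minimum exceeds y with probability P(d >
  y)^K. This is at most (1 - b y^p)^K <= exp (- K b y^p) for y <= x0, at most q^K between x0 and B,
  and 0 beyond B; integrating over y gives the Gamma term and an exponentially small
  remainder.\<close>

lemma random_code_bound:
  fixes M :: "'b measure" and d :: "'b \<Rightarrow> 'b \<Rightarrow> real"
  assumes M: "prob_space M" and K: "0 < K" and p: "0 < p" and b: "0 < b" and x0: "0 < x0" and B: "0 \<le> B"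
    and d: "(\<lambda>P. d P Q) \<in> borel_measurable M" "\<And>P. 0 \<le> d P Q" "AE P in M. d P Q \<le> B"
    and ball: "\<And>y. 0 \<le> y \<Longrightarrow> y \<le> x0 \<Longrightarrow> ennreal (b * y ^ p) \<le> emeasure M {P\<in>space M. d P Q \<le> y}"
  shows "(\<integral>\<^sup>+h. ennreal (Min ((\<lambda>i. d (h i) Q) ` {..<K})) \<partial>PiM {..<K} (\<lambda>_. M))
    \<le> ennreal (Gamma (1 / real p) / real p * (real K * b) powr (- 1 / real p) + B * (1 - b * x0 ^ p) ^ K)"
proof -
  interpret M: prob_space M by fact
  let ?N = "PiM {..<K} (\<lambda>_. M)"
  interpret N: prob_space ?N by (intro prob_space_PiM M)
  interpret pm: product_sigma_finite "\<lambda>_::nat. M" by standard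
  interpret pair_sigma_finite ?N lborel by standard
  note d(1)[measurable]
  define Z where "Z h = Min ((\<lambda>i. d (h i) Q) ` {..<K})" for h
  have [measurable]: "(\<lambda>h. d (h i) Q) \<in> borel_measurable ?N" if "i \<in> {..<K}" for i
    by (rule measurable_compose[OF measurable_component_singleton[OF that] d(1)])
  have [measurable]: "Z \<in> borel_measurable ?N" unfolding Z_def[abs_def] by (intro borel_measurable_Min) auto
  have Z_gr: "y < Z h \<longleftrightarrow> (\<forall>i<K. y < d (h i) Q)" for y h
    unfolding Z_def using K by (subst Min_gr_iff) auto
  have Z0: "0 \<le> Z h" for h
    unfolding Z_def using K d(2) by (subst Min_ge_iff) auto
  define q where "q = 1 - b * x0 ^ p"
  let ?E = "\<lambda>y. emeasure M {P\<in>space M. y < d P Q}" and ?T = "\<lambda>y. emeasure ?N {h\<in>space ?N. y < Z h}"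
  have large: "?E y \<le> ennreal (1 - b * y ^ p)" if y: "0 \<le> y" "y \<le> x0" for y
  proof -
    have "b * y ^ p \<le> M.prob {P\<in>space M. d P Q \<le> y}"
      using ball[OF y] b y by (simp add: M.emeasure_eq_measure)
    moreover have "M.prob {P\<in>space M. y < d P Q} = 1 - M.prob {P\<in>space M. d P Q \<le> y}"
    proof -
      have "{P\<in>space M. y < d P Q} = space M - {P\<in>space M. d P Q \<le> y}" by auto
      then show ?thesis by (simp add: M.prob_compl)
    qed
    ultimately show ?thesis by (simp add: M.emeasure_eq_measure ennreal_leI)
  qed
  have q0: "0 \<le> q"
  proof -
    have "ennreal (b * x0 ^ p) \<le> 1" using ball[of x0] x0 M.emeasure_le_1 by (meson less_imp_le order_refl order_trans)
    then show ?thesis using b x0 by (simp add: q_def)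
  qed
  have NZ: "?T y = (?E y) ^ K" for y
  proof -
    have "{h\<in>space ?N. y < Z h} = PiE {..<K} (\<lambda>_. {P\<in>space M. y < d P Q})"
      unfolding space_PiM PiE_iff Z_gr set_eq_iff mem_Collect_eq Ball_def lessThan_iff by blast
    also have "emeasure ?N \<dots> = (\<Prod>i<K. ?E y)"
      by (rule pm.emeasure_PiM) auto
    finally show ?thesis by simp
  qed
  have tail: "?T y = 0" if "B \<le> y" for y
  proof -
    have "AE P in M. \<not> y < d P Q" using d(3) by eventually_elim (use that in auto)
    then have "?E y = 0"
      by (subst AE_iff_measurable[symmetric, of _ _ "\<lambda>P. \<not> y < d P Q"]) auto
    then show ?thesis using K by (simp add: NZ)
  qed
  have "(\<integral>\<^sup>+h. ennreal (Z h) \<partial>?N) = (\<integral>\<^sup>+h. (\<integral>\<^sup>+y. indicator {0..} y * indicator {..<Z h} y \<partial>lborel) \<partial>?N)"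
  proof (rule nn_integral_cong)
    fix h
    have "ennreal (Z h) = emeasure lborel {0..<Z h}" using Z0[of h] by simp
    also have "\<dots> = (\<integral>\<^sup>+y. indicator {0..<Z h} y \<partial>lborel)" by simp
    also have "\<dots> = (\<integral>\<^sup>+y. indicator {0..} y * indicator {..<Z h} y \<partial>lborel)"
      by (intro nn_integral_cong) (auto simp: indicator_def)
    finally show "ennreal (Z h) = (\<integral>\<^sup>+y. indicator {0..} y * indicator {..<Z h} y \<partial>lborel)" .
  qed
  also have "\<dots> = (\<integral>\<^sup>+y. (\<integral>\<^sup>+h. indicator {0..} y * indicator {..<Z h} y \<partial>?N) \<partial>lborel)"
  proof (rule Fubini'[symmetric])
    have "(\<lambda>(h, y). indicator {0..} y * indicator {..<Z h} y :: ennreal)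
       = (\<lambda>z. indicator {0..} (snd z) * (if snd z < Z (fst z) then 1 else 0))"
      by (auto simp: indicator_def fun_eq_iff)
    also have "\<dots> \<in> borel_measurable (?N \<Otimes>\<^sub>M lborel)" by measurable
    finally show "(\<lambda>(h, y). indicator {0..} y * indicator {..<Z h} y :: ennreal) \<in> borel_measurable (?N \<Otimes>\<^sub>M lborel)" .
  qed
  also have "\<dots> = (\<integral>\<^sup>+y. indicator {0..} y * ?T y \<partial>lborel)"
  proof (rule nn_integral_cong)
    fix y :: real
    have "{h\<in>space ?N. y < Z h} \<in> sets ?N" by measurable
    then have "?T y = (\<integral>\<^sup>+h. indicator {h\<in>space ?N. y < Z h} h \<partial>?N)" by simp
    also have "\<dots> = (\<integral>\<^sup>+h. indicator {..<Z h} y \<partial>?N)" by (intro nn_integral_cong) (auto simp: indicator_def)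
    finally show "(\<integral>\<^sup>+h. indicator {0..} y * indicator {..<Z h} y \<partial>?N)
      = indicator {0..} y * ?T y"
      by (cases "0 \<le> y") simp_all
  qed
  also have "\<dots> \<le> (\<integral>\<^sup>+y. ennreal (exp (- ((real K * b) * y ^ p))) * indicator {0..} y + ennreal (q ^ K) * indicator {0..B} y \<partial>lborel)"
  proof (rule nn_integral_mono)
    fix y :: real
    show "indicator {0..} y * ?T y
       \<le> ennreal (exp (- ((real K * b) * y ^ p))) * indicator {0..} y + ennreal (q ^ K) * indicator {0..B} y"
    proof (cases "0 \<le> y")
      case y: True
      show ?thesis
      proof (cases "y \<le> x0")
        case True
        have "?E y \<le> ennreal (1 - b * y ^ p)" by (rule large[OF y True])
        also have "\<dots> \<le> ennreal (exp (- (b * y ^ p)))"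
          using exp_ge_add_one_self[of "- (b * y ^ p)"] by (intro ennreal_leI) simp
        finally have "?T y \<le> ennreal (exp (- (b * y ^ p))) ^ K"
          unfolding NZ by (rule power_mono) simp
        also have "\<dots> = ennreal (exp (- ((real K * b) * y ^ p)))"
          by (simp add: ennreal_power exp_of_nat_mult[symmetric] mult.assoc)
        finally show ?thesis using y by (simp add: add_increasing2)
      next
        case False
        show ?thesis
        proof (cases "y \<le> B")
          case True
          have "?E y \<le> ?E x0"
            using False by (intro emeasure_mono) auto
          also have "\<dots> \<le> ennreal q" unfolding q_def using x0 by (intro large) auto
          finally have "?T y \<le> ennreal q ^ K"
            unfolding NZ by (rule power_mono) simp
          also have "\<dots> = ennreal (q ^ K)" using q0 by (simp add: ennreal_power)
          finally show ?thesis using y True by (simp add: add_increasing)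
        next
          case False
          then show ?thesis using tail[of y] by simp
        qed
      qed
    qed simp
  qed
  also have "\<dots> = (\<integral>\<^sup>+y. ennreal (exp (- ((real K * b) * y ^ p))) * indicator {0..} y \<partial>lborel)
     + (\<integral>\<^sup>+y. ennreal (q ^ K) * indicator {0..B} y \<partial>lborel)"
    by (rule nn_integral_add) measurable
  also have "(\<integral>\<^sup>+y. ennreal (exp (- ((real K * b) * y ^ p))) * indicator {0..} y \<partial>lborel)
     = ennreal (Gamma (1 / real p) / real p * (real K * b) powr (- 1 / real p))"
    using K b p by (intro nn_integral_exp_power) auto
  also have "(\<integral>\<^sup>+y. ennreal (q ^ K) * indicator {0..B} y \<partial>lborel) = ennreal (B * q ^ K)"
    using B q0 by (subst nn_integral_cmult_indicator) (auto simp: ennreal_mult[symmetric] mult.commute)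
  also have "ennreal (Gamma (1 / real p) / real p * (real K * b) powr (- 1 / real p)) + ennreal (B * q ^ K)
     = ennreal (Gamma (1 / real p) / real p * (real K * b) powr (- 1 / real p) + B * q ^ K)"
    using B q0 p by (intro ennreal_plus[symmetric] mult_nonneg_nonneg divide_nonneg_nonneg less_imp_le[OF Gamma_real_pos]) auto
  finally show ?thesis unfolding Z_def q_def .
qed

text \<open>By Fubini the distortion averaged over random codes is at most R; if all codes with
  words in \<open>S\<close> had distortion above R', the average would be at least R' > R.\<close>

lemma exists_code_le:
  fixes M :: "'b measure" and d :: "'b \<Rightarrow> 'b \<Rightarrow> real"
  assumes M: "prob_space M" and K: "0 < K"
    and d: "case_prod d \<in> borel_measurable (M \<Otimes>\<^sub>M M)" "\<And>P Q. 0 \<le> d P Q"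
    and S: "AE P in M. P \<in> S" "infinite S" "S \<subseteq> space M"
    and R: "0 \<le> R" "AE Q in M. (\<integral>\<^sup>+h. ennreal (Min ((\<lambda>i. d (h i) Q) ` {..<K})) \<partial>PiM {..<K} (\<lambda>_. M)) \<le> ennreal R"
    and R': "R < R'"
  obtains C where "C \<subseteq> S" "finite C" "card C = K" "(\<integral>Q. Min ((\<lambda>P. d P Q) ` C) \<partial>M) \<le> R'"
proof -
  let ?Y = "\<lambda>C Q. Min ((\<lambda>P. d P Q) ` C)"
  interpret M: prob_space M by fact
  let ?N = "PiM {..<K} (\<lambda>_. M)"
  interpret N: prob_space ?N by (intro prob_space_PiM M)
  interpret pair_sigma_finite ?N M by standard
  define Z where "Z h Q = Min ((\<lambda>i. d (h i) Q) ` {..<K})" for h Q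
  have [measurable]: "case_prod Z \<in> borel_measurable (?N \<Otimes>\<^sub>M M)"
  proof -
    have "(\<lambda>z. d (fst z i) (snd z)) \<in> borel_measurable (?N \<Otimes>\<^sub>M M)" if i: "i \<in> {..<K}" for i
    proof -
      have "(\<lambda>z. (fst z i, snd z)) \<in> ?N \<Otimes>\<^sub>M M \<rightarrow>\<^sub>M M \<Otimes>\<^sub>M M"
        by (intro measurable_Pair measurable_snd measurable_compose[OF measurable_fst measurable_component_singleton[OF i]])
      from measurable_compose[OF this d(1)] show ?thesis by simp
    qed
    then have "(\<lambda>z. Min ((\<lambda>i. d (fst z i) (snd z)) ` {..<K})) \<in> borel_measurable (?N \<Otimes>\<^sub>M M)"
      by (intro borel_measurable_Min) auto
    then show ?thesis by (simp add: Z_def split_beta')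
  qed
  have "(\<integral>\<^sup>+h. (\<integral>\<^sup>+Q. ennreal (Z h Q) \<partial>M) \<partial>?N) = (\<integral>\<^sup>+Q. (\<integral>\<^sup>+h. ennreal (Z h Q) \<partial>?N) \<partial>M)"
    by (rule Fubini'[symmetric]) measurable
  also have "\<dots> \<le> (\<integral>\<^sup>+Q. ennreal R \<partial>M)" using R(2) unfolding Z_def by (rule nn_integral_mono_AE)
  also have "\<dots> = ennreal R" using M.emeasure_space_1 by simp
  finally have mean: "(\<integral>\<^sup>+h. (\<integral>\<^sup>+Q. ennreal (Z h Q) \<partial>M) \<partial>?N) \<le> ennreal R" .
  have inS: "AE h in ?N. \<forall>i\<in>{..<K}. h i \<in> S"
    by (rule AE_finite_allI) (auto intro!: AE_PiM_component M S(1))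
  have "\<exists>h. (\<forall>i\<in>{..<K}. h i \<in> S) \<and> (\<integral>\<^sup>+Q. ennreal (Z h Q) \<partial>M) \<le> ennreal R'"
  proof (rule ccontr)
    assume no: "\<not> ?thesis"
    have "ennreal R' = (\<integral>\<^sup>+h. ennreal R' \<partial>?N)" using N.emeasure_space_1 by simp
    also have "\<dots> \<le> (\<integral>\<^sup>+h. (\<integral>\<^sup>+Q. ennreal (Z h Q) \<partial>M) \<partial>?N)"
      using inS by (intro nn_integral_mono_AE, eventually_elim) (use no in \<open>auto simp: not_le intro: less_imp_le\<close>)
    also note mean
    finally show False using R' R(1) by (simp add: ennreal_le_iff)
  qed
  then obtain h where h: "\<And>i. i < K \<Longrightarrow> h i \<in> S" "(\<integral>\<^sup>+Q. ennreal (Z h Q) \<partial>M) \<le> ennreal R'" by auto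
  define C0 where "C0 = h ` {..<K}"
  have C0: "finite C0" "C0 \<subseteq> S" "card C0 \<le> K" "C0 \<noteq> {}"
    unfolding C0_def using h(1) K card_image_le[of "{..<K}" h] by auto
  \<comment> \<open>Random codewords may coincide, while the code must have exactly K elements.
    Adding points of the infinite set \<open>S\<close> can only decrease the minimum.\<close>
  obtain T where T: "T \<subseteq> S - C0" "finite T" "card T = K - card C0"
    using infinite_arbitrarily_large[of "S - C0" "K - card C0"] S(2) C0(1) by auto
  define C where "C = C0 \<union> T"
  have C: "finite C" "C \<subseteq> S" "C0 \<subseteq> C" using C0 T by (auto simp: C_def)
  have "card C = card C0 + card T" unfolding C_def using C0 T by (intro card_Un_disjoint) auto
  then have cardC: "card C = K" using T C0 by simp
  have Cne: "C \<noteq> {}" using C C0 by auto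
  have [measurable]: "d P \<in> borel_measurable M" if "P \<in> C" for P
    using measurable_compose[OF measurable_Pair1'[of P M M] d(1)] that C(2) S(3) by auto
  have Y: "?Y C \<in> borel_measurable M" using C(1) by (intro borel_measurable_Min) auto
  have le: "?Y C Q \<le> Z h Q" for Q
  proof -
    have "?Y C Q \<le> ?Y C0 Q"
      using C C0 by (intro Min_antimono image_mono) auto
    then show ?thesis by (simp add: C0_def Z_def image_image)
  qed
  have "(\<integral>Q. ?Y C Q \<partial>M) \<le> R'"
  proof -
    have "(\<integral>Q. ?Y C Q \<partial>M) = enn2real (\<integral>\<^sup>+Q. ennreal (?Y C Q) \<partial>M)"
      using Y C Cne d(2) by (intro integral_eq_nn_integral) (auto simp: Min_ge_iff)
    also have "\<dots> \<le> R'"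
    proof (rule enn2real_leI)
      have "(\<integral>\<^sup>+Q. ennreal (?Y C Q) \<partial>M) \<le> (\<integral>\<^sup>+Q. ennreal (Z h Q) \<partial>M)"
        using le by (intro nn_integral_mono ennreal_leI)
      then show "(\<integral>\<^sup>+Q. ennreal (?Y C Q) \<partial>M) \<le> ennreal R'" using h(2) by (rule order_trans)
    qed (use R R' in simp)
    finally show ?thesis .
  qed
  then show thesis using C cardC that by blast
qed

section \<open>Asymptotics of the distortion rate\<close>

lemma limsup_le_oneI:
  fixes f :: "nat \<Rightarrow> real"
  assumes "\<And>r. 1 < r \<Longrightarrow> eventually (\<lambda>K. f K \<le> r) sequentially"
  shows "limsup (\<lambda>K. ereal (f K)) \<le> 1"
proof (rule ereal_le_epsilon2)
  fix e :: real assume "0 < e"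
  then have "eventually (\<lambda>K. f K \<le> 1 + e) sequentially" by (intro assms) simp
  then have "eventually (\<lambda>K. ereal (f K) \<le> ereal (1 + e)) sequentially" by simp
  then have "limsup (\<lambda>K. ereal (f K)) \<le> ereal (1 + e)" by (rule Limsup_bounded)
  then show "limsup (\<lambda>K. ereal (f K)) \<le> 1 + ereal e" by (simp add: one_ereal_def)
qed

lemma two_powr_log: "0 < K \<Longrightarrow> 2 powr (- log 2 (real K) / q) = real K powr (- 1 / q)"
proof -
  assume K: "0 < K"
  have "2 powr (- log 2 (real K) / q) = (2 powr log 2 (real K)) powr (- 1 / q)"
    by (simp add: powr_powr)
  then show ?thesis using K by simp
qed

text \<open>The geometry is reduced here to a bounded symmetric distortion whose sublevel sets
  around points of \<open>S\<close> have measure c x^p up to a factor tending to 1 uniformly in the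
  centre.\<close>

lemma quantization_asymptotics:
  fixes M :: "'b measure" and d :: "'b \<Rightarrow> 'b \<Rightarrow> real"
  assumes M: "prob_space M"
    and d: "case_prod d \<in> borel_measurable (M \<Otimes>\<^sub>M M)" "\<And>P Q. 0 \<le> d P Q" "\<And>P Q. d P Q = d Q P" "\<And>P. d P P = 0"
    and S: "AE P in M. P \<in> S" "S \<subseteq> space M" "\<And>P Q. P \<in> S \<Longrightarrow> Q \<in> S \<Longrightarrow> d P Q \<le> B"
    and p: "0 < p" and c: "0 < c"
    and ball: "\<And>\<rho>. 1 < \<rho> \<Longrightarrow> \<exists>x0>0. \<forall>P\<in>S. \<forall>x. 0 \<le> x \<longrightarrow> x \<le> x0 \<longrightarrow>
        emeasure M (sublevel M (d P) x) \<le> ennreal (\<rho> * c * x ^ p) \<and>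
        ennreal (c / \<rho> * x ^ p) \<le> emeasure M (sublevel M (d P) x)"
  defines "D \<equiv> \<lambda>K. INF C\<in>{C. C \<subseteq> S \<and> finite C \<and> card C = K}. \<integral>Q. Min ((\<lambda>P. d P Q) ` C) \<partial>M"
  shows "limsup (\<lambda>K. ereal ((real p / (real p + 1) * c powr (- 1 / real p) * 2 powr (- log 2 (real K) / real p)) / D K)) \<le> 1"
    and "limsup (\<lambda>K. ereal (D K / (Gamma (1 / real p) / real p * c powr (- 1 / real p) * 2 powr (- log 2 (real K) / real p)))) \<le> 1"
proof -
  let ?c = "c powr (- 1 / real p)"
  let ?lower = "\<lambda>K. real p / (real p + 1) * ?c * 2 powr (- log 2 (real K) / real p)"
  let ?e = "\<lambda>C. \<integral>Q. Min ((\<lambda>P. d P Q) ` C) \<partial>M"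
  interpret prob_space M by fact
  have dm: "d P \<in> borel_measurable M" if "P \<in> S" for P
    using measurable_compose[OF measurable_Pair1'[of P M M] d(1)] that S(2) by auto
  \<comment> \<open>Sublevel sets at 0 are null because 0^p = 0; if \<open>S\<close> were finite,
    almost every point of \<open>S\<close> would avoid all of them, although d P P = 0. Infinity of
    \<open>S\<close> guarantees codes of every size K, so the infimum is over a nonempty
    set.\<close>
  have infS: "infinite S"
  proof
    assume fin: "finite S"
    obtain x0 where x0: "x0 > 0" "\<forall>P\<in>S. \<forall>x. 0 \<le> x \<longrightarrow> x \<le> x0 \<longrightarrow>
        emeasure M (sublevel M (d P) x) \<le> ennreal (2 * c * x ^ p) \<and>
        ennreal (c / 2 * x ^ p) \<le> emeasure M (sublevel M (d P) x)"
      using ball[of 2] by auto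
    have "AE Q in M. \<not> d P Q \<le> 0" if P: "P \<in> S" for P
    proof -
      note dm[OF P, measurable]
      have "emeasure M (sublevel M (d P) 0) \<le> ennreal (2 * c * 0 ^ p)"
        using x0 P by (meson less_imp_le order_refl)
      then have "emeasure M (sublevel M (d P) 0) = 0" by (simp add: zero_power[OF p])
      then show ?thesis by (subst AE_iff_measurable[of "sublevel M (d P) 0"]) auto
    qed
    then have "AE Q in M. \<forall>P\<in>S. \<not> d P Q \<le> 0" by (intro AE_finite_allI fin)
    with S(1) have "AE Q in M. False" by eventually_elim (use d(4) in auto)
    then show False using AE_False by simp
  qed
  have bounded: "AE Q in M. d P Q \<le> B" if "P \<in> S" for P
    using S(1) by eventually_elim (use S(3) that in auto)
  obtain P0 where P0: "P0 \<in> S" using infS by (metis finite.emptyI ex_in_conv)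
  have B: "0 \<le> B" using S(3)[OF P0 P0] d(4) by simp
  let ?C = "\<lambda>K. {C. C \<subseteq> S \<and> finite C \<and> card C = K}"
  have C_ne: "?C K \<noteq> {}" for K using infinite_arbitrarily_large[OF infS, of K] by auto
  have Min0: "0 \<le> ?e C" if "C \<in> ?C K" "0 < K" for C K
  proof (rule Bochner_Integration.integral_nonneg)
    have "C \<noteq> {}" using that by auto
    then show "0 \<le> Min ((\<lambda>P. d P Q) ` C)" for Q using that d(2) by (subst Min_ge_iff) auto
  qed
  show "limsup (\<lambda>K. ereal ((?lower K) / D K)) \<le> 1"
  proof (rule limsup_le_oneI)
    fix r :: real assume r: "1 < r"
    \<comment> \<open>The volume constant enters the bound through c^(-1/p), so an error factor r^p
      there becomes exactly r in the result.\<close>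
    have rp: "1 < r ^ p" using r p by (rule one_less_power)
    obtain x0 where x0: "x0 > 0" and x0_ball: "\<And>P x. P \<in> S \<Longrightarrow> 0 \<le> x \<Longrightarrow> x \<le> x0 \<Longrightarrow>
        emeasure M (sublevel M (d P) x) \<le> ennreal (r ^ p * c * x ^ p)"
      using ball[OF rp] by blast
    define a where "a = r ^ p * c"
    have a: "0 < a" using r c by (simp add: a_def)
    \<comment> \<open>The maximizer of x - K a x^(p+1) / (p+1), characterized by K a x^p = 1; the
      maximum is x p / (p+1). It tends to 0, so it is eventually in the range of the ball
      estimate.\<close>
    define x1 where "x1 K = (real K * a) powr (- 1 / real p)" for K
    have "(\<lambda>K. (real K * a) powr (- 1 / real p)) \<longlonglongrightarrow> 0"
      using a p by (intro tendsto_neg_powr filterlim_at_top_mult_tendsto_pos[OF tendsto_const] filterlim_real_sequentially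
          filterlim_tendsto_pos_mult_at_top[OF tendsto_const]) (auto simp: divide_neg_pos)
    then have "eventually (\<lambda>K. x1 K < x0) sequentially"
      unfolding x1_def using x0 by (rule order_tendstoD(2))
    \<comment> \<open>For K = 0 the only code is empty and \<open>Min\<close> of the empty set is
      unspecified, so K > 0 is included among the eventual conditions.\<close>
    then show "eventually (\<lambda>K. (?lower K) / D K \<le> r) sequentially"
      using eventually_gt_at_top[of 0]
    proof eventually_elim
      case (elim K)
      have x1: "0 < x1 K" using elim a by (simp add: x1_def)
      have "x1 K ^ p = (real K * a) powr (- 1)"
        using x1 p by (simp add: x1_def powr_realpow[symmetric] powr_powr)
      then have Kx: "real K * (a * x1 K ^ p) = 1"
        using elim a by (simp add: powr_minus field_simps)
      have lower: "x1 K * (real p / (real p + 1)) \<le> ?e C" if C: "C \<in> ?C K" for C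
      proof -
        have CS: "P \<in> S" if "P \<in> C" for P using that C by auto
        have "x1 K - real (card C) * (a * x1 K ^ Suc p / real (Suc p)) \<le> ?e C"
        proof (rule Min_code_lower_bound[OF M, where B=B])
          show "C \<noteq> {}" using C elim by auto
          show "emeasure M (sublevel M (d P) y) \<le> ennreal (a * y ^ p)" if "P \<in> C" "0 \<le> y" "y \<le> x1 K" for P y
            unfolding a_def using that elim CS by (intro x0_ball) auto
        qed (use C CS dm d(2) bounded x1 a in auto)
        moreover have "real (card C) * (a * x1 K ^ Suc p / real (Suc p)) = x1 K / (real p + 1)"
        proof -
          have "real (card C) * (a * x1 K ^ Suc p / real (Suc p)) = (real K * (a * x1 K ^ p)) * x1 K / (real p + 1)"
            using C by (simp add: ac_simps)
          then show ?thesis by (simp only: Kx mult_1)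
        qed
        moreover have "x1 K - x1 K / (real p + 1) = x1 K * (real p / (real p + 1))"
          by (simp add: field_simps)
        ultimately show ?thesis by simp
      qed
      have D: "x1 K * (real p / (real p + 1)) \<le> D K"
        unfolding D_def by (rule cINF_greatest[OF C_ne lower])
      have "?c * real K powr (- 1 / real p) = r * x1 K"
      proof -
        have "x1 K = (real K * c) powr (- 1 / real p) * (r ^ p) powr (- 1 / real p)"
          using r c by (simp add: x1_def a_def powr_mult[symmetric] ac_simps)
        also have "(r ^ p) powr (- 1 / real p) = 1 / r"
          using r p by (simp add: powr_realpow[symmetric] powr_powr powr_minus_divide)
        finally show ?thesis using r c by (simp add: powr_mult ac_simps)
      qed
      then have "?lower K
         = r * (x1 K * (real p / (real p + 1)))"
        unfolding two_powr_log[OF elim(2)] by (simp add: ac_simps)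
      also have "\<dots> \<le> r * D K" using D r by (intro mult_left_mono) auto
      finally have "?lower K \<le> r * D K" .
      moreover have "0 < D K" using D x1 p by (smt (verit) divide_pos_pos mult_pos_pos of_nat_0_less_iff)
      ultimately show ?case by (simp only: pos_divide_le_eq)
    qed
  qed
  show "limsup (\<lambda>K. ereal (D K / (Gamma (1 / real p) / real p * ?c * 2 powr (- log 2 (real K) / real p)))) \<le> 1"
  proof (rule limsup_le_oneI)
    fix r :: real assume r: "1 < r"
    \<comment> \<open>The slack r - 1 is divided evenly: s absorbs the error of the volume constant,
      and (r - 1) / 2 is left for the exponential remainder.\<close>
    define s where "s = (1 + r) / 2"
    have s: "1 < s" using r by (simp add: s_def)
    have sp: "1 < s ^ p" using s p by (rule one_less_power)
    obtain x0 where x0: "x0 > 0" and x0_ball: "\<And>P x. P \<in> S \<Longrightarrow> 0 \<le> x \<Longrightarrow> x \<le> x0 \<Longrightarrow>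
        ennreal (c / s ^ p * x ^ p) \<le> emeasure M (sublevel M (d P) x)"
      using ball[OF sp] by blast
    define b where "b = c / s ^ p"
    have b: "0 < b" using s c by (simp add: b_def)
    define q where "q = 1 - b * x0 ^ p"
    have q: "0 \<le> q" "q < 1"
    proof -
      have "ennreal (b * x0 ^ p) \<le> 1"
        using x0_ball[OF P0, of x0] x0 emeasure_le_1 unfolding b_def by (meson less_imp_le order_refl order_trans)
      then show "0 \<le> q" using b x0 by (simp add: q_def)
      show "q < 1" using b x0 by (simp add: q_def)
    qed
    define G where "G = Gamma (1 / real p) / real p * ?c"
    have G: "0 < G" unfolding G_def using p c by (intro mult_pos_pos divide_pos_pos Gamma_real_pos) auto
    \<comment> \<open>Relative to the main term the remainder is a constant times K^(1/p) q^K, which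
      is at most the same constant times K q^K and tends to 0.\<close>
    have "(\<lambda>K. B / G * (real K * q ^ K)) \<longlonglongrightarrow> B / G * 0"
      using q by (intro tendsto_mult_left powser_times_n_limit_0) simp
    moreover have "B / G * 0 < (r - 1) / 2" using r by simp
    ultimately have "eventually (\<lambda>K. B / G * (real K * q ^ K) < (r - 1) / 2) sequentially"
      by (rule order_tendstoD(2))
    then show "eventually (\<lambda>K. D K / (Gamma (1 / real p) / real p * ?c * 2 powr (- log 2 (real K) / real p)) \<le> r) sequentially"
      using eventually_gt_at_top[of 0]
    proof eventually_elim
      case (elim K)
      define u where "u = real K powr (- 1 / real p)"
      have u: "0 < u" using elim by (simp add: u_def)
      define R where "R = Gamma (1 / real p) / real p * (real K * b) powr (- 1 / real p) + B * q ^ K"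
      have Gam: "0 < Gamma (1 / real p) / real p" using p by (intro divide_pos_pos Gamma_real_pos) auto
      have R0: "0 \<le> R" unfolding R_def using B q Gam by (intro add_nonneg_nonneg mult_nonneg_nonneg) auto
      have AE_code: "AE Q in M. (\<integral>\<^sup>+h. ennreal (Min ((\<lambda>i. d (h i) Q) ` {..<K})) \<partial>PiM {..<K} (\<lambda>_. M)) \<le> ennreal R"
        using S(1)
      proof eventually_elim
        case Q: (elim Q)
        show ?case unfolding R_def q_def
        proof (rule random_code_bound[OF M elim(2) p b x0 B])
          show "(\<lambda>P. d P Q) \<in> borel_measurable M" using dm[OF Q] by (simp add: d(3)[of _ Q])
          show "AE P in M. d P Q \<le> B" using bounded[OF Q] by (simp add: d(3)[of _ Q])
          show "ennreal (b * y ^ p) \<le> emeasure M {P\<in>space M. d P Q \<le> y}" if "0 \<le> y" "y \<le> x0" for y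
            using x0_ball[OF Q that] by (simp add: d(3)[of _ Q] b_def)
        qed (rule d(2))
      qed
      have "D K \<le> R"
      \<comment> \<open>Codes are obtained only for each R' strictly above the mean R; the infimum
        then lies below R itself.\<close>
      proof (rule dense_ge)
        fix R' assume "R < R'"
        then obtain C where C: "C \<subseteq> S" "finite C" "card C = K" "?e C \<le> R'"
          using exists_code_le[OF M elim(2) d(1,2) S(1) infS S(2) R0 AE_code] by blast
        have "D K \<le> ?e C"
          unfolding D_def
        proof (rule cINF_lower)
          show "bdd_below (?e ` ?C K)"
            using Min0[OF _ elim(2)] by (intro bdd_belowI2[where m=0]) auto
        qed (use C in auto)
        then show "D K \<le> R'" using C(4) by simp
      qed
      also have "R = G * u * s + B * q ^ K"
      proof -
        have "(real K * b) powr (- 1 / real p) = u * (?c * s)"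
        proof -
          have "(real K * b) powr (- 1 / real p) = (real K * (c * (1 / s ^ p))) powr (- 1 / real p)"
            by (simp add: b_def)
          also have "\<dots> = u * (c * (1 / s ^ p)) powr (- 1 / real p)"
            unfolding u_def by (rule powr_mult)
          also have "(c * (1 / s ^ p)) powr (- 1 / real p) = ?c * (1 / s ^ p) powr (- 1 / real p)"
            by (rule powr_mult)
          also have "(1 / s ^ p) powr (- 1 / real p) = s"
          proof -
            have "1 / s ^ p = s powr (- real p)" using s by (simp add: powr_minus_divide powr_realpow)
            then show ?thesis using s p by (simp add: powr_powr)
          qed
          finally show ?thesis .
        qed
        then show ?thesis by (simp add: R_def G_def ac_simps)
      qed
      finally have "D K / (G * u) \<le> (G * u * s + B * q ^ K) / (G * u)"
        using G u by (intro divide_right_mono) auto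
      also have "\<dots> = s + B / G * ((1 / u) * q ^ K)"
        using G u by (simp add: field_simps)
      also have "\<dots> \<le> s + B / G * (real K * q ^ K)"
      proof -
        have "1 / u = real K powr (1 / real p)" using elim by (simp add: u_def powr_minus_divide)
        also have "\<dots> \<le> real K powr 1" using elim p by (intro powr_mono) auto
        finally have "1 / u \<le> real K" using elim by simp
        then show ?thesis using B G q by (intro add_left_mono mult_left_mono mult_right_mono) auto
      qed
      also have "\<dots> \<le> r" using elim(1) by (simp add: s_def field_simps)
      finally show ?case unfolding two_powr_log[OF elim(2)] G_def[symmetric] u_def .
    qed
  qed
qed

theorem theorem2:
  fixes m k :: nat and \<mu> :: "(complex^'n^'n) measure"
  assumes "1 \<le> m" and "m < CARD('n)" and "1 \<le> k"
    and "uniform_grassmann m \<mu>"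
  defines "t \<equiv> m * (CARD('n) - m)"
  defines "A \<equiv> ((Gamma (real t + 1)) ^ k / Gamma (real (k * t) + 1)
                  * (eta_const CARD('n) m) ^ k) powr (- 1 / real (k * t))"
  shows "limsup (\<lambda>K. ereal ((real (k * t) / (real (k * t) + 1) * A
                       * 2 powr (- log 2 (real K) / real (k * t)))
                     / distortion_rate k m \<mu> K)) \<le> 1 \<and>
         limsup (\<lambda>K. ereal (distortion_rate k m \<mu> K
                     / (Gamma (1 / real (k * t)) / real (k * t) * A
                        * 2 powr (- log 2 (real K) / real (k * t))))) \<le> 1"
proof -
  note U = uniform_grassmannD[OF assms(4)]
  \<comment> \<open>The codimension n - m is written as a successor because the index of an Erlang
    density is its shape parameter minus one.\<close>
  obtain r where n: "CARD('n) = m + Suc r" using assms(2) by (metis less_iff_Suc_add add_Suc_right)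
  have t: "t = Suc r * m" by (simp add: t_def n mult.commute)
  have t0: "0 < t" using assms(1) by (simp add: t)
  then obtain t' where t': "t = Suc t'" by (cases t) auto
  define \<eta> where "\<eta> = eta_const CARD('n) m"
  have \<eta>: "\<eta> = gs_coeff (Suc r) m m" unfolding \<eta>_def n by (rule eta_const_eq_gs_coeff)
  have \<eta>0: "0 < \<eta>" unfolding \<eta> by (rule gs_coeff_pos)
  define c where "c = (Gamma (real t + 1)) ^ k / Gamma (real (k * t) + 1) * \<eta> ^ k"
  have c: "c = \<eta> ^ k * (fact t ^ k / fact (t * k))"
    using Gamma_fact[of t, where ?'a=real] Gamma_fact[of "k * t", where ?'a=real]
    by (simp add: c_def add.commute mult.commute)
  have c0: "0 < c" unfolding c using \<eta>0 by simp
  define M where "M = comp_uniform k \<mu>"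
  have M_eq: "M = PiM {..<k} (\<lambda>_. \<mu>)" by (simp add: M_def comp_uniform_def)
  define d where "d P Q = (comp_chordal_dist k P Q)\<^sup>2" for P Q :: "nat \<Rightarrow> complex^'n^'n"
  have d: "d P Q = (\<Sum>i<k. (chordal_dist (P i) (Q i))\<^sup>2)" for P Q
    by (simp add: d_def comp_chordal_dist_def sum_nonneg)
  define S where "S = (comp_grassmann k m :: (nat \<Rightarrow> complex^'n^'n) set)"
  have M: "prob_space M" unfolding M_eq by (intro prob_space_PiM U(2))
  have d_meas: "case_prod d \<in> borel_measurable (M \<Otimes>\<^sub>M M)"
  proof -
    have comp: "(\<lambda>P. P i) \<in> borel_measurable M" if "i \<in> {..<k}" for i
      using measurable_component_singleton[OF that, of "\<lambda>_. \<mu>"]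
      by (simp add: M_eq measurable_cong_sets[OF refl U(1)])
    have "(\<lambda>z. \<Sum>i<k. (norm (fst z i - snd z i))\<^sup>2 / 2) \<in> borel_measurable (M \<Otimes>\<^sub>M M)"
    proof (rule borel_measurable_sum)
      fix i assume i: "i \<in> {..<k}"
      have [measurable]: "(\<lambda>z. fst z i) \<in> borel_measurable (M \<Otimes>\<^sub>M M)" "(\<lambda>z. snd z i) \<in> borel_measurable (M \<Otimes>\<^sub>M M)"
        by (rule measurable_compose[OF measurable_fst comp[OF i]], rule measurable_compose[OF measurable_snd comp[OF i]])
      show "(\<lambda>z. (norm (fst z i - snd z i))\<^sup>2 / 2) \<in> borel_measurable (M \<Otimes>\<^sub>M M)" by measurable
    qed
    then show ?thesis by (simp add: d chordal_dist_power2_eq split_beta')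
  qed
  have AE_S: "AE P in M. P \<in> S"
  proof -
    have "AE P in M. \<forall>i\<in>{..<k}. P i \<in> grassmann m"
      unfolding M_eq by (rule AE_finite_allI) (auto intro!: AE_PiM_component U(2,4))
    with AE_space show ?thesis
      by eventually_elim (auto simp: S_def comp_grassmann_def M_eq space_PiM PiE_iff)
  qed
  have S_space: "S \<subseteq> space M"
    by (auto simp: S_def comp_grassmann_def M_eq space_PiM U(3) PiE_iff)
  have SP: "P i \<in> grassmann m" if "P \<in> S" "i < k" for P i
    using that by (auto simp: S_def comp_grassmann_def)
  have bound: "d P Q \<le> real k * real m" if "P \<in> S" "Q \<in> S" for P Q
  proof -
    have "d P Q \<le> (\<Sum>i<k. real m)" unfolding d
      using that by (intro sum_mono chordal_dist_power2_le SP) auto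
    then show ?thesis by simp
  qed
  have ball: "\<exists>x0>0. \<forall>P\<in>S. \<forall>x. 0 \<le> x \<longrightarrow> x \<le> x0 \<longrightarrow>
        emeasure M (sublevel M (d P) x) \<le> ennreal (\<rho> * c * x ^ (k * t)) \<and>
        ennreal (c / \<rho> * x ^ (k * t)) \<le> emeasure M (sublevel M (d P) x)" if \<rho>: "1 < \<rho>" for \<rho>
  proof -
    let ?n = "real CARD('n)"
    \<comment> \<open>All error factors tend to 1 as x0 tends to 0 from the right. For k factors the
      upper error has the exponent t k, with t = m (n - m), and the lower error has the exponent m
      k; one x0 is chosen that meets both requirements.\<close>
    have "((\<lambda>x. (1 / (1 - 2 * x)) ^ (t * k)) \<longlongrightarrow> (1 / (1 - 2 * 0)) ^ (t * k)) (at_right (0::real))"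
      by (intro tendsto_intros) auto
    then have e1: "eventually (\<lambda>x. (1 / (1 - 2 * x)) ^ (t * k) < \<rho>) (at_right (0::real))"
      using \<rho> by (intro order_tendstoD(2)) auto
    have "((\<lambda>x. (1 - ?n * x) ^ (m * k)) \<longlongrightarrow> (1 - ?n * 0) ^ (m * k)) (at_right (0::real))"
      by (intro tendsto_intros)
    then have e2: "eventually (\<lambda>x. 1 / \<rho> < (1 - ?n * x) ^ (m * k)) (at_right (0::real))"
      using \<rho> by (intro order_tendstoD(1)) auto
    have "((\<lambda>x. ?n * x) \<longlongrightarrow> ?n * 0) (at_right (0::real))" by (intro tendsto_intros)
    then have e3: "eventually (\<lambda>x. ?n * x < 1) (at_right (0::real))"
      by (intro order_tendstoD(2)) auto
    have e4: "eventually (\<lambda>x. x < 1 / 2) (at_right (0::real))"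
      by (rule eventually_mono[OF eventually_at_right_real[of 0 "1 / 2"]]) auto
    have e5: "eventually (\<lambda>x. 0 < x) (at_right (0::real))" by (rule eventually_at_right_less)
    have "eventually (\<lambda>x. 0 < x \<and> x < 1 / 2 \<and> ?n * x < 1 \<and> (1 / (1 - 2 * x)) ^ (t * k) < \<rho> \<and> 1 / \<rho> < (1 - ?n * x) ^ (m * k)) (at_right (0::real))"
      using e1 e2 e3 e4 e5 by eventually_elim auto
    from eventually_happens'[OF trivial_limit_at_right_real this]
    obtain x0 where x0: "0 < x0" "x0 < 1 / 2" "?n * x0 < 1"
      "(1 / (1 - 2 * x0)) ^ (t * k) < \<rho>" "1 / \<rho> < (1 - ?n * x0) ^ (m * k)"
      by blast
    define a where "a = (1 / (1 - 2 * x0)) ^ t * \<eta>"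
    define b where "b = (1 - ?n * x0) ^ m * \<eta>"
    have ab: "0 \<le> a" "0 \<le> b" using x0 \<eta>0 by (simp_all add: a_def b_def)
    have tk: "t * k = k * t" by (rule mult.commute)
    have a_le: "a ^ k * (fact t ^ k / fact (t * k)) \<le> \<rho> * c"
    proof -
      have "a ^ k * (fact t ^ k / fact (t * k)) = (1 / (1 - 2 * x0)) ^ (t * k) * c"
        by (simp only: a_def c power_mult_distrib power_mult mult.assoc)
      also have "\<dots> \<le> \<rho> * c" using x0(4) c0 by (intro mult_right_mono) auto
      finally show ?thesis .
    qed
    have b_le: "c / \<rho> \<le> b ^ k * (fact t ^ k / fact (t * k))"
    proof -
      have "c / \<rho> = 1 / \<rho> * c" by simp
      also have "\<dots> \<le> (1 - ?n * x0) ^ (m * k) * c" using x0(5) c0 by (intro mult_right_mono) auto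
      also have "\<dots> = b ^ k * (fact t ^ k / fact (t * k))"
        by (simp only: b_def c power_mult_distrib power_mult mult.assoc)
      finally show ?thesis .
    qed
    show ?thesis
    proof (intro exI[of _ x0] conjI ballI allI impI)
      show "0 < x0" by (rule x0)
      fix P x assume P: "P \<in> S" and x: "0 \<le> x" "x \<le> x0"
      have set: "sublevel M (d P) x = {Q \<in> space (PiM {..<k} (\<lambda>_. \<mu>)). (\<Sum>i<k. (chordal_dist (P i) (Q i))\<^sup>2) \<le> x}"
        by (simp add: d M_eq)
      have ball1: "emeasure \<mu> (chordal_ball (P i) y) \<le> ennreal (a * y ^ t)"
        "ennreal (b * y ^ t) \<le> emeasure \<mu> (chordal_ball (P i) y)"
        if "0 \<le> y" "y \<le> x0" "i < k" for i y
        using chordal_ball_bounds[OF assms(4) SP[OF P that(3)] n x0(2,3) that(1,2)]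
        unfolding a_def b_def \<eta> t by simp_all
      note bounds = comp_chordal_ball_bounds[OF U(1,2) t' ab ball1 x order_refl]
      have "emeasure M (sublevel M (d P) x) \<le> ennreal (a ^ k * (fact t ^ k / fact (t * k)) * x ^ (t * k))"
        unfolding set unfolding M_eq by (rule bounds(1))
      also have "\<dots> \<le> ennreal (\<rho> * c * x ^ (k * t))"
        unfolding tk using a_le[unfolded tk] x by (intro ennreal_leI mult_right_mono) auto
      finally show "emeasure M (sublevel M (d P) x) \<le> ennreal (\<rho> * c * x ^ (k * t))" .
      have "ennreal (c / \<rho> * x ^ (k * t)) \<le> ennreal (b ^ k * (fact t ^ k / fact (t * k)) * x ^ (t * k))"
        unfolding tk using b_le[unfolded tk] x by (intro ennreal_leI mult_right_mono) auto
      also have "\<dots> \<le> emeasure M (sublevel M (d P) x)"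
        unfolding set unfolding M_eq by (rule bounds(2))
      finally show "ennreal (c / \<rho> * x ^ (k * t)) \<le> emeasure M (sublevel M (d P) x)" .
    qed
  qed
  have D: "distortion_rate k m \<mu> K = (INF C\<in>{C. C \<subseteq> S \<and> finite C \<and> card C = K}. \<integral>Q. Min ((\<lambda>P. d P Q) ` C) \<partial>M)" for K
    by (simp add: distortion_rate_def S_def d_def M_def)
  have A: "A = c powr (- 1 / real (k * t))" by (simp only: A_def c_def \<eta>_def)
  have d0: "0 \<le> d P Q" and dc: "d P Q = d Q P" and dd: "d P P = 0" for P Q
  proof -
    show "0 \<le> d P Q" by (simp add: d_def)
    show "d P Q = d Q P" unfolding d by (intro sum.cong refl) (simp add: chordal_dist_power2_eq norm_minus_commute)
    show "d P P = 0" by (simp add: d chordal_dist_power2_eq)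
  qed
  have kt: "0 < k * t" using t0 assms(3) by simp
  show ?thesis
    unfolding D A
    using quantization_asymptotics[OF M d_meas d0 dc dd AE_S S_space bound kt c0 ball] by blast
qed

end
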